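(* Let $D\subset\mathbb{C}^n$ be an open invariant set, $f\in\mathcal{SR}(\Omega_D)$ and $m\in\{1,\dots,n-1\}$. Then for every $K\in\mathcal{P}(m)$ the function $\mathcal{S}^{\llbracket m\rrbracket}_K(f)$ satisfies: 1. $\partial_{x_m}\big(\mathcal{S}^{\llbracket m\rrbracket}_K(f)\big)\in\mathcal{AM}_m(\Omega_D)$; 2. $\Delta_{m+1}\big(\mathcal{S}^{\llbracket m\rrbracket}_K(f)\big)\in\mathcal{AM}_{m+1}(\Omega_D)$.
   Context: Sets and products. $\mathbb{H}$ denotes the quaternions, $\mathbb{S}_\mathbb{H}=\{J\in\mathbb{H}: J^2=-1\}$, $\mathcal{P}(m)$ is the power set of $\llbracket m\rrbracket:=\{1,\dots,m\}$. For $K=\{k_1<\dots<k_p\}$ and quaternions $q_k$, $q_K:=q_{k_1}\cdots q_{k_p}$ (increasing order), $q_\emptyset:=1$. For $z\in\mathbb{C}^n$ write $z_h=\alpha_h+i\beta_h$ with $\alpha_h,\beta_h\in\mathbb{R}$, and let $\overline z^h$ be $z$ with $z_h$ replaced by $\overline{z_h}$. Stem and slice functions. $D\subset\mathbb{C}^n$ is invariant if $z\in D\iff\overline z^h\in D$ for all $h$. Let $\{e_K\}_{K\in\mathcal{P}(n)}$ be a basis of $\mathbb{R}^{2^n}$, $e_\emptyset=1$, $e_h:=e_{\{h\}}$. A stem function on $D$ is a continuous $F=\sum_{K\in\mathcal{P}(n)}e_KF_K:D\to\mathbb{H}\otimes\mathbb{R}^{2^n}$ ($F_K$ $\mathbb{H}$-valued)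 with $F_K(\overline z^h)=(-1)^{|K\cap\{h\}|}F_K(z)$ for all $K,h$. The circularization of $D$ is $\Omega_D=\{(\alpha_1+J_1\beta_1,\dots,\alpha_n+J_n\beta_n): (\alpha_1+i\beta_1,\dots,\alpha_n+i\beta_n)\in D,\ J_1,\dots,J_n\in\mathbb{S}_\mathbb{H}\}$. $F$ induces the slice function $f=\mathcal{I}(F):\Omega_D\to\mathbb{H}$, $f(x)=\sum_{K}J_KF_K(z)$ for $x=(\alpha_h+J_h\beta_h)_h$, $z=(\alpha_h+i\beta_h)_h$; the stem function $F$ is determined by $f$. $\mathcal{S}(\Omega_D)$ is the set of slice functions on $\Omega_D$. Product: $(F\otimes G)(z)=\sum_{H,K}(-1)^{|H\cap K|}e_{K\Delta H}F_K(z)G_H(z)$ ($\Delta$ = symmetric difference) and $\mathcal{I}(F)\odot\mathcal{I}(G):=\mathcal{I}(F\otimes G)$. The coordinate function $x_j$ is the slice function induced by $Z_j(z)=\alpha_j+e_j\beta_j$; $x_K$ is the ordered product of the $x_k$, $k\in K$. Regularity. $\mathcal{J}_h(q\otimes e_K)=(-1)^{|K\cap\{h\}|}q\otimes e_{K\Delta\{h\}}$ and $\overline\partial_h=\frac12(\partial/\partial\alpha_h+\mathcal{J}_h\,\partial/\partial\beta_h)$. A $C^1$ stem function $F$ is holomorphic if $\overline\partial_hF=0$ for every $h=1,\dots,n$; $f=\mathcal{I}(F)$ is slice regular if $F$ is holomorphic. $\mathcal{SR}(\Omega_D)$ is the set of slice regular functions. Spherical derivatives and components. For $H\in\mathcal{P}(n)$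 let $H^c=\{1,\dots,n\}\setminus H$, $D_H=\{z\in D:\beta_h\ne0\ \forall h\in H\}$, $\Omega_{D_H}$ its circularization, and for $f=\mathcal{I}(F)\in\mathcal{S}(\Omega_D)$ let $f'_{s,H}=\mathcal{I}(F'_H)\in\mathcal{S}(\Omega_{D_H})$, where $F'_H(z)=\big(\prod_{h\in H}\beta_h\big)^{-1}\sum_{K\subset H^c}e_KF_{K\cup H}(z)$. For $K\subset\llbracket m\rrbracket$ define $\mathcal{S}^{\llbracket m\rrbracket}_K(f):=(x_K\odot f)'_{s,\llbracket m\rrbracket}$ on $\Omega_{D_{\llbracket m\rrbracket}}$. When $f$ is slice regular, $\mathcal{S}^{\llbracket m\rrbracket}_K(f)$ extends continuously (in a unique way) to $\Omega_D$ and the extension is denoted by the same symbol. Operators. Writing $x_h=\alpha_h+i\beta_h+j\gamma_h+k\delta_h$ in real coordinates, $\partial_{x_h}=\frac12(\partial_{\alpha_h}-i\partial_{\beta_h}-j\partial_{\gamma_h}-k\partial_{\delta_h})$, $\overline\partial_{x_h}=\frac12(\partial_{\alpha_h}+i\partial_{\beta_h}+j\partial_{\gamma_h}+k\partial_{\delta_h})$, and $\Delta_h=\partial^2_{\alpha_h}+\partial^2_{\beta_h}+\partial^2_{\gamma_h}+\partial^2_{\delta_h}$. $\mathcal{AM}_h(\Omega_D)=\{g\in\mathcal{S}(\Omega_D): g\in C^1(\Omega_D),\ \overline\partial_{x_h}g=0\}$ is the set of $x_h$-axially monogenic functions. *)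

theory Defs
  imports "HOL-Analysis.Analysis"
begin

section \<open>Quaternions\<close>

text \<open>Real coordinates with respect to the basis \<open>1, i, j, k\<close>. The norm is the Euclidean one, so that
  continuity and differentiability have their usual meaning.\<close>

codatatype quat = Quat (q0: real) (q1: real) (q2: real) (q3: real)

lemma quat_eq_iff: "x = y \<longleftrightarrow> q0 x = q0 y \<and> q1 x = q1 y \<and> q2 x = q2 y \<and> q3 x = q3 y"
  by (auto intro: quat.expand)

instantiation quat :: ring_1
begin

primcorec zero_quat where
  "q0 0 = 0" | "q1 0 = 0" | "q2 0 = 0" | "q3 0 = 0"

primcorec one_quat where
  "q0 1 = 1" | "q1 1 = 0" | "q2 1 = 0" | "q3 1 = 0"

primcorec plus_quat where
  "q0 (x + y) = q0 x + q0 y"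
| "q1 (x + y) = q1 x + q1 y"
| "q2 (x + y) = q2 x + q2 y"
| "q3 (x + y) = q3 x + q3 y"

primcorec uminus_quat where
  "q0 (- x) = - q0 x" | "q1 (- x) = - q1 x" | "q2 (- x) = - q2 x" | "q3 (- x) = - q3 x"

primcorec minus_quat where
  "q0 (x - y) = q0 x - q0 y"
| "q1 (x - y) = q1 x - q1 y"
| "q2 (x - y) = q2 x - q2 y"
| "q3 (x - y) = q3 x - q3 y"

primcorec times_quat where
  "q0 (x * y) = q0 x * q0 y - q1 x * q1 y - q2 x * q2 y - q3 x * q3 y"
| "q1 (x * y) = q0 x * q1 y + q1 x * q0 y + q2 x * q3 y - q3 x * q2 y"
| "q2 (x * y) = q0 x * q2 y - q1 x * q3 y + q2 x * q0 y + q3 x * q1 y"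
| "q3 (x * y) = q0 x * q3 y + q1 x * q2 y - q2 x * q1 y + q3 x * q0 y"

instance
  by standard (simp_all add: quat_eq_iff algebra_simps)

end

instantiation quat :: real_algebra_1
begin

primcorec scaleR_quat where
  "q0 (scaleR r x) = r * q0 x"
| "q1 (scaleR r x) = r * q1 x"
| "q2 (scaleR r x) = r * q2 x"
| "q3 (scaleR r x) = r * q3 x"

instance
  by standard (simp_all add: quat_eq_iff algebra_simps)

end

instantiation quat :: real_inner
begin

definition inner_quat :: "quat \<Rightarrow> quat \<Rightarrow> real" where
  "inner_quat x y = q0 x * q0 y + q1 x * q1 y + q2 x * q2 y + q3 x * q3 y"

definition norm_quat :: "quat \<Rightarrow> real" where
  "norm_quat x = sqrt (inner x x)"

definition sgn_quat :: "quat \<Rightarrow> quat" where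
  "sgn_quat x = x /\<^sub>R norm x"

definition dist_quat :: "quat \<Rightarrow> quat \<Rightarrow> real" where
  "dist_quat x y = norm (x - y)"

definition uniformity_quat :: "(quat \<times> quat) filter" where
  "uniformity_quat = (INF e\<in>{0 <..}. principal {(x, y). dist x y < e})"

definition open_quat :: "quat set \<Rightarrow> bool" where
  "open_quat U \<longleftrightarrow> (\<forall>x\<in>U. eventually (\<lambda>(x', y). x' = x \<longrightarrow> y \<in> U) uniformity)"

instance
proof
  fix x y z :: quat and r :: real and U :: "quat set"
  show "dist x y = norm (x - y)" by (rule dist_quat_def)
  show "sgn x = x /\<^sub>R norm x" by (rule sgn_quat_def)
  show "(uniformity :: (quat \<times> quat) filter) = (INF e\<in>{0 <..}. principal {(x, y). dist x y < e})"
    by (rule uniformity_quat_def)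
  show "open U \<longleftrightarrow> (\<forall>x\<in>U. eventually (\<lambda>(x', y). x' = x \<longrightarrow> y \<in> U) uniformity)"
    by (rule open_quat_def)
  show "inner x y = inner y x" by (simp add: inner_quat_def mult.commute)
  show "inner (x + y) z = inner x z + inner y z" by (simp add: inner_quat_def algebra_simps)
  show "inner (r *\<^sub>R x) y = r * inner x y" by (simp add: inner_quat_def algebra_simps)
  show "0 \<le> inner x x" by (simp add: inner_quat_def)
  show "inner x x = 0 \<longleftrightarrow> x = 0"
  proof
    assume "inner x x = 0"
    then have "(q0 x)\<^sup>2 + (q1 x)\<^sup>2 + (q2 x)\<^sup>2 + (q3 x)\<^sup>2 = 0"
      by (simp add: inner_quat_def power2_eq_square)
    then show "x = 0"
      by (simp add: quat_eq_iff add_nonneg_eq_0_iff)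
  qed (simp add: inner_quat_def)
  show "norm x = sqrt (inner x x)" by (rule norm_quat_def)
qed

end

definition qi :: quat where "qi = Quat 0 1 0 0"
definition qj :: quat where "qj = Quat 0 0 1 0"
definition qk :: quat where "qk = Quat 0 0 0 1"

lemma quat_units:
  "qi * qi = -1" "qj * qj = -1" "qk * qk = -1" "qi * qj = qk" "qj * qk = qi" "qk * qi = qj"
  by (simp_all add: quat_eq_iff qi_def qj_def qk_def)

instantiation quat :: euclidean_space
begin

definition Basis_quat :: "quat set" where
  "Basis_quat = {1, qi, qj, qk}"

instance
proof
  fix u v x :: quat
  show "(Basis :: quat set) \<noteq> {}" and "finite (Basis :: quat set)"
    by (simp_all add: Basis_quat_def)
  have neq: "1 \<noteq> qi" "1 \<noteq> qj" "1 \<noteq> qk" "qi \<noteq> qj" "qi \<noteq> qk" "qj \<noteq> qk"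
    by (simp_all add: quat_eq_iff qi_def qj_def qk_def)
  show "inner u v = (if u = v then 1 else 0)" if "u \<in> Basis" "v \<in> Basis"
    using that neq unfolding Basis_quat_def
    by (elim insertE emptyE) (simp_all add: inner_quat_def qi_def qj_def qk_def)
  show "(\<forall>u\<in>Basis. inner x u = 0) \<longleftrightarrow> x = 0"
    unfolding Basis_quat_def ball_simps inner_quat_def qi_def qj_def qk_def
    by (simp add: quat_eq_iff)
qed

end

instance quat :: real_normed_algebra_1
proof
  fix x y :: quat
  have "inner (x * y) (x * y) = inner x x * inner y y"
    by (simp add: inner_quat_def algebra_simps)
  then show "norm (x * y) \<le> norm x * norm y"
    by (simp add: norm_quat_def real_sqrt_mult)
  show "norm (1::quat) = 1"
    by (simp add: norm_quat_def inner_quat_def)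
qed

definition imag_units :: "quat set" where
  "imag_units = {J. J * J = -1}"


section \<open>Indices\<close>

text \<open>The index set \<open>{1, ..., n}\<close> is a finite linearly ordered type \<open>'n\<close> with \<open>n = CARD('n)\<close>;
  \<open>idx h\<close> is its \<open>h\<close>-th smallest element (\<open>1 \<le> h \<le> n\<close>) and \<open>seg m\<close> is \<open>{1, ..., m}\<close>.\<close>

definition idx :: "nat \<Rightarrow> 'n::{finite,linorder}" where
  "idx h = sorted_list_of_set UNIV ! (h - 1)"

definition seg :: "nat \<Rightarrow> 'n::{finite,linorder} set" where
  "seg m = idx ` {1..m}"

definition ordered_prod :: "'n::{finite,linorder} set \<Rightarrow> ('n \<Rightarrow> quat) \<Rightarrow> quat" where
  "ordered_prod K q = prod_list (map q (sorted_list_of_set K))"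


section \<open>Derivatives\<close>

definition dir_deriv :: "('a::real_normed_vector \<Rightarrow> 'b::real_normed_vector) \<Rightarrow> 'a \<Rightarrow> 'a \<Rightarrow> 'b" where
  "dir_deriv f v x = vector_derivative (\<lambda>t. f (x + t *\<^sub>R v)) (at 0)"

definition dir_differentiable_on ::
    "('a::real_normed_vector \<Rightarrow> 'b::real_normed_vector) \<Rightarrow> 'a \<Rightarrow> 'a set \<Rightarrow> bool" where
  "dir_differentiable_on f v U \<longleftrightarrow> (\<forall>x\<in>U. (\<lambda>t::real. f (x + t *\<^sub>R v)) differentiable (at 0))"

text \<open>Only used for open sets \<open>U\<close>.\<close>

definition C1_on :: "'a::real_normed_vector set \<Rightarrow> ('a \<Rightarrow> 'b::real_normed_vector) \<Rightarrow> bool" where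
  "C1_on U f \<longleftrightarrow> (\<exists>f' :: 'a \<Rightarrow> 'a \<Rightarrow>\<^sub>L 'b. continuous_on U f' \<and>
     (\<forall>x\<in>U. (f has_derivative blinfun_apply (f' x)) (at x)))"


section \<open>Stem functions and slice functions\<close>

type_synonym 'n cvec = "complex ^ 'n"
type_synonym 'n qvec = "quat ^ 'n"

definition conj_at :: "'n::finite \<Rightarrow> 'n cvec \<Rightarrow> 'n cvec" where
  "conj_at h z = (\<chi> k. if k = h then cnj (z $ k) else z $ k)"

definition invariant_set :: "('n::finite) cvec set \<Rightarrow> bool" where
  "invariant_set D \<longleftrightarrow> (\<forall>z h. z \<in> D \<longleftrightarrow> conj_at h z \<in> D)"

text \<open>The point \<open>(\<alpha>\<^sub>1 + J\<^sub>1 \<beta>\<^sub>1, ..., \<alpha>\<^sub>n + J\<^sub>n \<beta>\<^sub>n)\<close> for \<open>z = \<alpha> + i \<beta>\<close>.\<close>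

definition slice_point :: "('n::finite) cvec \<Rightarrow> 'n qvec \<Rightarrow> 'n qvec" where
  "slice_point z J = (\<chi> h. of_real (Re (z $ h)) + J $ h * of_real (Im (z $ h)))"

definition circularization :: "('n::finite) cvec set \<Rightarrow> 'n qvec set" where
  "circularization D = {slice_point z J | z J. z \<in> D \<and> (\<forall>h. J $ h \<in> imag_units)}"

text \<open>An element \<open>\<Sum>\<^sub>K e\<^sub>K w\<^sub>K\<close> of the tensor product of the quaternions with \<open>\<real>\<close> to the power
  \<open>2\<^sup>n\<close> is the vector of its components \<open>w $ K\<close>, indexed by the subsets \<open>K\<close> of \<open>{1, ..., n}\<close>;
  \<open>axis K q\<close> is \<open>q \<otimes> e\<^sub>K\<close>.\<close>

type_synonym 'n coeffs = "quat ^ ('n set)"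
type_synonym 'n stem = "'n cvec \<Rightarrow> 'n coeffs"

definition stem_function :: "('n::finite) cvec set \<Rightarrow> 'n stem \<Rightarrow> bool" where
  "stem_function D F \<longleftrightarrow> continuous_on D F \<and>
     (\<forall>z\<in>D. \<forall>K h. F (conj_at h z) $ K = (-1) ^ card (K \<inter> {h}) * F z $ K)"

text \<open>\<open>induced D F\<close> is the slice function on \<open>circularization D\<close> induced by the stem function \<open>F\<close>. The
  value below does not depend on the chosen \<open>z\<close> and \<open>J\<close>, by the symmetries of \<open>F\<close>.
  Slice functions on \<open>circularization D\<close> are represented by total functions, whose values outside of
  \<open>circularization D\<close> are irrelevant.\<close>

definition induced :: "('n::{finite,linorder}) cvec set \<Rightarrow> 'n stem \<Rightarrow> 'n qvec \<Rightarrow> quat" where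
  "induced D F x = (THE y. \<exists>z J. z \<in> D \<and> (\<forall>h. J $ h \<in> imag_units) \<and> x = slice_point z J \<and>
     y = (\<Sum>K\<in>UNIV. ordered_prod K (($) J) * F z $ K))"

definition induced_by :: "('n::{finite,linorder}) cvec set \<Rightarrow> 'n stem \<Rightarrow> ('n qvec \<Rightarrow> quat) \<Rightarrow> bool" where
  "induced_by D F f \<longleftrightarrow> stem_function D F \<and> (\<forall>x\<in>circularization D. f x = induced D F x)"

definition slice_functions :: "('n::{finite,linorder}) cvec set \<Rightarrow> ('n qvec \<Rightarrow> quat) set" where
  "slice_functions D = {f. \<exists>F. induced_by D F f}"

text \<open>The stem function inducing \<open>f\<close>; it is unique on \<open>D\<close>.\<close>

definition stem_of :: "('n::{finite,linorder}) cvec set \<Rightarrow> ('n qvec \<Rightarrow> quat) \<Rightarrow> 'n stem" where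
  "stem_of D f = (SOME F. induced_by D F f)"

definition stem_prod :: "'n::finite stem \<Rightarrow> 'n stem \<Rightarrow> 'n stem" where
  "stem_prod F G z =
     (\<Sum>H\<in>UNIV. \<Sum>K\<in>UNIV. axis (sym_diff K H) ((-1) ^ card (H \<inter> K) * F z $ K * G z $ H))"

definition slice_prod :: "('n::{finite,linorder}) cvec set \<Rightarrow>
    ('n qvec \<Rightarrow> quat) \<Rightarrow> ('n qvec \<Rightarrow> quat) \<Rightarrow> 'n qvec \<Rightarrow> quat" where
  "slice_prod D f g = induced D (stem_prod (stem_of D f) (stem_of D g))"

definition coord_stem :: "'n::finite \<Rightarrow> 'n stem" where
  "coord_stem j z = axis {} (of_real (Re (z $ j))) + axis {j} (of_real (Im (z $ j)))"

definition coord :: "('n::{finite,linorder}) cvec set \<Rightarrow> 'n \<Rightarrow> 'n qvec \<Rightarrow> quat" where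
  "coord D j = induced D (coord_stem j)"

definition coord_prod :: "('n::{finite,linorder}) cvec set \<Rightarrow> 'n set \<Rightarrow> 'n qvec \<Rightarrow> quat" where
  "coord_prod D K = foldr (\<lambda>k. slice_prod D (coord D k)) (sorted_list_of_set K) (\<lambda>x. 1)"


section \<open>Slice regularity\<close>

definition complex_structure :: "'n::finite \<Rightarrow> 'n coeffs \<Rightarrow> 'n coeffs" where
  "complex_structure h w = (\<Sum>K\<in>UNIV. axis (sym_diff K {h}) ((-1) ^ card (K \<inter> {h}) * w $ K))"

definition stem_dbar :: "'n::finite \<Rightarrow> 'n stem \<Rightarrow> 'n stem" where
  "stem_dbar h F z = (1/2) *\<^sub>R
     (dir_deriv F (axis h 1) z + complex_structure h (dir_deriv F (axis h \<i>) z))"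

definition holomorphic_stem :: "('n::finite) cvec set \<Rightarrow> 'n stem \<Rightarrow> bool" where
  "holomorphic_stem D F \<longleftrightarrow> stem_function D F \<and> C1_on D F \<and> (\<forall>h. \<forall>z\<in>D. stem_dbar h F z = 0)"

definition slice_regular :: "('n::{finite,linorder}) cvec set \<Rightarrow> ('n qvec \<Rightarrow> quat) set" where
  "slice_regular D = {f. \<exists>F. induced_by D F f \<and> holomorphic_stem D F}"


section \<open>Spherical derivatives and components\<close>

definition off_real :: "'n::finite set \<Rightarrow> 'n cvec set \<Rightarrow> 'n cvec set" where
  "off_real H D = {z \<in> D. \<forall>h\<in>H. Im (z $ h) \<noteq> 0}"

definition stem_spherical_deriv :: "'n::finite set \<Rightarrow> 'n stem \<Rightarrow> 'n stem" where
  "stem_spherical_deriv H F z =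
     inverse (\<Prod>h\<in>H. Im (z $ h)) *\<^sub>R (\<Sum>K\<in>Pow (- H). axis K (F z $ (K \<union> H)))"

definition spherical_deriv :: "('n::{finite,linorder}) cvec set \<Rightarrow> 'n set \<Rightarrow>
    ('n qvec \<Rightarrow> quat) \<Rightarrow> 'n qvec \<Rightarrow> quat" where
  "spherical_deriv D H f = induced (off_real H D) (stem_spherical_deriv H (stem_of D f))"

text \<open>The spherical component, extended continuously from the circularization of \<open>off_real (seg m) D\<close>
  to that of \<open>D\<close>. For open \<open>D\<close> the former is dense in the latter, so the extension is unique there.\<close>

definition spherical_component :: "('n::{finite,linorder}) cvec set \<Rightarrow> nat \<Rightarrow> 'n set \<Rightarrow>
    ('n qvec \<Rightarrow> quat) \<Rightarrow> 'n qvec \<Rightarrow> quat" where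
  "spherical_component D m K f = (SOME g. continuous_on (circularization D) g \<and>
     (\<forall>x\<in>circularization (off_real (seg m) D).
        g x = spherical_deriv D (seg m) (slice_prod D (coord_prod D K) f) x))"


section \<open>Differential operators on quaternionic variables\<close>

definition qd :: "'n::finite \<Rightarrow> ('n qvec \<Rightarrow> quat) \<Rightarrow> 'n qvec \<Rightarrow> quat" where
  "qd h g x = (1/2) *\<^sub>R (dir_deriv g (axis h 1) x - qi * dir_deriv g (axis h qi) x
     - qj * dir_deriv g (axis h qj) x - qk * dir_deriv g (axis h qk) x)"

definition qdbar :: "'n::finite \<Rightarrow> ('n qvec \<Rightarrow> quat) \<Rightarrow> 'n qvec \<Rightarrow> quat" where
  "qdbar h g x = (1/2) *\<^sub>R (dir_deriv g (axis h 1) x + qi * dir_deriv g (axis h qi) x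
     + qj * dir_deriv g (axis h qj) x + qk * dir_deriv g (axis h qk) x)"

definition qlaplace :: "'n::finite \<Rightarrow> ('n qvec \<Rightarrow> quat) \<Rightarrow> 'n qvec \<Rightarrow> quat" where
  "qlaplace h g x = (\<Sum>u\<in>{1, qi, qj, qk}. dir_deriv (dir_deriv g (axis h u)) (axis h u) x)"

text \<open>Existence of the partial derivatives occurring in \<open>qd h g\<close> and in \<open>qlaplace h g\<close>: the
  derivative operator of the library is total and has an unspecified value where no derivative exists.\<close>

definition qd_defined :: "'n::finite qvec set \<Rightarrow> 'n \<Rightarrow> ('n qvec \<Rightarrow> quat) \<Rightarrow> bool" where
  "qd_defined U h g \<longleftrightarrow> (\<forall>u\<in>{1, qi, qj, qk}. dir_differentiable_on g (axis h u) U)"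

definition qlaplace_defined :: "'n::finite qvec set \<Rightarrow> 'n \<Rightarrow> ('n qvec \<Rightarrow> quat) \<Rightarrow> bool" where
  "qlaplace_defined U h g \<longleftrightarrow> (\<forall>u\<in>{1, qi, qj, qk}. dir_differentiable_on g (axis h u) U \<and>
     dir_differentiable_on (dir_deriv g (axis h u)) (axis h u) U)"

definition axially_monogenic :: "'n::{finite,linorder} \<Rightarrow> 'n cvec set \<Rightarrow> ('n qvec \<Rightarrow> quat) set" where
  "axially_monogenic h D = {g \<in> slice_functions D. C1_on (circularization D) g \<and>
     (\<forall>x\<in>circularization D. qdbar h g x = 0)}"

end

theory Submission
  imports Defs "HOL-Complex_Analysis.Cauchy_Integral_Formula"
begin

text \<open>
  The product of \<open>x\<^sub>K\<close> with \<open>f\<close> is again slice regular, so the statement concerns the spherical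
  derivative of a slice regular function \<open>g\<close> with stem function \<open>G\<close>. The component \<open>G\<^sub>M\<close> is odd in
  \<open>\<beta>\<^sub>k\<close> for \<open>k \<in> M\<close> and even in the other \<open>\<beta>\<^sub>k\<close>. Hence \<open>G\<^sub>M = (\<Prod>k\<in>M. \<beta>\<^sub>k) E\<^sub>M\<close> with a function \<open>E\<^sub>M\<close> of
  the coordinates \<open>u\<^sub>h = Re x\<^sub>h\<close> and \<open>s\<^sub>h = \<bar>Im x\<^sub>h\<bar>\<^sup>2\<close>, which are polynomials in \<open>x\<close>, and \<open>g\<close> is the sum of
  the terms \<open>(Im x)\<^sub>M E\<^sub>M\<close>, with \<open>(Im x)\<^sub>M\<close> the ordered product of the vector parts. In these terms the
  spherical derivative with respect to \<open>P\<close> is the sum of \<open>(Im x)\<^sub>L E\<^sub>N\<close>, \<open>N = P \<union> L\<close>, over the sets \<open>L\<close> disjoint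
  from \<open>P\<close>. No denominator is left, so this formula is the continuous extension to the whole domain
  (\<open>spherical_component_eq_sum\<close>), provided that the functions \<open>E\<^sub>M\<close> are smooth across \<open>s\<^sub>h = 0\<close>.

  Smoothness comes from complex analysis. Sending \<open>e\<^sub>M\<close> to \<open>\<i>\<close> to the power \<open>card M\<close> turns \<open>G\<close> into four
  holomorphic functions of \<open>n\<close> complex variables, one for each quaternionic coordinate
  (\<open>hol_stem_char\<close>), and turns products of stem functions into products (\<open>stem_char_stem_prod\<close>). In
  one variable \<open>z = u + \<i>\<sigma>\<close>, \<open>s = \<sigma>\<^sup>2\<close>, the even part \<open>(\<phi>(u + \<i>\<sigma>) + \<phi>(u - \<i>\<sigma>)) / 2\<close> and the odd quotient
  \<open>(\<phi>(u + \<i>\<sigma>) - \<phi>(u - \<i>\<sigma>)) / (2\<i>\<sigma>)\<close> are holomorphic functions of the complex variables \<open>u\<close> and \<open>s\<close>,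
  also at \<open>s = 0\<close>. Applying one or the other successively in all variables produces the functions \<open>E\<^sub>M\<close>
  (\<open>stem_eq_radial\<close>).

  Let \<open>a\<close> and \<open>b\<close> be the even part and the odd quotient of the same function in the variable \<open>h\<close>. The
  Cauchy-Riemann equations become \<open>\<partial>\<^sub>u a = b + 2s \<partial>\<^sub>s b\<close> and \<open>\<partial>\<^sub>s a = - \<partial>\<^sub>u b / 2\<close>. The Laplacian in the
  four real coordinates of \<open>x\<^sub>h\<close> acts on functions of \<open>u\<close> and \<open>s\<close> as \<open>\<partial>\<^sub>u\<^sup>2 + 6 \<partial>\<^sub>s + 4s \<partial>\<^sub>s\<^sup>2\<close>; it
  annihilates \<open>b\<close> (\<open>odd_quot_harmonic\<close>) and sends \<open>a\<close> to \<open>- 2 \<partial>\<^sub>u b\<close> (\<open>even_part_laplacian\<close>).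

  For the first claim let \<open>h = m\<close>: every \<open>E\<^sub>N\<close> in the spherical derivative is an odd quotient in \<open>x\<^sub>h\<close>, hence
  harmonic in \<open>x\<^sub>h\<close>, and a fourth of the Laplacian is the composition of the two first-order operators. The
  image is again a slice function since the indices in \<open>L\<close> exceed \<open>h\<close>, so that a factor
  \<open>Im x\<^sub>h\<close> produced on the left stands at its place in the ordered product. For the second claim let
  \<open>h = m + 1\<close>: the terms pair up as \<open>a + Im x\<^sub>h b\<close>, and the Laplacian of such a pair is \<open>- 4\<close> times the
  first-order derivative of \<open>b\<close> (\<open>laplace_slice_pair\<close>). So the Laplacian of the component for \<open>m\<close> is \<open>- 4\<close>
  times the derivative, in \<open>x\<^sub>h\<close>, of the spherical derivative with respect to \<open>{1, ..., m + 1}\<close>, and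
  the argument of the first claim applies to it.
\<close>

section \<open>Holomorphic functions of several complex variables\<close>

definition upd :: "'a^'k \<Rightarrow> 'k::finite \<Rightarrow> 'a \<Rightarrow> 'a^'k" where
  "upd z j t = (\<chi> i. if i = j then t else z $ i)"

lemma upd_nth [simp]: "upd z j t $ i = (if i = j then t else z $ i)"
  by (simp add: upd_def)

lemma upd_upd [simp]: "upd (upd z j t) j s = upd z j s"
  by (simp add: vec_eq_iff)

lemma upd_triv [simp]: "upd z j (z $ j) = z"
  by (simp add: vec_eq_iff)

lemma upd_commute: "i \<noteq> j \<Longrightarrow> upd (upd z i s) j t = upd (upd z j t) i s"
  by (simp add: vec_eq_iff)

lemma upd_eq_axis: "upd z j t = z + axis j (t - z $ j)" for z :: "complex^'k::finite"
  by (simp add: vec_eq_iff axis_def)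

lemma norm_axis_vec: "norm (axis j t :: 'a::real_normed_vector^'k::finite) = norm t"
proof -
  have "norm (axis j t :: 'a^'k) = L2_set (\<lambda>i. if i = j then norm t else 0) UNIV"
    unfolding norm_vec_def by (rule arg_cong2[where f=L2_set]) (auto simp: axis_def)
  also have "\<dots> = norm t"
    by (simp add: L2_set_def if_distrib[where f="\<lambda>x. x^2"] sum.delta cong: if_cong)
  finally show ?thesis .
qed

lemma bounded_linear_axis: "bounded_linear (axis j :: complex \<Rightarrow> complex^'k::finite)"
proof (rule bounded_linear_intro[where K=1])
  show "norm (axis j x :: complex^'k) \<le> norm x * 1" for x :: complex by (simp add: norm_axis_vec)
qed (auto simp: vec_eq_iff axis_def)

lemma dist_upd_self: "dist (upd z j t) z = cmod (t - z $ j)" for z :: "complex^'k::finite"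
  unfolding upd_eq_axis dist_norm by (simp add: norm_axis_vec)

lemma dist_upd_le: "dist (upd z j t) (upd y j t) \<le> dist z y" for z :: "complex^'k::finite"
  unfolding dist_vec_def by (rule L2_set_mono) auto

lemma continuous_on_upd [continuous_intros]:
  "continuous_on S f \<Longrightarrow> continuous_on S g \<Longrightarrow> continuous_on S (\<lambda>x. upd (f x) j (g x))"
  for f :: "'a::topological_space \<Rightarrow> complex^'k::finite"
  unfolding upd_def
  by (intro continuous_on_vec_lambda, rename_tac i, case_tac "i = j") (auto intro!: continuous_intros)

text \<open>Continuity and holomorphy in each variable separately: this is all that is checked about the functions
  constructed below, and it is inherited by partial derivatives.\<close>

definition hol :: "(complex^'k::finite) set \<Rightarrow> (complex^'k \<Rightarrow> complex) \<Rightarrow> bool" where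
  "hol U f \<longleftrightarrow> open U \<and> continuous_on U f \<and>
     (\<forall>z\<in>U. \<forall>j. (\<lambda>t. f (upd z j t)) field_differentiable at (z $ j))"

definition pd :: "'k::finite \<Rightarrow> (complex^'k \<Rightarrow> complex) \<Rightarrow> complex^'k \<Rightarrow> complex" where
  "pd j f z = deriv (\<lambda>t. f (upd z j t)) (z $ j)"

lemma pd_line:
  assumes "hol U f" "upd z j t \<in> U"
  shows "((\<lambda>t. f (upd z j t)) has_field_derivative pd j f (upd z j t)) (at t)"
proof -
  have "(\<lambda>t. f (upd z j t)) field_differentiable at t"
    using assms unfolding hol_def by (metis (no_types, lifting) upd_nth upd_upd ext)
  then show ?thesis
    using field_differentiable_derivI by (fastforce simp: pd_def)
qed

lemma pd_eqI:
  assumes "((\<lambda>t. f (upd z j t)) has_field_derivative d) (at (z $ j))"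
  shows "pd j f z = d"
  unfolding pd_def by (rule DERIV_imp_deriv) (rule assms)

lemma holI:
  assumes "open U" "continuous_on U f"
    "\<And>z j. z \<in> U \<Longrightarrow> (\<lambda>t. f (upd z j t)) field_differentiable at (z $ j)"
  shows "hol U f"
  using assms by (simp add: hol_def)

lemma open_line: "open U \<Longrightarrow> open {t. upd z j t \<in> U}" for z :: "complex^'k::finite"
proof -
  assume "open U"
  moreover have "continuous_on UNIV (\<lambda>t. upd z j t)" by (intro continuous_intros)
  ultimately show ?thesis
    using continuous_open_preimage[of UNIV "\<lambda>t. upd z j t" U] by (simp add: vimage_def)
qed

lemma convex_line: 
  fixes z :: "complex^'k::finite" assumes "convex C" shows "convex {t. upd z j t \<in> C}"
proof (rule convexI)
  fix x y :: complex and u v :: real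
  assume *: "x \<in> {t. upd z j t \<in> C}" "y \<in> {t. upd z j t \<in> C}" "0 \<le> u" "0 \<le> v" "u + v = 1"
  have "upd z j (u *\<^sub>R x + v *\<^sub>R y) = u *\<^sub>R upd z j x + v *\<^sub>R upd z j y"
    using * by (simp add: vec_eq_iff flip: scaleR_left_distrib)
  moreover have "u *\<^sub>R upd z j x + v *\<^sub>R upd z j y \<in> C"
    using * assms by (intro convexD) auto
  ultimately show "u *\<^sub>R x + v *\<^sub>R y \<in> {t. upd z j t \<in> C}"
    by simp
qed

text \<open>The one-variable mean value inequality, applied to \<open>f - t c\<close> along a coordinate line. The constant \<open>c\<close>
  is arbitrary, so that difference quotients can be compared with the derivative at a nearby point.\<close>

lemma hol_mean_value:
  assumes f: "hol U f" and C: "convex C" "C \<subseteq> U"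
    and b: "\<And>w. w \<in> C \<Longrightarrow> cmod (pd j f w - c) \<le> e"
    and z: "upd z j s \<in> C" "upd z j t \<in> C"
  shows "cmod (f (upd z j t) - f (upd z j s) - (t - s) * c) \<le> e * cmod (t - s)"
proof -
  have "cmod ((f (upd z j t) - t * c) - (f (upd z j s) - s * c)) \<le> e * cmod (t - s)"
  proof (rule field_differentiable_bound[OF convex_line[OF C(1), of z j]])
    fix x assume x: "x \<in> {t. upd z j t \<in> C}"
    show "((\<lambda>t. f (upd z j t) - t * c) has_field_derivative pd j f (upd z j x) - c) (at x within {t. upd z j t \<in> C})"
      by (rule derivative_eq_intros DERIV_subset[OF pd_line[OF f]] refl | use x C in force)+
    show "cmod (pd j f (upd z j x) - c) \<le> e" using x b by auto
  qed (use z in auto)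
  then show ?thesis by (simp add: algebra_simps)
qed

lemma hol_line_holomorphic:
  assumes "hol U f" "\<And>t. t \<in> S \<Longrightarrow> upd z j t \<in> U"
  shows "(\<lambda>t. f (upd z j t)) holomorphic_on S"
  using pd_line[OF assms(1)] assms(2)
  by (meson has_field_derivative_at_within holomorphic_onI field_differentiable_def)

text \<open>Only the variation of the other variables has to be controlled. Uniform continuity makes the restrictions of
  \<open>f\<close> to two parallel lines uniformly close, and Cauchy's inequality passes this to the derivatives.\<close>

lemma continuous_on_pd:
  assumes f: "hol U f" shows "continuous_on U (pd j f)"
proof -
  have oU: "open U" using f by (simp add: hol_def)
  show ?thesis unfolding continuous_on_eq_continuous_at[OF oU] 
  proof
    fix z0 assume z0: "z0 \<in> U"
    obtain r where r: "r > 0" "cball z0 (2*r) \<subseteq> U"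
    proof -
      obtain e where "e > 0" "cball z0 e \<subseteq> U" using oU z0 open_contains_cball by blast
      then show ?thesis using that[of "e/2"] by auto
    qed
    have near: "upd z j t \<in> cball z0 (2*r)" if "dist z z0 \<le> r" "cmod (t - z $ j) \<le> r" for z t
    proof -
      have "dist (upd z j t) z0 \<le> dist (upd z j t) z + dist z z0" by (rule dist_triangle)
      with that show ?thesis by (simp add: dist_upd_self dist_commute[of z0])
    qed
    have uc: "uniformly_continuous_on (cball z0 (2*r)) f"
      using f r by (intro compact_uniformly_continuous) (auto simp: hol_def intro: continuous_on_subset)
    show "isCont (pd j f) z0" unfolding continuous_at_eps_delta
    proof (intro allI impI)
      fix e :: real assume e: "e > 0"
      define G where "G = (\<lambda>t. f (upd z0 j t))"
      have "G holomorphic_on {t. upd z0 j t \<in> U}" unfolding G_def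
        by (rule hol_line_holomorphic[OF f]) auto
      then have "deriv G holomorphic_on {t. upd z0 j t \<in> U}"
        using holomorphic_deriv open_line[OF oU] by blast
      then have "isCont (deriv G) (z0 $ j)"
        using z0 by (intro continuous_on_interior[OF holomorphic_on_imp_continuous_on])
          (auto simp: interior_open open_line[OF oU])
      then obtain d1 where d1: "d1 > 0" "\<And>t. dist t (z0 $ j) < d1 \<Longrightarrow> dist (deriv G t) (deriv G (z0 $ j)) < e / 2"
        unfolding continuous_at_eps_delta using e half_gt_zero by blast
      \<comment> \<open>Chosen such that Cauchy's inequality on a disc of radius \<open>r / 2\<close> yields the bound \<open>e / 2\<close>.\<close>
      define \<eta> where "\<eta> = e / 2 * r / 2"
      have "\<eta> > 0" using e r by (simp add: \<eta>_def)
      then obtain d2 where d2: "d2 > 0" "\<And>x y. x \<in> cball z0 (2*r) \<Longrightarrow> y \<in> cball z0 (2*r) \<Longrightarrow> dist x y < d2 \<Longrightarrow> dist (f x) (f y) < \<eta>"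
        using uc unfolding uniformly_continuous_on_def by (metis dist_commute)
      show "\<exists>d>0. \<forall>z. dist z z0 < d \<longrightarrow> dist (pd j f z) (pd j f z0) < e"
      proof (intro exI[of _ "min (min d1 d2) (r/2)"] conjI allI impI)
        show "min (min d1 d2) (r/2) > 0" using d1 d2 r by simp
        fix z assume z: "dist z z0 < min (min d1 d2) (r/2)"
        define H where "H = (\<lambda>t. f (upd z j t) - f (upd z0 j t))"
        have zj: "cmod (z $ j - z0 $ j) \<le> dist z z0"
          using component_le_norm_cart Finite_Cartesian_Product.norm_nth_le[of "z - z0" j] by (simp add: dist_norm)
        have in1: "upd z j t \<in> cball z0 (2*r)" "upd z0 j t \<in> cball z0 (2*r)" if "t \<in> cball (z $ j) (r/2)" for t
        proof -
          have a: "cmod (t - z $ j) \<le> r/2" using that by (simp add: dist_norm norm_minus_commute)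
          have "cmod (t - z0 $ j) \<le> cmod (t - z $ j) + cmod (z $ j - z0 $ j)"
            using norm_triangle_ineq[of "t - z $ j" "z $ j - z0 $ j"] by simp
          then have b: "cmod (t - z0 $ j) \<le> r" using a zj z by linarith
          show "upd z j t \<in> cball z0 (2*r)" by (rule near) (use a z r in auto)
          show "upd z0 j t \<in> cball z0 (2*r)" by (rule near) (use b r in auto)
        qed
        have holH: "H holomorphic_on cball (z $ j) (r/2)" unfolding H_def
          by (intro holomorphic_on_diff hol_line_holomorphic[OF f]) (use in1 r(2) in blast)+
        have "cmod ((deriv ^^ 1) H (z $ j)) \<le> fact 1 * \<eta> / (r/2) ^ 1"
        proof (rule Cauchy_higher_deriv_bound[where y=0])
          show "H holomorphic_on ball (z $ j) (r/2)" using holH holomorphic_on_subset ball_subset_cball by blast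
          show "continuous_on (cball (z $ j) (r/2)) H" using holH holomorphic_on_imp_continuous_on by blast
          show "H w \<in> ball 0 \<eta>" if "w \<in> ball (z $ j) (r/2)" for w
          proof -
            have w: "w \<in> cball (z $ j) (r/2)" using that by simp
            have "dist (upd z j w) (upd z0 j w) < d2" using dist_upd_le[of z j w z0] z by simp
            then have "dist (f (upd z j w)) (f (upd z0 j w)) < \<eta>" using in1[OF w] d2(2) by blast
            then show ?thesis by (simp add: H_def dist_norm norm_minus_commute)
          qed
        qed (use r in auto)
        then have Hb: "cmod (deriv H (z $ j)) \<le> e / 2" using r by (simp add: \<eta>_def field_simps)
        have zr: "z $ j \<in> cball (z $ j) (r/2)" using r by simp
        have "deriv H (z $ j) = pd j f z - deriv G (z $ j)"
        proof -
          have "((\<lambda>t. f (upd z j t)) has_field_derivative pd j f z) (at (z $ j))"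
            using pd_line[OF f, of z j "z $ j"] in1(1)[OF zr] r by auto
          moreover have "((\<lambda>t. f (upd z0 j t)) has_field_derivative pd j f (upd z0 j (z $ j))) (at (z $ j))"
            using pd_line[OF f, of z0 j "z $ j"] in1(2)[OF zr] r by auto
          ultimately show ?thesis unfolding H_def G_def
            by (metis DERIV_imp_deriv Deriv.field_differentiable_diff)
        qed
        moreover have "dist (deriv G (z $ j)) (deriv G (z0 $ j)) < e/2"
          by (rule d1(2)) (use zj z in \<open>simp add: dist_norm\<close>)
        moreover have "deriv G (z0 $ j) = pd j f z0" by (simp add: G_def pd_def)
        moreover have "dist (pd j f z) (pd j f z0) \<le> dist (pd j f z) (deriv G (z $ j)) + dist (deriv G (z $ j)) (pd j f z0)"
          by (rule dist_triangle)
        ultimately show "dist (pd j f z) (pd j f z0) < e" using Hb by (simp add: dist_norm)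
      qed
    qed
  qed
qed

lemma uniformly_continuous_on_cballE:
  fixes f :: "'a::heine_borel \<Rightarrow> 'b::metric_space"
  assumes "continuous_on U f" "cball z r \<subseteq> U" "e > 0"
  obtains d where "d > 0" "\<And>x y. x \<in> cball z r \<Longrightarrow> y \<in> cball z r \<Longrightarrow> dist x y < d \<Longrightarrow> dist (f x) (f y) < e"
  using compact_uniformly_continuous[OF continuous_on_subset[OF assms(1,2)] compact_cball] assms(3)
  unfolding uniformly_continuous_on_def by metis

text \<open>Along the line of differentiation this is the one-variable theorem. In any other direction the partial
  derivative is the uniform limit of difference quotients, which are holomorphic there.\<close>

lemma hol_pd:
  assumes f: "hol U f" shows "hol U (pd j f)"
proof (rule holI)
  show oU: "open U" and "continuous_on U (pd j f)"
    using f continuous_on_pd by (auto simp: hol_def)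
  fix z0 k assume z0: "z0 \<in> U"
  show "(\<lambda>t. pd j f (upd z0 k t)) field_differentiable at (z0 $ k)"
  proof (cases "k = j")
    case True
    have "(\<lambda>t. f (upd z0 j t)) holomorphic_on {t. upd z0 j t \<in> U}"
      by (rule hol_line_holomorphic[OF f]) auto
    then have "deriv (\<lambda>t. f (upd z0 j t)) holomorphic_on {t. upd z0 j t \<in> U}"
      using holomorphic_deriv open_line[OF oU] by blast
    moreover have "deriv (\<lambda>t. f (upd z0 j t)) = (\<lambda>t. pd j f (upd z0 j t))"
      by (simp add: pd_def fun_eq_iff)
    ultimately show ?thesis
      using True z0 open_line[OF oU, of z0 j] holomorphic_on_imp_differentiable_at by fastforce
  next
    case False
    obtain r where r: "r > 0" "cball z0 (2*r) \<subseteq> U"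
    proof -
      obtain e where "e > 0" "cball z0 e \<subseteq> U" using oU z0 open_contains_cball by blast
      then show ?thesis using that[of "e/2"] by auto
    qed
    define \<delta> :: "nat \<Rightarrow> real" where "\<delta> = (\<lambda>n. 1 / real (Suc n))"
    have \<delta>: "\<delta> n > 0" for n by (simp add: \<delta>_def)
    have ev: "eventually (\<lambda>n. \<delta> n < d) sequentially" if "d > 0" for d
      using order_tendstoD(2)[OF LIMSEQ_Suc[OF lim_1_over_n[where 'a=real]] that] by (simp add: \<delta>_def)
    have near: "upd (upd z0 k t) j s \<in> cball z0 (2*r)" if "t \<in> cball (z0 $ k) r" "cmod (s - z0 $ j) \<le> r" for t s
    proof -
      have "dist (upd (upd z0 k t) j s) z0 \<le> dist (upd (upd z0 k t) j s) (upd z0 k t) + dist (upd z0 k t) z0"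
        by (rule dist_triangle)
      also have "\<dots> \<le> r + r"
        using that False dist_upd_self[of "upd z0 k t" j s] dist_upd_self[of z0 k t]
        by (intro add_mono) (auto simp: dist_norm[of "z0 $ k"] norm_minus_commute)
      finally show ?thesis by (simp add: dist_commute)
    qed
    define F where "F = (\<lambda>n t. (f (upd (upd z0 k t) j (z0 $ j + \<delta> n)) - f (upd z0 k t)) / \<delta> n)"
    have near0: "upd z0 k t \<in> cball z0 (2*r)" if "t \<in> cball (z0 $ k) r" for t
    proof -
      have "upd (upd z0 k t) j (z0 $ j) = upd z0 k t" using False by (simp add: vec_eq_iff)
      then show ?thesis using near[OF that, of "z0 $ j"] r by simp
    qed
    have Fhol: "F n holomorphic_on cball (z0 $ k) r" if "\<delta> n < r" for n
    proof -
      have "(\<lambda>t. f (upd (upd z0 j (z0 $ j + \<delta> n)) k t)) holomorphic_on cball (z0 $ k) r"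
        by (rule hol_line_holomorphic[OF f]) (use near that \<delta>[of n] r False in \<open>force simp: upd_commute\<close>)
      moreover have "(\<lambda>t. f (upd z0 k t)) holomorphic_on cball (z0 $ k) r"
        by (rule hol_line_holomorphic[OF f]) (use near0 r in blast)
      ultimately show ?thesis unfolding F_def using \<delta>[of n] False
        by (auto intro!: holomorphic_intros simp: upd_commute)
    qed
    have ul: "uniform_limit (cball (z0 $ k) r) F (\<lambda>t. pd j f (upd z0 k t)) sequentially"
    proof (rule uniform_limitI)
      fix e :: real assume e: "e > 0"
      then obtain d where d: "d > 0" "\<And>x y. x \<in> cball z0 (2*r) \<Longrightarrow> y \<in> cball z0 (2*r) \<Longrightarrow> dist x y < d \<Longrightarrow> dist (pd j f x) (pd j f y) < e/2"
        using uniformly_continuous_on_cballE[OF continuous_on_pd[OF f] r(2)] half_gt_zero by metis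
      have "eventually (\<lambda>n. \<delta> n < min d r) sequentially" using d r by (intro ev) simp
      then show "\<forall>\<^sub>F n in sequentially. \<forall>t\<in>cball (z0 $ k) r. dist (F n t) (pd j f (upd z0 k t)) < e"
      proof eventually_elim
        case (elim n)
        show ?case
        proof
          fix t assume t: "t \<in> cball (z0 $ k) r"
          let ?y = "upd z0 k t"
          let ?C = "cball ?y (\<delta> n) \<inter> cball z0 (2*r)"
          have yj: "upd ?y j (z0 $ j) = ?y" using False by (simp add: vec_eq_iff)
          have "cmod (f (upd ?y j (z0 $ j + \<delta> n)) - f (upd ?y j (z0 $ j)) - (z0 $ j + \<delta> n - z0 $ j) * pd j f ?y)
              \<le> e/2 * cmod (z0 $ j + \<delta> n - z0 $ j)"
          proof (rule hol_mean_value[OF f, of ?C])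
            show "convex ?C" by (intro convex_Int convex_cball)
            show "?C \<subseteq> U" using r by blast
            show "cmod (pd j f w - pd j f ?y) \<le> e/2" if "w \<in> ?C" for w
            proof -
              have "dist w ?y < d" using that elim by (simp add: dist_commute)
              then have "dist (pd j f w) (pd j f ?y) < e/2" using that near0[OF t] by (intro d(2)) auto
              then show ?thesis by (simp add: dist_norm)
            qed
            have "dist ?y (upd ?y j (z0 $ j + \<delta> n)) = \<delta> n"
              using dist_upd_self[of ?y j "z0 $ j + \<delta> n"] \<delta>[of n] False by (simp add: dist_commute)
            then show "upd ?y j (z0 $ j + \<delta> n) \<in> ?C"
              using near[OF t, of "z0 $ j + \<delta> n"] \<delta>[of n] elim by simp
            show "upd ?y j (z0 $ j) \<in> ?C"
              using near0[OF t] \<delta>[of n] yj by simp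
          qed
          then have *: "cmod (f (upd ?y j (z0 $ j + \<delta> n)) - f ?y - \<delta> n * pd j f ?y) \<le> e/2 * \<delta> n"
            using \<delta>[of n] yj by simp
          have "F n t - pd j f ?y = (f (upd ?y j (z0 $ j + \<delta> n)) - f ?y - \<delta> n * pd j f ?y) / \<delta> n"
            using \<delta>[of n] by (simp add: F_def field_simps)
          then have "cmod (F n t - pd j f ?y) \<le> e/2"
            using * \<delta>[of n] by (simp add: norm_divide pos_divide_le_eq)
          then show "dist (F n t) (pd j f ?y) < e" using e by (simp add: dist_norm)
        qed
      qed
    qed
    have "\<forall>\<^sub>F n in sequentially. continuous_on (cball (z0 $ k) r) (F n) \<and> F n holomorphic_on ball (z0 $ k) r"
      using ev[OF r(1)]
      by eventually_elim (meson Fhol ball_subset_cball holomorphic_on_imp_continuous_on holomorphic_on_subset)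
    then have "(\<lambda>t. pd j f (upd z0 k t)) holomorphic_on ball (z0 $ k) r"
      by (rule holomorphic_uniform_limit[OF _ ul trivial_limit_sequentially])
    then show ?thesis
      using r by (intro holomorphic_on_imp_differentiable_at[of _ "ball (z0 $ k) r"]) auto
  qed
qed

lemma hol_const: "open U \<Longrightarrow> hol U (\<lambda>z. c)"
  by (rule holI) auto

lemma hol_nth: "open U \<Longrightarrow> hol U (\<lambda>z. z $ k)"
  by (rule holI, simp, intro continuous_intros, rename_tac z j, case_tac "j = k") auto

lemma hol_mult: 
  assumes "hol U f" "hol U g" shows "hol U (\<lambda>z. f z * g z)"
  using assms by (auto simp: hol_def intro!: continuous_intros derivative_intros)

text \<open>The coordinates of the increment are switched on one at a time, and each step is estimated by the mean value
  inequality and the continuity of the partial derivative.\<close>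

lemma hol_has_derivative:
  assumes f: "hol U f" and z: "z \<in> U"
  shows "(f has_derivative (\<lambda>v. \<Sum>j\<in>UNIV. v $ j * pd j f z)) (at z)"
proof -
  define rest where "rest = (\<lambda>J (v::complex^'a). \<chi> i. if i \<in> J then v $ i else 0)"
  have oU: "open U" using f by (simp add: hol_def)
  have nrest: "norm (rest J v) \<le> norm v" for J v
    unfolding norm_vec_def rest_def by (rule L2_set_mono) auto
  have main: "\<exists>d>0. \<forall>v. norm v < d \<longrightarrow> cmod (f (z + rest J v) - f z - (\<Sum>j\<in>J. v $ j * pd j f z)) \<le> e * norm v"
    if "finite J" "e > 0" for J e
    using that
  proof (induction J arbitrary: e rule: finite_induct)
    case empty
    have "rest {} v = 0" for v by (simp add: rest_def vec_eq_iff)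
    then show ?case using empty by (auto intro!: exI[of _ 1])
  next
    case (insert j J)
    obtain d1 where d1: "d1 > 0" "\<And>v. norm v < d1 \<Longrightarrow> cmod (f (z + rest J v) - f z - (\<Sum>j\<in>J. v $ j * pd j f z)) \<le> e/2 * norm v"
      using insert.IH[of "e/2"] insert.prems by auto
    obtain r where r: "r > 0" "ball z r \<subseteq> U" using oU z open_contains_ball by blast
    have "isCont (pd j f) z"
      using continuous_on_pd[OF f] oU z continuous_on_eq_continuous_at by blast
    then obtain d2 where d2: "d2 > 0" "\<And>w. dist w z < d2 \<Longrightarrow> dist (pd j f w) (pd j f z) < e/2"
      unfolding continuous_at_eps_delta using insert.prems half_gt_zero by blast
    show ?case
    proof (intro exI[of _ "min (min d1 d2) r"] conjI allI impI)
      show "min (min d1 d2) r > 0" using d1 d2 r by simp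
      fix v :: "complex^'a" assume v: "norm v < min (min d1 d2) r"
      let ?C = "ball z (min d2 r)"
      let ?y = "z + rest J v"
      have e1: "z + rest (insert j J) v = upd ?y j (z $ j + v $ j)" 
        using insert.hyps by (auto simp: rest_def vec_eq_iff)
      have e2: "?y = upd ?y j (z $ j)"
        using insert.hyps by (auto simp: rest_def vec_eq_iff)
      have inC: "z + rest J' v \<in> ?C" for J'
        using nrest[of J' v] v by (simp add: dist_norm)
      have "cmod (f (upd ?y j (z $ j + v $ j)) - f (upd ?y j (z $ j)) - (z $ j + v $ j - z $ j) * pd j f z)
         \<le> e/2 * cmod (z $ j + v $ j - z $ j)"
      proof (rule hol_mean_value[OF f, of ?C])
        show "?C \<subseteq> U" using r by auto
        show "cmod (pd j f w - pd j f z) \<le> e/2" if "w \<in> ?C" for w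
          using d2(2)[of w] that by (simp add: dist_norm norm_minus_commute)
        show "upd ?y j (z $ j + v $ j) \<in> ?C" "upd ?y j (z $ j) \<in> ?C"
          using inC e1 e2 by metis+
      qed auto
      then have "cmod (f (z + rest (insert j J) v) - f ?y - v $ j * pd j f z) \<le> e/2 * cmod (v $ j)"
        by (simp flip: e1 e2)
      also have "\<dots> \<le> e/2 * norm v"
        using insert.prems by (intro mult_left_mono Finite_Cartesian_Product.norm_nth_le) auto
      finally have a: "cmod (f (z + rest (insert j J) v) - f ?y - v $ j * pd j f z) \<le> e/2 * norm v" .
      have b: "cmod (f ?y - f z - (\<Sum>j\<in>J. v $ j * pd j f z)) \<le> e/2 * norm v"
        using d1 v by simp
      have "f (z + rest (insert j J) v) - f z - (\<Sum>j\<in>insert j J. v $ j * pd j f z)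
        = (f (z + rest (insert j J) v) - f ?y - v $ j * pd j f z) + (f ?y - f z - (\<Sum>j\<in>J. v $ j * pd j f z))"
        by (subst sum.insert) (use insert.hyps in auto)
      then show "cmod (f (z + rest (insert j J) v) - f z - (\<Sum>j\<in>insert j J. v $ j * pd j f z)) \<le> e * norm v"
        using norm_triangle_mono[OF a b] by (simp only:)
    qed
  qed
  have rU: "rest UNIV v = v" for v by (simp add: rest_def vec_eq_iff)
  show ?thesis unfolding has_derivative_at_alt
  proof (intro conjI allI impI)
    show "bounded_linear (\<lambda>v. \<Sum>j\<in>UNIV. v $ j * pd j f z)"
      by (intro bounded_linear_sum bounded_linear_mult_const bounded_linear_vec_nth)
    fix e :: real assume "e > 0"
    then obtain d where d: "d > 0" "\<And>v. norm v < d \<Longrightarrow> cmod (f (z + v) - f z - (\<Sum>j\<in>UNIV. v $ j * pd j f z)) \<le> e * norm v"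
      using main[of UNIV e] by (auto simp: rU)
    show "\<exists>d>0. \<forall>y. norm (y - z) < d \<longrightarrow> cmod (f y - f z - (\<Sum>j\<in>UNIV. (y - z) $ j * pd j f z)) \<le> e * norm (y - z)"
    proof (intro exI conjI allI impI)
      show "d > 0" by (rule d)
      fix y assume "norm (y - z) < d"
      then show "cmod (f y - f z - (\<Sum>j\<in>UNIV. (y - z) $ j * pd j f z)) \<le> e * norm (y - z)"
        using d(2)[of "y - z"] by simp
    qed
  qed
qed

lemma pd_self:
  assumes "hol U f" "z \<in> U"
  shows "((\<lambda>t. f (upd z j t)) has_field_derivative pd j f z) (at (z $ j))"
  using pd_line[OF assms(1), of z j "z $ j"] assms(2) by simp

lemma hol_cong: "hol U f \<Longrightarrow> (\<And>z. z \<in> U \<Longrightarrow> f z = g z) \<Longrightarrow> hol U g"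
proof (rule holI)
  assume f: "hol U f" and eq: "\<And>z. z \<in> U \<Longrightarrow> f z = g z"
  show o: "open U" and "continuous_on U g" using f eq by (auto simp: hol_def cong: continuous_on_cong)
  fix z j assume z: "z \<in> U"
  have "((\<lambda>t. g (upd z j t)) has_field_derivative pd j f z) (at (z $ j))"
    by (rule has_field_derivative_transform_within_open[OF pd_self[OF f z] open_line[OF o]])
      (use z eq in \<open>auto\<close>)
  then show "(\<lambda>t. g (upd z j t)) field_differentiable at (z $ j)" by (auto simp: field_differentiable_def)
qed

lemma tendsto_upd [tendsto_intros]:
  fixes f :: "'a \<Rightarrow> complex^'k::finite"
  assumes "(f \<longlongrightarrow> a) F" "(g \<longlongrightarrow> b) F"
  shows "((\<lambda>x. upd (f x) j (g x)) \<longlongrightarrow> upd a j b) F"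
proof (rule vec_tendstoI)
  fix i show "((\<lambda>x. upd (f x) j (g x) $ i) \<longlongrightarrow> upd a j b $ i) F"
    using assms by (cases "i = j") (auto intro: tendsto_vec_nth)
qed

section \<open>Even parts and odd quotients in one variable\<close>

text \<open>Coordinate \<open>a\<close> holds \<open>u\<close> and coordinate \<open>c\<close> holds \<open>s\<close>; for a root \<open>\<sigma>\<close> of \<open>s\<close> the point \<open>u + \<i>\<sigma>\<close> is put
  into coordinate \<open>a\<close>. Coordinate \<open>c\<close> is then reset, so that the result depends on \<open>s\<close> through \<open>\<sigma>\<close> only.\<close>

definition root_shift :: "'k::finite \<Rightarrow> 'k \<Rightarrow> complex \<Rightarrow> complex^'k \<Rightarrow> complex^'k" where
  "root_shift a c \<sigma> w = upd (upd w a (w $ a + \<i> * \<sigma>)) c 0"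

text \<open>Both roots are required, since there is no preferred one.\<close>

definition root_dom :: "'k::finite \<Rightarrow> 'k \<Rightarrow> (complex^'k) set \<Rightarrow> (complex^'k) set" where
  "root_dom a c W = {w. \<forall>\<sigma>. \<sigma>\<^sup>2 = w $ c \<longrightarrow> root_shift a c \<sigma> w \<in> W}"

definition even_part :: "'k::finite \<Rightarrow> 'k \<Rightarrow> (complex^'k \<Rightarrow> complex) \<Rightarrow> complex^'k \<Rightarrow> complex" where
  "even_part a c g w = (let \<sigma> = csqrt (w $ c) in
     (g (root_shift a c \<sigma> w) + g (root_shift a c (- \<sigma>) w)) / 2)"

text \<open>At \<open>\<sigma> = 0\<close> the quotient is replaced by its limit.\<close>

definition odd_quot :: "'k::finite \<Rightarrow> 'k \<Rightarrow> (complex^'k \<Rightarrow> complex) \<Rightarrow> complex^'k \<Rightarrow> complex" where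
  "odd_quot a c g w = (let \<sigma> = csqrt (w $ c) in
     if \<sigma> = 0 then pd a g (root_shift a c 0 w)
     else (g (root_shift a c \<sigma> w) - g (root_shift a c (- \<sigma>) w)) / (2 * \<i> * \<sigma>))"

lemma csqrt_square_cases:
  assumes "\<sigma>\<^sup>2 = s" obtains "csqrt s = \<sigma>" | "csqrt s = - \<sigma>"
  using assms power2_csqrt[of s] by (metis power2_eq_iff)

lemma even_part_root:
  assumes "\<sigma>\<^sup>2 = w $ c"
  shows "even_part a c g w = (g (root_shift a c \<sigma> w) + g (root_shift a c (- \<sigma>) w)) / 2"
  using csqrt_square_cases[OF assms] by cases (auto simp: even_part_def Let_def add.commute)

lemma odd_quot_root:
  assumes "\<sigma>\<^sup>2 = w $ c" "\<sigma> \<noteq> 0"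
  shows "odd_quot a c g w = (g (root_shift a c \<sigma> w) - g (root_shift a c (- \<sigma>) w)) / (2 * \<i> * \<sigma>)"
  using csqrt_square_cases[OF assms(1)] assms(2) by cases (auto simp: odd_quot_def Let_def field_simps)

lemma odd_quot_zero: "w $ c = 0 \<Longrightarrow> odd_quot a c g w = pd a g (root_shift a c 0 w)"
  by (simp add: odd_quot_def)

lemma even_part_zero: "w $ c = 0 \<Longrightarrow> even_part a c g w = g (root_shift a c 0 w)"
  by (simp add: even_part_def)

lemma root_domD: "w \<in> root_dom a c W \<Longrightarrow> \<sigma>\<^sup>2 = w $ c \<Longrightarrow> root_shift a c \<sigma> w \<in> W"
  "w \<in> root_dom a c W \<Longrightarrow> \<sigma>\<^sup>2 = w $ c \<Longrightarrow> root_shift a c (-\<sigma>) w \<in> W"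
  by (auto simp: root_dom_def)

lemma root_near:
  fixes s0 :: complex
  assumes "\<sigma>\<^sup>2 = s" "cmod (s - s0) < e\<^sup>2" "e > 0"
  shows "\<exists>\<sigma>0. \<sigma>0\<^sup>2 = s0 \<and> cmod (\<sigma> - \<sigma>0) < e"
proof (rule ccontr)
  assume n: "\<not> ?thesis"
  have "cmod (\<sigma> - csqrt s0) \<ge> e" using n power2_csqrt by (meson linorder_not_less)
  moreover have "(- csqrt s0)\<^sup>2 = s0" by simp
  then have "cmod (\<sigma> - (- csqrt s0)) \<ge> e" using n by (meson linorder_not_less)
  ultimately have "e * e \<le> cmod (\<sigma> - csqrt s0) * cmod (\<sigma> + csqrt s0)" using assms(3) by (intro mult_mono) auto
  also have "\<dots> = cmod (s - s0)"
  proof -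
    have "(\<sigma> - csqrt s0) * (\<sigma> + csqrt s0) = \<sigma>\<^sup>2 - (csqrt s0)\<^sup>2" by (simp add: power2_eq_square algebra_simps)
    then show ?thesis using assms(1) by (simp flip: norm_mult)
  qed
  finally show False using assms(2) by (simp add: power2_eq_square)
qed

text \<open>The set of the two roots of \<open>s\<close> depends continuously on \<open>s\<close>, although near \<open>s = 0\<close> no continuous branch of
  the root exists. This replaces such a branch in the proofs of openness and continuity.\<close>

lemma eventually_all_roots:
  assumes Q: "\<And>\<sigma>0. \<sigma>0\<^sup>2 = w0 $ c \<Longrightarrow> eventually (\<lambda>p. Q (fst p) (snd p)) (nhds (w0, \<sigma>0))"
  shows "eventually (\<lambda>w::complex^'k::finite. \<forall>\<sigma>. \<sigma>\<^sup>2 = w $ c \<longrightarrow> Q w \<sigma>) (nhds w0)"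
proof -
  define S where "S = {\<sigma>. \<sigma>\<^sup>2 = w0 $ c}"
  have "S \<subseteq> {csqrt (w0 $ c), - csqrt (w0 $ c)}"
    unfolding S_def by (auto elim!: csqrt_square_cases)
  then have fin: "finite S" by (rule finite_subset) simp
  have ne: "S \<noteq> {}" using power2_csqrt unfolding S_def by blast
  have "\<exists>P e. e > 0 \<and> eventually P (nhds w0) \<and> (\<forall>w \<sigma>. P w \<longrightarrow> dist \<sigma> \<sigma>0 < e \<longrightarrow> Q w \<sigma>)" if \<sigma>0: "\<sigma>0 \<in> S" for \<sigma>0
  proof -
    obtain P R where PR: "eventually P (nhds w0)" "eventually R (nhds \<sigma>0)" "\<And>w \<sigma>. P w \<Longrightarrow> R \<sigma> \<Longrightarrow> Q w \<sigma>"
      using Q[of \<sigma>0] \<sigma>0 unfolding S_def nhds_prod eventually_prod_filter by auto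
    obtain e where "e > 0" "\<And>\<sigma>. dist \<sigma> \<sigma>0 < e \<Longrightarrow> R \<sigma>"
      using PR(2) unfolding eventually_nhds_metric by blast
    then show ?thesis using PR by blast
  qed
  then obtain P e where Pe: "\<And>\<sigma>0. \<sigma>0 \<in> S \<Longrightarrow> e \<sigma>0 > 0 \<and> eventually (P \<sigma>0) (nhds w0) \<and>
      (\<forall>w \<sigma>. P \<sigma>0 w \<longrightarrow> dist \<sigma> \<sigma>0 < e \<sigma>0 \<longrightarrow> Q w \<sigma>)"
    by metis
  define E where "E = Min (e ` S)"
  have E: "E > 0" "\<And>\<sigma>0. \<sigma>0 \<in> S \<Longrightarrow> E \<le> e \<sigma>0" using Pe fin ne by (auto simp: E_def)
  have "((\<lambda>w. w $ c) \<longlongrightarrow> w0 $ c) (nhds w0)" by (intro tendsto_intros filterlim_ident)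
  then have "eventually (\<lambda>w. dist (w $ c) (w0 $ c) < E\<^sup>2) (nhds w0)"
    by (rule tendstoD) (use E in simp)
  moreover have "eventually (\<lambda>w. \<forall>\<sigma>0\<in>S. P \<sigma>0 w) (nhds w0)"
    using Pe by (intro eventually_ball_finite[OF fin]) auto
  ultimately show ?thesis
  proof eventually_elim
    case (elim w)
    show ?case
    proof (intro allI impI)
      fix \<sigma> assume "\<sigma>\<^sup>2 = w $ c"
      then obtain \<sigma>0 where "\<sigma>0 \<in> S" "cmod (\<sigma> - \<sigma>0) < E"
        using root_near[of \<sigma> "w $ c" "w0 $ c" E] elim E(1) by (auto simp: S_def dist_norm)
      then show "Q w \<sigma>" using elim Pe E(2) by (force simp: dist_norm)
    qed
  qed
qed

lemma tendsto_root_shift: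
  assumes g: "isCont g (root_shift a c \<sigma>0 w0)" and h: "((\<lambda>p. h (snd p)) \<longlongrightarrow> \<sigma>0) (nhds (w0, \<sigma>1))"
  shows "((\<lambda>p. g (root_shift a c (h (snd p)) (fst p))) \<longlongrightarrow> g (root_shift a c \<sigma>0 w0)) (nhds (w0, \<sigma>1))"
proof (rule isCont_tendsto_compose[OF g])
  have "(fst \<longlongrightarrow> w0) (nhds (w0, \<sigma>1))" using tendsto_fst[OF filterlim_ident[of "nhds (w0, \<sigma>1)"]] by simp
  then show "((\<lambda>p. root_shift a c (h (snd p)) (fst p)) \<longlongrightarrow> root_shift a c \<sigma>0 w0) (nhds (w0, \<sigma>1))"
    unfolding root_shift_def by (intro tendsto_intros h)
qed

lemma tendsto_snd_nhds: "(snd \<longlongrightarrow> y) (nhds (x, y))"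
  using tendsto_snd[OF filterlim_ident[of "nhds (x, y)"]] by simp

lemma open_root_dom:
  assumes "open W"
  shows "open (root_dom a c W)"
proof (subst open_subopen, intro ballI)
  fix w0 assume w0: "w0 \<in> root_dom a c W"
  have "eventually (\<lambda>w. \<forall>\<sigma>. \<sigma>\<^sup>2 = w $ c \<longrightarrow> root_shift a c \<sigma> w \<in> W) (nhds w0)"
  proof (rule eventually_all_roots)
    fix \<sigma>0 assume "\<sigma>0\<^sup>2 = w0 $ c"
    then have "root_shift a c \<sigma>0 w0 \<in> W" using w0 by (simp add: root_dom_def)
    then show "eventually (\<lambda>p. root_shift a c (snd p) (fst p) \<in> W) (nhds (w0, \<sigma>0))"
      using topological_tendstoD[OF tendsto_root_shift[where g="\<lambda>w. w" and h="\<lambda>\<sigma>. \<sigma>", OF _ tendsto_snd_nhds] assms] by simp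
  qed
  then show "\<exists>T. open T \<and> w0 \<in> T \<and> T \<subseteq> root_dom a c W"
    unfolding eventually_nhds root_dom_def by blast
qed

text \<open>A function that can be computed from any root is continuous if the computation is continuous in the point
  and the root jointly.\<close>

lemma isCont_of_roots:
  fixes q :: "complex^'k::finite \<Rightarrow> complex \<Rightarrow> complex"
  assumes F: "\<And>w \<sigma>. \<sigma>\<^sup>2 = w $ c \<Longrightarrow> F w = q w \<sigma>"
    and q: "\<And>\<sigma>0. \<sigma>0\<^sup>2 = w0 $ c \<Longrightarrow> ((\<lambda>p. q (fst p) (snd p)) \<longlongrightarrow> q w0 \<sigma>0) (nhds (w0, \<sigma>0))"
  shows "isCont F w0"
proof -
  have "(F \<longlongrightarrow> F w0) (nhds w0)"
  proof (rule tendstoI)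
    fix e :: real assume e: "e > 0"
    have "eventually (\<lambda>w. \<forall>\<sigma>. \<sigma>\<^sup>2 = w $ c \<longrightarrow> dist (q w \<sigma>) (F w0) < e) (nhds w0)"
      by (rule eventually_all_roots) (use tendstoD[OF q e] F in auto)
    then show "eventually (\<lambda>w. dist (F w) (F w0) < e) (nhds w0)"
      by eventually_elim (use F power2_csqrt in metis)
  qed
  then show ?thesis by (simp add: isCont_def tendsto_at_iff_tendsto_nhds)
qed

lemma hol_isCont: "hol W g \<Longrightarrow> w \<in> W \<Longrightarrow> isCont g w"
  using continuous_on_eq_continuous_at by (auto simp: hol_def)

lemma continuous_on_even_part:
  assumes g: "hol W g"
  shows "continuous_on (root_dom a c W) (even_part a c g)"
proof (intro continuous_at_imp_continuous_on ballI)
  fix w0 assume w0: "w0 \<in> root_dom a c W"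
  show "isCont (even_part a c g) w0"
  proof (rule isCont_of_roots[OF even_part_root])
    fix \<sigma>0 assume "\<sigma>0\<^sup>2 = w0 $ c"
    note W = root_domD[OF w0 this]
    show "((\<lambda>p. (g (root_shift a c (snd p) (fst p)) + g (root_shift a c (- snd p) (fst p))) / 2) \<longlongrightarrow>
        (g (root_shift a c \<sigma>0 w0) + g (root_shift a c (- \<sigma>0) w0)) / 2) (nhds (w0, \<sigma>0))"
      by (intro tendsto_intros tendsto_root_shift[where h="\<lambda>\<sigma>. \<sigma>"] tendsto_root_shift[where h="\<lambda>\<sigma>. - \<sigma>"]
          tendsto_snd_nhds hol_isCont[OF g] W) simp
  qed
qed

text \<open>At a point with \<open>s = 0\<close> the quotient is compared with the derivative by means of the mean value inequality
  between \<open>u - \<i>\<sigma>\<close> and \<open>u + \<i>\<sigma>\<close>.\<close>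

lemma continuous_on_odd_quot:
  assumes ac: "a \<noteq> c" and g: "hol W g"
  shows "continuous_on (root_dom a c W) (odd_quot a c g)"
proof (intro continuous_at_imp_continuous_on ballI)
  fix w0 assume w0: "w0 \<in> root_dom a c W"
  define q where "q = (\<lambda>w \<sigma>. if \<sigma> = 0 then pd a g (root_shift a c \<sigma> w)
    else (g (root_shift a c \<sigma> w) - g (root_shift a c (- \<sigma>) w)) / (2 * \<i> * \<sigma>))"
  have oW: "open W" using g by (simp add: hol_def)
  show "isCont (odd_quot a c g) w0"
  proof (rule isCont_of_roots)
    show "odd_quot a c g w = q w \<sigma>" if "\<sigma>\<^sup>2 = w $ c" for w \<sigma>
      using that odd_quot_zero[of w c a g] odd_quot_root[OF that, of a g] by (auto simp: q_def)
    fix \<sigma>0 assume "\<sigma>0\<^sup>2 = w0 $ c"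
    note W = root_domD[OF w0 this]
    show "((\<lambda>p. q (fst p) (snd p)) \<longlongrightarrow> q w0 \<sigma>0) (nhds (w0, \<sigma>0))"
    proof (cases "\<sigma>0 = 0")
      case False
      have "((\<lambda>p. (g (root_shift a c (snd p) (fst p)) - g (root_shift a c (- snd p) (fst p))) / (2 * \<i> * snd p)) \<longlongrightarrow>
          (g (root_shift a c \<sigma>0 w0) - g (root_shift a c (- \<sigma>0) w0)) / (2 * \<i> * \<sigma>0)) (nhds (w0, \<sigma>0))"
        by (intro tendsto_intros tendsto_root_shift[where h="\<lambda>\<sigma>. \<sigma>"] tendsto_root_shift[where h="\<lambda>\<sigma>. - \<sigma>"]
          tendsto_snd_nhds hol_isCont[OF g] W) (simp_all add: False)
      moreover have "eventually (\<lambda>p. snd p \<noteq> 0) (nhds (w0, \<sigma>0))"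
        by (rule tendsto_imp_eventually_ne[OF tendsto_snd_nhds False])
      ultimately show ?thesis
        by (subst filterlim_cong[OF refl refl, where g="\<lambda>p. (g (root_shift a c (snd p) (fst p)) - g (root_shift a c (- snd p) (fst p))) / (2 * \<i> * snd p)"])
          (auto simp: q_def False elim!: eventually_mono)
    next
      case True
      let ?z = "root_shift a c 0 w0" and ?c = "pd a g (root_shift a c 0 w0)"
      have zW: "?z \<in> W" using W(1) True by simp
      show ?thesis
      proof (rule tendstoI)
        fix e :: real assume e: "e > 0"
        have "eventually (\<lambda>y. y \<in> W) (nhds ?z)" using oW zW by (rule eventually_nhds_in_open)
        moreover have "(pd a g \<longlongrightarrow> ?c) (nhds ?z)"
          using hol_isCont[OF hol_pd[OF g] zW] by (simp add: isCont_def tendsto_at_iff_tendsto_nhds)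
        then have "eventually (\<lambda>y. dist (pd a g y) ?c < e/2) (nhds ?z)"
          by (rule tendstoD) (use e in simp)
        ultimately have "eventually (\<lambda>y. y \<in> W \<and> dist (pd a g y) ?c < e/2) (nhds ?z)" by eventually_elim simp
        then obtain d where d: "d > 0" "\<And>y. dist y ?z < d \<Longrightarrow> y \<in> W \<and> dist (pd a g y) ?c < e/2"
          unfolding eventually_nhds_metric by blast
        let ?C = "ball ?z d"
        have ev: "eventually (\<lambda>p. root_shift a c (h (snd p)) (fst p) \<in> ?C) (nhds (w0, \<sigma>0))"
          if "((\<lambda>p. h (snd p)) \<longlongrightarrow> 0) (nhds (w0, \<sigma>0))" for h
          using topological_tendstoD[OF tendsto_root_shift[where g="\<lambda>w. w" and h=h, OF _ that] open_ball] d(1) by simp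
        have s: "((\<lambda>p. snd p) \<longlongrightarrow> 0) (nhds (w0, \<sigma>0))" "((\<lambda>p. - snd p) \<longlongrightarrow> 0) (nhds (w0, \<sigma>0))"
          using tendsto_snd_nhds[of \<sigma>0 w0] tendsto_minus[OF tendsto_snd_nhds[of \<sigma>0 w0]] True by simp_all
        from ev[where h="\<lambda>\<sigma>. \<sigma>", OF s(1)] ev[where h="\<lambda>\<sigma>. - \<sigma>", OF s(2)]
        show "eventually (\<lambda>p. dist (q (fst p) (snd p)) (q w0 \<sigma>0) < e) (nhds (w0, \<sigma>0))"
          unfolding True
        proof eventually_elim
          case (elim p)
          obtain w \<sigma> where p: "p = (w, \<sigma>)" by (cases p)
          have inC: "root_shift a c \<sigma> w \<in> ?C" "root_shift a c (-\<sigma>) w \<in> ?C" using elim by (simp_all add: p)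
          have q0: "q w0 0 = ?c" by (simp add: q_def)
          show ?case
          proof (cases "\<sigma> = 0")
            case s0: True
            then show ?thesis using d(2)[of "root_shift a c \<sigma> w"] inC(1) e by (simp add: p q_def dist_commute)
          next
            case False
            let ?y = "root_shift a c \<sigma> w"
            have l: "?y = upd ?y a (w $ a + \<i> * \<sigma>)" "root_shift a c (-\<sigma>) w = upd ?y a (w $ a - \<i> * \<sigma>)"
              using ac by (auto simp: root_shift_def vec_eq_iff)
            have "cmod (g (upd ?y a (w $ a + \<i> * \<sigma>)) - g (upd ?y a (w $ a - \<i> * \<sigma>)) - ((w $ a + \<i> * \<sigma>) - (w $ a - \<i> * \<sigma>)) * ?c)
              \<le> e/2 * cmod ((w $ a + \<i> * \<sigma>) - (w $ a - \<i> * \<sigma>))"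
            proof (rule hol_mean_value[OF g, of ?C])
              show "?C \<subseteq> W" using d(2) by (auto simp: dist_commute)
              show "cmod (pd a g y - ?c) \<le> e/2" if "y \<in> ?C" for y
                using d(2)[of y] that by (simp add: dist_norm norm_minus_commute)
              show "upd ?y a (w $ a - \<i> * \<sigma>) \<in> ?C" using inC(2) unfolding l(2) .
              show "upd ?y a (w $ a + \<i> * \<sigma>) \<in> ?C" using inC(1) l(1) by simp
            qed auto
            then have *: "cmod (g ?y - g (root_shift a c (-\<sigma>) w) - (2 * \<i> * \<sigma>) * ?c) \<le> e/2 * cmod (2 * \<i> * \<sigma>)"
              using l by (simp add: algebra_simps)
            have "q w \<sigma> - ?c = (g ?y - g (root_shift a c (-\<sigma>) w) - (2 * \<i> * \<sigma>) * ?c) / (2 * \<i> * \<sigma>)"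
              using False by (simp add: q_def diff_divide_distrib)
            then have "cmod (q w \<sigma> - ?c) \<le> e/2"
              using * False by (simp only: norm_divide) (simp add: pos_divide_le_eq norm_mult)
            then show ?thesis using e q0 by (simp add: p dist_norm)
          qed
        qed
      qed
    qed
  qed
qed

text \<open>A branch of the square root that is holomorphic near \<open>s\<^sub>0 \<noteq> 0\<close>, wherever \<open>s\<^sub>0\<close> lies in the plane.\<close>

definition local_root :: "complex \<Rightarrow> complex \<Rightarrow> complex" where
  "local_root s0 s = csqrt (s / s0) * csqrt s0"

lemma local_root_square: "s0 \<noteq> 0 \<Longrightarrow> (local_root s0 s)\<^sup>2 = s"
  by (simp add: local_root_def power_mult_distrib)

lemma local_root_self: "s0 \<noteq> 0 \<Longrightarrow> local_root s0 s0 = csqrt s0"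
  by (simp add: local_root_def)

lemma local_root_deriv:
  assumes "s0 \<noteq> 0"
  shows "(local_root s0 has_field_derivative 1 / (2 * csqrt s0)) (at s0)"
proof -
  have "1 \<notin> \<real>\<^sub>\<le>\<^sub>0" by (simp add: complex_nonpos_Reals_iff)
  then have "(csqrt has_field_derivative inverse (2 * csqrt (s0/s0))) (at (s0/s0))"
    using assms by (intro has_field_derivative_csqrt) simp
  then have "((\<lambda>s. csqrt (s / s0) * csqrt s0) has_field_derivative (inverse (2 * csqrt (s0/s0)) * (1/s0)) * csqrt s0) (at s0)"
    by (intro DERIV_cmult_right DERIV_chain2[where f=csqrt] DERIV_cdivide DERIV_ident)
  moreover have "(inverse (2 * csqrt (s0/s0)) * (1/s0)) * csqrt s0 = 1 / (2 * csqrt s0)"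
    using assms power2_csqrt[of s0] by (simp add: field_simps power2_eq_square)
  ultimately show ?thesis unfolding local_root_def by simp
qed

lemma root_shift_upd:
  assumes "a \<noteq> c"
  shows "j \<noteq> a \<Longrightarrow> j \<noteq> c \<Longrightarrow> root_shift a c \<sigma> (upd w j t) = upd (root_shift a c \<sigma> w) j t"
    and "root_shift a c \<sigma> (upd w a t) = upd (root_shift a c \<sigma> w) a (t + \<i> * \<sigma>)"
    and "root_shift a c \<sigma> (upd w c t) = upd (root_shift a c \<sigma>' w) a (w $ a + \<i> * \<sigma>)"
  using assms by (auto simp: root_shift_def vec_eq_iff)

lemma root_shift_deriv:
  assumes g: "hol W g" and ac: "a \<noteq> c" "j \<noteq> c" and w: "root_shift a c \<sigma> w \<in> W"
  shows "((\<lambda>t. g (root_shift a c \<sigma> (upd w j t))) has_field_derivative pd j g (root_shift a c \<sigma> w)) (at (w $ j))"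
proof (cases "j = a")
  case True
  have "((\<lambda>t. g (upd (root_shift a c \<sigma> w) a t)) has_field_derivative pd a g (root_shift a c \<sigma> w)) (at (w $ a + \<i> * \<sigma>))"
    using pd_self[OF g w, of a] ac by (simp add: root_shift_def)
  then show ?thesis using ac True by (simp add: root_shift_upd DERIV_shift)
next
  case False
  then show ?thesis using pd_self[OF g w, of j] ac by (simp add: root_shift_upd) (simp add: root_shift_def)
qed

lemma root_shift_deriv_root:
  assumes g: "hol W g" and ac: "a \<noteq> c" and w: "root_shift a c \<sigma> w \<in> W"
    and h: "(h has_field_derivative h') (at (w $ c))" "h (w $ c) = \<sigma>"
  shows "((\<lambda>t. g (root_shift a c (h t) (upd w c t))) has_field_derivative pd a g (root_shift a c \<sigma> w) * (\<i> * h')) (at (w $ c))"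
proof -
  have "((\<lambda>t. g (upd (root_shift a c \<sigma> w) a t)) has_field_derivative pd a g (root_shift a c \<sigma> w)) (at (w $ a + \<i> * h (w $ c)))"
    using pd_self[OF g w, of a] ac h by (simp add: root_shift_def)
  then have "((\<lambda>t. g (upd (root_shift a c \<sigma> w) a (w $ a + \<i> * h t))) has_field_derivative pd a g (root_shift a c \<sigma> w) * (\<i> * h')) (at (w $ c))"
    by (rule DERIV_chain2) (auto intro!: derivative_eq_intros h)
  then show ?thesis using root_shift_upd(3)[OF ac, where \<sigma>'=\<sigma>] by simp
qed

lemma even_part_deriv:
  assumes ac: "a \<noteq> c" "j \<noteq> c" and g: "hol W g" and w: "w \<in> root_dom a c W"
  shows "((\<lambda>t. even_part a c g (upd w j t)) has_field_derivative even_part a c (pd j g) w) (at (w $ j))"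
  unfolding even_part_def Let_def using ac
  by (auto intro!: derivative_eq_intros root_shift_deriv[OF g] root_domD[OF w])

lemma odd_quot_deriv:
  assumes ac: "a \<noteq> c" and g: "hol W g" and w: "w \<in> root_dom a c W"
  shows "((\<lambda>t. odd_quot a c g (upd w a t)) has_field_derivative odd_quot a c (pd a g) w) (at (w $ a))"
proof (cases "csqrt (w $ c) = 0")
  case True
  then show ?thesis using root_shift_deriv[OF hol_pd[OF g] ac ac, where w=w and \<sigma>=0] root_domD(1)[OF w, of 0] ac
    by (simp add: odd_quot_zero)
next
  case False
  have "((\<lambda>t. (g (root_shift a c (csqrt (w $ c)) (upd w a t)) - g (root_shift a c (- csqrt (w $ c)) (upd w a t))) / (2 * \<i> * csqrt (w $ c)))
     has_field_derivative (pd a g (root_shift a c (csqrt (w $ c)) w) - pd a g (root_shift a c (- csqrt (w $ c)) w)) / (2 * \<i> * csqrt (w $ c))) (at (w $ a))"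
    by (intro DERIV_cdivide DERIV_diff root_shift_deriv[OF g ac ac] root_domD[OF w]) auto
  then show ?thesis using False ac by (simp add: odd_quot_def Let_def)
qed

lemma odd_quot_differentiable:
  assumes ac: "a \<noteq> c" "j \<noteq> c" and g: "hol W g" and w: "w \<in> root_dom a c W"
  shows "(\<lambda>t. odd_quot a c g (upd w j t)) field_differentiable at (w $ j)"
proof (cases "csqrt (w $ c) = 0")
  case True
  then have "((\<lambda>t. odd_quot a c g (upd w j t)) has_field_derivative pd j (pd a g) (root_shift a c 0 w)) (at (w $ j))"
    using root_shift_deriv[OF hol_pd[OF g] ac, where w=w and \<sigma>=0] root_domD(1)[OF w, of 0] ac
    by (simp add: odd_quot_zero)
  then show ?thesis unfolding field_differentiable_def by blast
next
  case False
  have "((\<lambda>t. (g (root_shift a c (csqrt (w $ c)) (upd w j t)) - g (root_shift a c (- csqrt (w $ c)) (upd w j t))) / (2 * \<i> * csqrt (w $ c)))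
     has_field_derivative (pd j g (root_shift a c (csqrt (w $ c)) w) - pd j g (root_shift a c (- csqrt (w $ c)) w)) / (2 * \<i> * csqrt (w $ c))) (at (w $ j))"
    by (intro DERIV_cdivide DERIV_diff root_shift_deriv[OF g ac] root_domD[OF w]) auto
  then show ?thesis using False ac by (auto simp: odd_quot_def Let_def field_differentiable_def)
qed

text \<open>Chain rule with a local branch of the root, whose derivative is \<open>1 / (2\<sigma>)\<close>. The derivatives of both functions
  are again an even part and an odd quotient, so the root disappears from the result.\<close>

lemma root_part_deriv_square:
  assumes ac: "a \<noteq> c" and g: "hol W g" and w: "w \<in> root_dom a c W" "w $ c \<noteq> 0"
  shows "((\<lambda>t. even_part a c g (upd w c t)) has_field_derivative - odd_quot a c (pd a g) w / 2) (at (w $ c))" (is ?E)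
    and "((\<lambda>t. odd_quot a c g (upd w c t)) has_field_derivative
       (even_part a c (pd a g) w - odd_quot a c g w) / (2 * w $ c)) (at (w $ c))" (is ?O)
proof -
  define \<sigma> where "\<sigma> = csqrt (w $ c)"
  have s2: "\<sigma>\<^sup>2 = w $ c" and s0: "\<sigma> \<noteq> 0" using w by (auto simp: \<sigma>_def)
  define h where "h = local_root (w $ c)"
  have h: "(h has_field_derivative 1 / (2 * \<sigma>)) (at (w $ c))" "h (w $ c) = \<sigma>"
    using local_root_deriv local_root_self w by (auto simp: h_def \<sigma>_def)
  have nh: "((\<lambda>t. - h t) has_field_derivative - (1 / (2 * \<sigma>))) (at (w $ c))" using h(1) by (rule DERIV_minus)
  have p: "((\<lambda>t. g (root_shift a c (h t) (upd w c t))) has_field_derivative pd a g (root_shift a c \<sigma> w) * (\<i> * (1 / (2 * \<sigma>)))) (at (w $ c))"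
    by (rule root_shift_deriv_root[OF g ac root_domD(1)[OF w(1) s2] h])
  have n: "((\<lambda>t. g (root_shift a c (- h t) (upd w c t))) has_field_derivative pd a g (root_shift a c (-\<sigma>) w) * (\<i> * (- (1 / (2 * \<sigma>))))) (at (w $ c))"
    by (rule root_shift_deriv_root[OF g ac root_domD(2)[OF w(1) s2] nh]) (simp add: h)
  have ev: "eventually (\<lambda>t. (h t)\<^sup>2 = t \<and> h t \<noteq> 0) (nhds (w $ c))"
  proof -
    have "eventually (\<lambda>t. t \<noteq> 0) (nhds (w $ c))" using w(2) by (intro t1_space_nhds) auto
    then show ?thesis
    proof eventually_elim
      case (elim t)
      have "(h t)\<^sup>2 = t" unfolding h_def by (rule local_root_square[OF w(2)])
      then show ?case using elim by auto
    qed
  qed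
  let ?p = "pd a g (root_shift a c \<sigma> w)" and ?n = "pd a g (root_shift a c (-\<sigma>) w)"
  have E: "((\<lambda>t. (g (root_shift a c (h t) (upd w c t)) + g (root_shift a c (- h t) (upd w c t))) / 2) has_field_derivative
     (?p * (\<i> * (1 / (2 * \<sigma>))) + ?n * (\<i> * (- (1 / (2 * \<sigma>))))) / 2) (at (w $ c))"
    by (intro DERIV_cdivide DERIV_add p n)
  have Ev: "(?p * (\<i> * (1 / (2 * \<sigma>))) + ?n * (\<i> * (- (1 / (2 * \<sigma>))))) / 2 = - odd_quot a c (pd a g) w / 2"
    unfolding odd_quot_root[where w=w, OF s2 s0] using s0 by (simp add: field_simps)
  show ?E
    by (rule iffD1[OF DERIV_cong_ev E]) 
       (use ev Ev in \<open>auto elim!: eventually_mono simp: even_part_root\<close>)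
  let ?gp = "g (root_shift a c \<sigma> w)" and ?gn = "g (root_shift a c (-\<sigma>) w)"
  have O: "((\<lambda>t. (g (root_shift a c (h t) (upd w c t)) - g (root_shift a c (- h t) (upd w c t))) / (2 * \<i> * h t)) has_field_derivative
     ((?p * (\<i> * (1 / (2 * \<sigma>))) - ?n * (\<i> * (- (1 / (2 * \<sigma>))))) * (2 * \<i> * \<sigma>) - (?gp - ?gn) * (2 * \<i> * (1 / (2 * \<sigma>)))) / ((2 * \<i> * \<sigma>) * (2 * \<i> * \<sigma>))) (at (w $ c))"
    using DERIV_divide[OF DERIV_diff[OF p n] DERIV_cmult[OF h(1), of "2 * \<i>"]] h(2) s0 by simp
  have Ov: "((?p * (\<i> * (1 / (2 * \<sigma>))) - ?n * (\<i> * (- (1 / (2 * \<sigma>))))) * (2 * \<i> * \<sigma>) - (?gp - ?gn) * (2 * \<i> * (1 / (2 * \<sigma>)))) / ((2 * \<i> * \<sigma>) * (2 * \<i> * \<sigma>))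
     = (even_part a c (pd a g) w - odd_quot a c g w) / (2 * w $ c)"
    unfolding odd_quot_root[where w=w, OF s2 s0] even_part_root[where w=w, OF s2] s2[symmetric] using s0 
    by (simp add: field_simps power2_eq_square)
  show ?O
    by (rule iffD1[OF DERIV_cong_ev O])
       (use ev Ov in \<open>auto elim!: eventually_mono simp: odd_quot_root\<close>)
qed

lemma pd_cong_open:
  assumes "open U" "w \<in> U" "\<And>w. w \<in> U \<Longrightarrow> F w = G w"
  shows "pd j F w = pd j G w"
  unfolding pd_def
proof (rule deriv_cong_ev)
  have "eventually (\<lambda>t. t \<in> {t. upd w j t \<in> U}) (nhds (w $ j))"
    using assms by (intro eventually_nhds_in_open open_line) auto
  then show "eventually (\<lambda>t. F (upd w j t) = G (upd w j t)) (nhds (w $ j))"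
    by eventually_elim (use assms(3) in auto)
qed simp

text \<open>A coordinate hyperplane has no interior, so identities between continuous functions may be proved off it.\<close>

lemma eq_across_hyperplane:
  fixes F G :: "complex^'k::finite \<Rightarrow> complex"
  assumes "open U" "continuous_on U F" "continuous_on U G"
    and eq: "\<And>w. w \<in> U \<Longrightarrow> w $ c \<noteq> 0 \<Longrightarrow> F w = G w"
    and w: "w \<in> U"
  shows "F w = G w"
proof (cases "w $ c = 0")
  case True
  let ?S = "{t. upd w c t \<in> U}"
  have "continuous_on ?S (\<lambda>t. F (upd w c t) - G (upd w c t))"
    by (intro continuous_intros continuous_on_compose2[OF assms(2)] continuous_on_compose2[OF assms(3)]) auto
  moreover have "0 \<in> ?S" using w True by (metis mem_Collect_eq upd_triv)
  ultimately have "((\<lambda>t. F (upd w c t) - G (upd w c t)) \<longlongrightarrow> F (upd w c 0) - G (upd w c 0)) (at 0)"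
    using open_line[OF assms(1), of w c] by (auto simp: continuous_on_eq_continuous_at isCont_def)
  moreover have "eventually (\<lambda>t. F (upd w c t) - G (upd w c t) = 0) (at 0)"
  proof -
    have "eventually (\<lambda>t. t \<in> ?S - {0}) (at 0)"
      using eventually_at_in_open[OF open_line[OF assms(1), of w c]] \<open>0 \<in> ?S\<close> by blast
    then show ?thesis by eventually_elim (use eq in auto)
  qed
  ultimately have "F (upd w c 0) - G (upd w c 0) = 0"
    using tendsto_unique[OF _ _ tendsto_eventually] trivial_limit_at by blast
  then show ?thesis using True by (metis eq_iff_diff_eq_0 upd_triv)
qed (use eq w in auto)

text \<open>Removable singularity theorem on the line through the point in direction \<open>c\<close>.\<close>

lemma differentiable_across_hyperplane:
  fixes F :: "complex^'k::finite \<Rightarrow> complex"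
  assumes "open U" "continuous_on U F"
    and eq: "\<And>w. w \<in> U \<Longrightarrow> w $ c \<noteq> 0 \<Longrightarrow> (\<lambda>t. F (upd w c t)) field_differentiable at (w $ c)"
    and w: "w \<in> U"
  shows "(\<lambda>t. F (upd w c t)) field_differentiable at (w $ c)"
proof -
  let ?S = "{t. upd w c t \<in> U}"
  have op: "open ?S" by (rule open_line[OF assms(1)])
  have "(\<lambda>t. F (upd w c t)) holomorphic_on ?S"
  proof (rule no_isolated_singularity[OF _ _ op, of _ "{0}"])
    show "continuous_on ?S (\<lambda>t. F (upd w c t))"
      by (intro continuous_intros continuous_on_compose2[OF assms(2)]) auto
    show "(\<lambda>t. F (upd w c t)) holomorphic_on ?S - {0}"
    proof (rule holomorphic_onI)
      fix t assume "t \<in> ?S - {0}"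
      then have "(\<lambda>t. F (upd w c t)) field_differentiable at t" using eq[of "upd w c t"] by simp
      then show "(\<lambda>t. F (upd w c t)) field_differentiable at t within ?S - {0}"
        by (rule field_differentiable_at_within)
    qed
  qed auto
  then show ?thesis using op w by (intro holomorphic_on_imp_differentiable_at) auto
qed

lemma hol_even_part:
  assumes ac: "a \<noteq> c" and g: "hol W g"
  shows "hol (root_dom a c W) (even_part a c g)"
proof (rule holI)
  show o: "open (root_dom a c W)" using g by (simp add: open_root_dom hol_def)
  show c: "continuous_on (root_dom a c W) (even_part a c g)"
    using g by (rule continuous_on_even_part)
  fix w j assume w: "w \<in> root_dom a c W"
  show "(\<lambda>t. even_part a c g (upd w j t)) field_differentiable at (w $ j)"
  proof (cases "j = c")
    case True
    show ?thesis unfolding True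
    proof (rule differentiable_across_hyperplane[OF o c _ w])
      fix w assume "w \<in> root_dom a c W" "w $ c \<noteq> 0"
      from root_part_deriv_square(1)[OF ac g this]
      show "(\<lambda>t. even_part a c g (upd w c t)) field_differentiable at (w $ c)"
        unfolding field_differentiable_def by blast
    qed
  next
    case False
    then show ?thesis using even_part_deriv[OF ac False g w] by (auto simp: field_differentiable_def)
  qed
qed

lemma hol_odd_quot:
  assumes ac: "a \<noteq> c" and g: "hol W g"
  shows "hol (root_dom a c W) (odd_quot a c g)"
proof (rule holI)
  show o: "open (root_dom a c W)" using g by (simp add: open_root_dom hol_def)
  show c: "continuous_on (root_dom a c W) (odd_quot a c g)"
    using g ac by (simp add: continuous_on_odd_quot)
  fix w j assume w: "w \<in> root_dom a c W"
  show "(\<lambda>t. odd_quot a c g (upd w j t)) field_differentiable at (w $ j)"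
  proof (cases "j = c")
    case True
    show ?thesis unfolding True
    proof (rule differentiable_across_hyperplane[OF o c _ w])
      fix w assume "w \<in> root_dom a c W" "w $ c \<noteq> 0"
      from root_part_deriv_square(2)[OF ac g this]
      show "(\<lambda>t. odd_quot a c g (upd w c t)) field_differentiable at (w $ c)"
        unfolding field_differentiable_def by blast
    qed
  next
    case False
    then show ?thesis by (rule odd_quot_differentiable[OF ac _ g w])
  qed
qed

lemma pd_even_part: "a \<noteq> c \<Longrightarrow> hol W g \<Longrightarrow> w \<in> root_dom a c W \<Longrightarrow> pd a (even_part a c g) w = even_part a c (pd a g) w"
  by (rule pd_eqI[OF even_part_deriv])

lemma pd_odd_quot: "a \<noteq> c \<Longrightarrow> hol W g \<Longrightarrow> w \<in> root_dom a c W \<Longrightarrow> pd a (odd_quot a c g) w = odd_quot a c (pd a g) w"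
  by (rule pd_eqI[OF odd_quot_deriv])

text \<open>The Cauchy-Riemann equation \<open>\<partial>\<^sub>\<beta> A = - \<partial>\<^sub>\<alpha> B\<close> in the coordinates \<open>u\<close> and \<open>s\<close>.\<close>

lemma pd_square_even_part: 
  assumes ac: "a \<noteq> c" and g: "hol W g" and w: "w \<in> root_dom a c W"
  shows "pd c (even_part a c g) w = - pd a (odd_quot a c g) w / 2"
proof (rule eq_across_hyperplane[OF _ _ _ _ w])
  have h: "hol (root_dom a c W) (even_part a c g)" "hol (root_dom a c W) (odd_quot a c g)" 
    using hol_even_part[OF ac g] hol_odd_quot[OF ac g] by auto
  then show "open (root_dom a c W)" "continuous_on (root_dom a c W) (pd c (even_part a c g))"
    using continuous_on_pd by (auto simp: hol_def)
  show "continuous_on (root_dom a c W) (\<lambda>w. - pd a (odd_quot a c g) w / 2)"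
    using continuous_on_pd[OF h(2), of a] by (auto intro!: continuous_intros)
  show "pd c (even_part a c g) w = - pd a (odd_quot a c g) w / 2" if "w \<in> root_dom a c W" "w $ c \<noteq> 0" for w
    using pd_eqI[OF root_part_deriv_square(1)[OF ac g that]] pd_odd_quot[OF ac g that(1)] by simp
qed

text \<open>The Cauchy-Riemann equation \<open>\<partial>\<^sub>\<alpha> A = \<partial>\<^sub>\<beta> B\<close> with \<open>B = \<beta> b\<close>, in the coordinates \<open>u\<close> and \<open>s\<close>.\<close>

lemma pd_even_part_eq:
  assumes ac: "a \<noteq> c" and g: "hol W g" and w: "w \<in> root_dom a c W"
  shows "pd a (even_part a c g) w = odd_quot a c g w + 2 * w $ c * pd c (odd_quot a c g) w"
proof (cases "w $ c = 0")
  case True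
  then show ?thesis by (simp add: pd_even_part[OF assms] odd_quot_zero even_part_zero)
next
  case False
  then show ?thesis using pd_eqI[OF root_part_deriv_square(2)[OF ac g w False]] pd_even_part[OF assms]
    by (simp add: field_simps)
qed

lemma pd_pd_odd_quot:
  assumes ac: "a \<noteq> c" and g: "hol W g" and w: "w \<in> root_dom a c W"
  shows "pd a (pd a (odd_quot a c g)) w = odd_quot a c (pd a (pd a g)) w"
proof -
  have "open (root_dom a c W)" using g by (simp add: open_root_dom hol_def)
  then have "pd a (pd a (odd_quot a c g)) w = pd a (odd_quot a c (pd a g)) w"
    by (rule pd_cong_open[OF _ w]) (rule pd_odd_quot[OF ac g])
  then show ?thesis using pd_odd_quot[OF ac hol_pd[OF g] w] by simp
qed

text \<open>The operator is the Laplacian of \<open>\<real>\<^sup>4\<close> on functions of \<open>u\<close> and \<open>s = \<bar>v\<bar>\<^sup>2\<close>, \<open>v \<in> \<real>\<^sup>3\<close>. Differentiate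
  \<open>\<partial>\<^sub>u a = b + 2s \<partial>\<^sub>s b\<close> with respect to \<open>s\<close> and use the other Cauchy-Riemann equation on the left.\<close>

lemma odd_quot_harmonic:
  assumes ac: "a \<noteq> c" and g: "hol W g" and w: "w \<in> root_dom a c W"
  defines "b \<equiv> odd_quot a c g"
  shows "pd a (pd a b) w + 6 * pd c b w + 4 * w $ c * pd c (pd c b) w = 0"
proof -
  have b: "hol (root_dom a c W) b" unfolding b_def by (rule hol_odd_quot[OF ac g])
  have op: "open (root_dom a c W)" using b by (simp add: hol_def)
  \<comment> \<open>The equation for \<open>\<partial>\<^sub>u a\<close> holds on an open set and may be differentiated.\<close>
  have "pd c (even_part a c (pd a g)) w = pd c (\<lambda>w. b w + 2 * w $ c * pd c b w) w"
    by (rule pd_cong_open[OF op w]) (simp add: b_def pd_even_part_eq[OF ac g, symmetric] pd_even_part[OF ac g])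
  also have "\<dots> = 3 * pd c b w + 2 * w $ c * pd c (pd c b) w"
    by (rule pd_eqI) (auto intro!: derivative_eq_intros pd_self[OF b w] pd_self[OF hol_pd[OF b] w])
  finally have "pd c (even_part a c (pd a g)) w = 3 * pd c b w + 2 * w $ c * pd c (pd c b) w" .
  moreover have "pd a (pd a b) w = - 2 * pd c (even_part a c (pd a g)) w"
    using pd_square_even_part[OF ac hol_pd[OF g] w] pd_odd_quot[OF ac hol_pd[OF g] w] pd_pd_odd_quot[OF ac g w]
    by (simp add: b_def)
  ultimately show ?thesis by (simp only:) (simp add: algebra_simps)
qed

text \<open>Differentiating \<open>\<partial>\<^sub>u a = b + 2s \<partial>\<^sub>s b\<close> with respect to \<open>u\<close>, and writing the same equation for \<open>\<partial>\<^sub>u g\<close>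
  in place of \<open>g\<close>, yields the two orders of differentiation multiplied by \<open>2s\<close>.\<close>

lemma odd_quot_pd_commute:
  assumes ac: "a \<noteq> c" and g: "hol W g" and w: "w \<in> root_dom a c W"
  defines "b \<equiv> odd_quot a c g"
  shows "pd a (pd c b) w = pd c (pd a b) w"
proof -
  have b: "hol (root_dom a c W) b" unfolding b_def by (rule hol_odd_quot[OF ac g])
  have op: "open (root_dom a c W)" using b by (simp add: hol_def)
  show ?thesis
  proof (rule eq_across_hyperplane[OF op _ _ _ w])
    show "continuous_on (root_dom a c W) (pd a (pd c b))" "continuous_on (root_dom a c W) (pd c (pd a b))"
      by (intro continuous_on_pd hol_pd b)+
    fix w assume w: "w \<in> root_dom a c W" and n: "w $ c \<noteq> 0"
    have "pd a (even_part a c (pd a g)) w = pd a (\<lambda>w. b w + 2 * w $ c * pd c b w) w"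
      by (rule pd_cong_open[OF op w]) (simp add: b_def pd_even_part_eq[OF ac g, symmetric] pd_even_part[OF ac g])
    also have "\<dots> = pd a b w + 2 * w $ c * pd a (pd c b) w"
      using ac by (intro pd_eqI) (auto intro!: derivative_eq_intros pd_self[OF b w] pd_self[OF hol_pd[OF b] w])
    also have "pd a (even_part a c (pd a g)) w = odd_quot a c (pd a g) w + 2 * w $ c * pd c (odd_quot a c (pd a g)) w"
      by (rule pd_even_part_eq[OF ac hol_pd[OF g] w])
    also have "odd_quot a c (pd a g) w = pd a b w" unfolding b_def by (rule pd_odd_quot[OF ac g w, symmetric])
    also have "pd c (odd_quot a c (pd a g)) w = pd c (pd a b) w" 
      unfolding b_def by (rule pd_cong_open[OF op w]) (rule pd_odd_quot[OF ac g, symmetric])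
    finally show "pd a (pd c b) w = pd c (pd a b) w" using n by simp
  qed
qed

text \<open>Both Cauchy-Riemann equations express the derivatives of \<open>A\<close> by those of \<open>B\<close>; the terms with the factor \<open>s\<close>
  cancel because the mixed derivatives of \<open>B\<close> commute.\<close>

lemma even_part_laplacian:
  assumes ac: "a \<noteq> c" and g: "hol W g" and w: "w \<in> root_dom a c W"
  defines "A \<equiv> even_part a c g" and "B \<equiv> odd_quot a c g"
  shows "pd a (pd a A) w + 6 * pd c A w + 4 * w $ c * pd c (pd c A) w = - 2 * pd a B w"
proof -
  have B: "hol (root_dom a c W) B" unfolding B_def by (rule hol_odd_quot[OF ac g])
  have op: "open (root_dom a c W)" using B by (simp add: hol_def)
  have "pd a (pd a A) w = pd a (\<lambda>w. B w + 2 * w $ c * pd c B w) w"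
    by (rule pd_cong_open[OF op w]) (simp add: A_def B_def pd_even_part_eq[OF ac g])
  also have "\<dots> = pd a B w + 2 * w $ c * pd a (pd c B) w"
    using ac by (intro pd_eqI) (auto intro!: derivative_eq_intros pd_self[OF B w] pd_self[OF hol_pd[OF B] w])
  also have "pd a (pd c B) w = pd c (pd a B) w" unfolding B_def by (rule odd_quot_pd_commute[OF ac g w])
  finally have 1: "pd a (pd a A) w = pd a B w + 2 * w $ c * pd c (pd a B) w" .
  have 2: "pd c A w = - pd a B w / 2" unfolding A_def B_def by (rule pd_square_even_part[OF ac g w])
  have "pd c (pd c A) w = pd c (\<lambda>w. - pd a B w / 2) w"
    by (rule pd_cong_open[OF op w]) (simp add: A_def B_def pd_square_even_part[OF ac g])
  also have "\<dots> = - pd c (pd a B) w / 2"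
    by (intro pd_eqI) (auto intro!: derivative_eq_intros pd_self[OF hol_pd[OF B] w])
  finally have 3: "pd c (pd c A) w = - pd c (pd a B) w / 2" .
  show ?thesis unfolding 1 2 3 by (simp add: algebra_simps)
qed

section \<open>Stem functions in the coordinates \<open>\<alpha>\<^sub>h\<close> and \<open>\<beta>\<^sub>h\<^sup>2\<close>\<close>

text \<open>The variables in the list are replaced one after the other by a pair \<open>(u\<^sub>h, s\<^sub>h)\<close>, stored in the coordinates
  \<open>Inl h\<close> and \<open>Inr h\<close>; variables that are not yet replaced stay in \<open>Inl h\<close> as complex variables. The head of the
  list is treated last, which makes the even part or odd quotient in this variable directly accessible.\<close>

primrec stem_rep :: "'n::finite list \<Rightarrow> 'n set \<Rightarrow> ('n cvec \<Rightarrow> complex) \<Rightarrow> complex^('n + 'n) \<Rightarrow> complex" where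
  "stem_rep [] K \<phi> = (\<lambda>w. \<phi> (\<chi> h. w $ Inl h))"
| "stem_rep (h # hs) K \<phi> =
     (if h \<in> K then odd_quot (Inl h) (Inr h) else even_part (Inl h) (Inr h)) (stem_rep hs K \<phi>)"

primrec rep_dom :: "'n::finite list \<Rightarrow> 'n cvec set \<Rightarrow> (complex^('n + 'n)) set" where
  "rep_dom [] D = {w. (\<chi> h. w $ Inl h) \<in> D}"
| "rep_dom (h # hs) D = root_dom (Inl h) (Inr h) (rep_dom hs D)"

lemma hol_stem_rep:
  assumes \<phi>: "hol D \<phi>"
  shows "hol (rep_dom hs D) (stem_rep hs K \<phi>)"
proof (induction hs)
  case Nil
  have oD: "open D" and cD: "continuous_on D \<phi>" using \<phi> by (auto simp: hol_def)
  let ?p = "\<lambda>w::complex^('a + 'a). (\<chi> h. w $ Inl h) :: 'a cvec"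
  have cp: "continuous_on S ?p" for S by (intro continuous_intros)
  have o: "open {w. ?p w \<in> D}"
    using continuous_open_preimage[OF cp[of UNIV] open_UNIV oD] by (simp add: vimage_def)
  have "hol {w. ?p w \<in> D} (\<lambda>w. \<phi> (?p w))"
  proof (rule holI[OF o])
    show "continuous_on {w. ?p w \<in> D} (\<lambda>w. \<phi> (?p w))"
      by (rule continuous_on_compose2[OF cD cp]) auto
    fix w j assume w: "w \<in> {w. ?p w \<in> D}"
    show "(\<lambda>t. \<phi> (?p (upd w j t))) field_differentiable at (w $ j)"
    proof (cases j)
      case (Inl h)
      have "?p (upd w j t) = upd (?p w) h t" for t by (simp add: Inl vec_eq_iff)
      then show ?thesis using pd_self[OF \<phi>, of "?p w" h] w Inl by (auto simp: field_differentiable_def)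
    next
      case (Inr h)
      have "?p (upd w j t) = ?p w" for t by (simp add: Inr vec_eq_iff)
      then show ?thesis by simp
    qed
  qed
  then show ?case by simp
next
  case (Cons h hs)
  then show ?case by (simp add: hol_even_part hol_odd_quot)
qed

lemma stem_rep_cong: "K \<inter> set hs = K' \<inter> set hs \<Longrightarrow> stem_rep hs K \<phi> = stem_rep hs K' \<phi>"
proof (induction hs)
  case (Cons h hs)
  then have "h \<in> K \<longleftrightarrow> h \<in> K'" "K \<inter> set hs = K' \<inter> set hs" by auto
  with Cons show ?case by simp
qed simp

text \<open>The algebra homomorphism that sends each \<open>e\<^sub>h\<close> to \<open>\<i>\<close>, applied to the quaternionic coordinate \<open>b\<close>. It
  turns the commuting complex structures \<open>\<J>\<^sub>h\<close> into one; the components remain recoverable through their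
  different parities.\<close>

definition stem_char :: "quat \<Rightarrow> 'n::finite coeffs \<Rightarrow> complex" where
  "stem_char b w = (\<Sum>K\<in>UNIV. \<i> ^ card K * of_real (inner (w $ K) b))"

definition stem_parity :: "('n::finite) cvec set \<Rightarrow> 'n stem \<Rightarrow> bool" where
  "stem_parity D F \<longleftrightarrow> (\<forall>z\<in>D. \<forall>K h. F (conj_at h z) $ K = (-1) ^ card (K \<inter> {h}) * F z $ K)"

lemma conj_at_nth [simp]: "conj_at h z $ k = (if k = h then cnj (z $ k) else z $ k)"
  by (simp add: conj_at_def)

lemma stem_parity_simps:
  assumes "stem_parity D F" "z \<in> D"
  shows "h \<in> K \<Longrightarrow> F (conj_at h z) $ K = - F z $ K" "h \<notin> K \<Longrightarrow> F (conj_at h z) $ K = F z $ K"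
  using assms by (auto simp: stem_parity_def)

lemma stem_parity_zero:
  assumes "stem_parity D F" "z \<in> D" "h \<in> K" "Im (z $ h) = 0"
  shows "F z $ K = 0"
proof -
  have "conj_at h z = z" using assms(4) by (auto simp: vec_eq_iff complex_eq_iff)
  then have "F z $ K = - F z $ K" using stem_parity_simps(1)[OF assms(1-3)] by simp
  then have "2 *\<^sub>R F z $ K = 0" by (metis add.right_inverse scaleR_2)
  then show ?thesis by simp
qed

lemma root_shift_Inl:
  "root_shift (Inl h) (Inr h) \<sigma> w $ Inl k = (if k = h then w $ Inl h + \<i> * \<sigma> else w $ Inl k)"
  "root_shift (Inl h) (Inr h) \<sigma> w $ Inr k = (if k = h then 0 else w $ Inr k)"
  by (auto simp: root_shift_def)

text \<open>The point of evaluation when the variables in \<open>hs\<close> have been replaced and the others have not.\<close>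

definition rep_point :: "'n list \<Rightarrow> ('n::finite) cvec \<Rightarrow> complex^('n + 'n) \<Rightarrow> bool" where
  "rep_point hs z w \<longleftrightarrow> (\<forall>h. if h \<in> set hs
     then w $ Inl h = of_real (Re (z $ h)) \<and> w $ Inr h = of_real ((Im (z $ h))\<^sup>2) else w $ Inl h = z $ h)"

lemma rep_point_shift:
  assumes "rep_point (h # hs) z w" "h \<notin> set hs"
  shows "rep_point hs z (root_shift (Inl h) (Inr h) (Im (z $ h)) w)"
    and "rep_point hs (conj_at h z) (root_shift (Inl h) (Inr h) (- Im (z $ h)) w)"
  using assms by (auto simp: rep_point_def root_shift_Inl complex_eq_iff split: if_splits)

lemma rep_point_dom:
  assumes inv: "invariant_set D"
  shows "z \<in> D \<Longrightarrow> distinct hs \<Longrightarrow> rep_point hs z w \<Longrightarrow> w \<in> rep_dom hs D"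
proof (induction hs arbitrary: z w)
  case Nil
  then have "(\<chi> h. w $ Inl h) = z" by (simp add: rep_point_def vec_eq_iff)
  with Nil show ?case by simp
next
  case (Cons h hs)
  have z': "conj_at h z \<in> D" using inv Cons.prems(1) by (simp add: invariant_set_def)
  show ?case unfolding rep_dom.simps root_dom_def
  proof (clarify)
    fix \<sigma> assume "\<sigma>\<^sup>2 = w $ Inr h"
    then have "\<sigma>\<^sup>2 = (of_real (Im (z $ h)))\<^sup>2" using Cons.prems by (simp add: rep_point_def)
    then have "\<sigma> = of_real (Im (z $ h)) \<or> \<sigma> = - of_real (Im (z $ h))" by (simp add: power2_eq_iff)
    then show "root_shift (Inl h) (Inr h) \<sigma> w \<in> rep_dom hs D"
      using Cons.IH[OF Cons.prems(1) _ rep_point_shift(1)[OF Cons.prems(3)]] Cons.IH[OF z' _ rep_point_shift(2)[OF Cons.prems(3)]]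
        Cons.prems(2) by auto
  qed
qed

text \<open>Conjugating \<open>z\<^sub>h\<close> changes the sign of \<open>G\<^sub>L\<close> exactly if \<open>h \<in> L\<close>. So the even part in \<open>z\<^sub>h\<close> retains the terms with
  \<open>h \<notin> L\<close>, and the odd part those with \<open>h \<in> L\<close>; when all variables are treated a single component is left.\<close>

lemma stem_rep_value:
  assumes inv: "invariant_set D" and par: "stem_parity D G"
  shows "z \<in> D \<Longrightarrow> distinct hs \<Longrightarrow> rep_point hs z w \<Longrightarrow>
    (\<Prod>k\<in>K \<inter> set hs. \<i> * of_real (Im (z $ k))) * stem_rep hs K (\<lambda>z. stem_char b (G z)) w =
    (\<Sum>L | L \<inter> set hs = K \<inter> set hs. \<i> ^ card L * of_real (inner (G z $ L) b))"
proof (induction hs arbitrary: z w)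
  case Nil
  then have "(\<chi> h. w $ Inl h) = z" by (simp add: rep_point_def vec_eq_iff)
  then show ?case by (simp add: stem_char_def)
next
  case (Cons h hs)
  have z': "conj_at h z \<in> D" using inv Cons.prems(1) by (simp add: invariant_set_def)
  have h: "h \<notin> set hs" "distinct hs" using Cons.prems(2) by auto
  define g where "g = stem_rep hs K (\<lambda>z. stem_char b (G z))"
  define \<beta> where "\<beta> = Im (z $ h)"
  define P where "P = (\<Prod>k\<in>K \<inter> set hs. \<i> * of_real (Im (z $ k)) :: complex)"
  define t where "t = (\<lambda>L. \<i> ^ card L * of_real (inner (G z $ L) b) :: complex)"
  define S where "S = {L. L \<inter> set hs = K \<inter> set hs}"
  let ?wp = "root_shift (Inl h) (Inr h) (of_real \<beta>) w" and ?wn = "root_shift (Inl h) (Inr h) (- of_real \<beta>) w"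
  have p: "P * g ?wp = sum t S"
    using Cons.IH[OF Cons.prems(1) h(2) rep_point_shift(1)[OF Cons.prems(3) h(1)]]
    by (simp add: P_def g_def t_def S_def \<beta>_def)
  have n: "P * g ?wn = (\<Sum>L\<in>S. if h \<in> L then - t L else t L)"
  proof -
    have "P = (\<Prod>k\<in>K \<inter> set hs. \<i> * of_real (Im (conj_at h z $ k)))"
      unfolding P_def using h by (intro prod.cong) auto
    then have "P * g ?wn = (\<Sum>L\<in>S. \<i> ^ card L * of_real (inner (G (conj_at h z) $ L) b))"
      using Cons.IH[OF z' h(2) rep_point_shift(2)[OF Cons.prems(3) h(1)]]
      by (simp add: g_def S_def \<beta>_def)
    also have "\<dots> = (\<Sum>L\<in>S. if h \<in> L then - t L else t L)"
      by (intro sum.cong) (auto simp: t_def stem_parity_simps[OF par Cons.prems(1)])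
    finally show ?thesis .
  qed
  have sq: "(of_real \<beta>)\<^sup>2 = w $ Inr h" using Cons.prems(3) by (simp add: rep_point_def \<beta>_def)
  have fS: "finite S" by simp
  show ?case
  proof (cases "h \<in> K")
    case True
    have Pi: "(\<Prod>k\<in>K \<inter> set (h # hs). \<i> * of_real (Im (z $ k))) = \<i> * of_real \<beta> * P"
      using True h by (simp add: P_def \<beta>_def prod.insert Int_insert_right)
    have S': "{L. L \<inter> set (h # hs) = K \<inter> set (h # hs)} = {L \<in> S. h \<in> L}"
      using True h by (auto simp: S_def)
    \<comment> \<open>Twice the odd part: the terms with \<open>h \<notin> L\<close> cancel.\<close>
    have R: "2 * (\<Sum>L | L \<inter> set (h # hs) = K \<inter> set (h # hs). t L) = sum t S - (\<Sum>L\<in>S. if h \<in> L then - t L else t L)"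
      unfolding S' sum_subtractf[symmetric] sum.inter_filter[OF fS] sum_distrib_left
      by (intro sum.cong) auto
    show ?thesis
    proof (cases "\<beta> = 0")
      case b0: True
      have "(\<Sum>L | L \<inter> set (h # hs) = K \<inter> set (h # hs). t L) = 0"
        unfolding S' by (intro sum.neutral ballI) (use stem_parity_zero[OF par Cons.prems(1)] b0 in \<open>auto simp: t_def \<beta>_def\<close>)
      then show ?thesis unfolding Pi by (simp add: b0 t_def)
    next
      case False
      define Q where "Q = stem_rep (h # hs) K (\<lambda>z. stem_char b (G z)) w"
      have "Q = (g ?wp - g ?wn) / (2 * \<i> * of_real \<beta>)"
        using True odd_quot_root[OF sq, of "Inl h" g] False by (simp add: g_def Q_def)
      then have "2 * (\<i> * of_real \<beta> * Q) = g ?wp - g ?wn"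
        using False by (simp add: field_simps)
      then have "P * (2 * (\<i> * of_real \<beta> * Q)) = P * g ?wp - P * g ?wn"
        by (simp only: right_diff_distrib)
      then have "2 * (\<i> * of_real \<beta> * P * Q) = P * g ?wp - P * g ?wn"
        by (simp only: mult_ac)
      also have "\<dots> = 2 * (\<Sum>L | L \<inter> set (h # hs) = K \<inter> set (h # hs). t L)" using R p n by simp
      finally show ?thesis unfolding Pi t_def Q_def by simp
    qed
  next
    case False
    have Pi: "(\<Prod>k\<in>K \<inter> set (h # hs). \<i> * of_real (Im (z $ k))) = P"
      using False by (simp add: P_def)
    have S': "{L. L \<inter> set (h # hs) = K \<inter> set (h # hs)} = {L \<in> S. h \<notin> L}"
      using False h by (auto simp: S_def)
    have R: "2 * (\<Sum>L | L \<inter> set (h # hs) = K \<inter> set (h # hs). t L) = sum t S + (\<Sum>L\<in>S. if h \<in> L then - t L else t L)"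
      unfolding S' sum.distrib[symmetric] sum.inter_filter[OF fS] sum_distrib_left
      by (intro sum.cong) auto
    define Q where "Q = stem_rep (h # hs) K (\<lambda>z. stem_char b (G z)) w"
    have "Q = (g ?wp + g ?wn) / 2"
      using False even_part_root[OF sq, of "Inl h" g] by (simp add: g_def Q_def)
    then have "2 * (P * Q) = P * g ?wp + P * g ?wn"
      by (simp add: field_simps)
    also have "\<dots> = 2 * (\<Sum>L | L \<inter> set (h # hs) = K \<inter> set (h # hs). t L)" using R p n by simp
    finally show ?thesis unfolding Pi t_def Q_def by simp
  qed
qed

text \<open>The coordinates \<open>u\<^sub>h = \<alpha>\<^sub>h\<close> and \<open>s\<^sub>h = \<beta>\<^sub>h\<^sup>2\<close>, regarded as complex numbers.\<close>

definition even_coords :: "('n::finite) cvec \<Rightarrow> complex^('n + 'n)" where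
  "even_coords z = (\<chi> j. case j of Inl h \<Rightarrow> of_real (Re (z $ h)) | Inr h \<Rightarrow> of_real ((Im (z $ h))\<^sup>2))"

lemma even_coords_nth [simp]:
  "even_coords z $ Inl h = of_real (Re (z $ h))" "even_coords z $ Inr h = of_real ((Im (z $ h))\<^sup>2)"
  by (simp_all add: even_coords_def)

lemma even_coords_conj_at [simp]: "even_coords (conj_at h z) = even_coords z"
  by (auto simp: vec_eq_iff even_coords_def split: sum.split)

lemma even_coords_continuous: "continuous_on S (even_coords :: ('n::finite) cvec \<Rightarrow> complex^('n + 'n))"
  unfolding even_coords_def
  by (intro continuous_on_vec_lambda, rename_tac j, case_tac j) (auto intro!: continuous_intros)

lemma even_coords_dom:
  assumes "invariant_set D" "z \<in> D" "distinct hs" "set hs = UNIV"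
  shows "even_coords z \<in> rep_dom hs D"
  by (rule rep_point_dom[OF assms(1-3)]) (simp add: rep_point_def assms(4))

text \<open>At the points of interest the values \<open>\<Theta> b w\<close> are real; the real part only serves to get a real scalar.\<close>

definition radial :: "(quat \<Rightarrow> complex^('n + 'n) \<Rightarrow> complex) \<Rightarrow> complex^('n::finite + 'n) \<Rightarrow> quat" where
  "radial \<Theta> w = (\<Sum>b\<in>Basis. Re (\<Theta> b w) *\<^sub>R b)"

text \<open>The factorization \<open>G\<^sub>K = (\<Prod>k\<in>K. \<beta>\<^sub>k) E\<^sub>K\<close> with \<open>E\<^sub>K\<close> a holomorphic function of the \<open>u\<^sub>h\<close> and \<open>s\<^sub>h\<close>.\<close>

lemma stem_eq_radial:
  assumes inv: "invariant_set D" and par: "stem_parity D G" and z: "z \<in> D"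
    and hs: "distinct hs" "set hs = UNIV"
  shows "G z $ K = (\<Prod>k\<in>K. Im (z $ k)) *\<^sub>R radial (\<lambda>b. stem_rep hs K (\<lambda>z. stem_char b (G z))) (even_coords z)"
proof -
  define p where "p = (\<Prod>k\<in>K. Im (z $ k))"
  have *: "of_real p * stem_rep hs K (\<lambda>z. stem_char b (G z)) (even_coords z) = of_real (inner (G z $ K) b)" for b
  proof -
    have "rep_point hs z (even_coords z)" by (simp add: rep_point_def hs)
    from stem_rep_value[OF inv par z hs(1) this, of K b]
    have "\<i> ^ card K * (of_real p * stem_rep hs K (\<lambda>z. stem_char b (G z)) (even_coords z)) = \<i> ^ card K * of_real (inner (G z $ K) b)"
      by (simp add: hs prod.distrib p_def)
    then show ?thesis by simp
  qed
  have "p *\<^sub>R radial (\<lambda>b. stem_rep hs K (\<lambda>z. stem_char b (G z))) (even_coords z)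
     = (\<Sum>b\<in>Basis. Re (of_real p * stem_rep hs K (\<lambda>z. stem_char b (G z)) (even_coords z)) *\<^sub>R b)"
    by (simp add: radial_def scaleR_sum_right)
  also have "\<dots> = G z $ K" unfolding * by (simp add: euclidean_representation)
  finally show ?thesis by (simp add: p_def)
qed

text \<open>\<open>\<J>\<^sub>h\<close> is the multiplication with \<open>e\<^sub>h\<close>, and \<open>e\<^sub>h\<close> is sent to \<open>\<i>\<close>.\<close>

lemma stem_char_complex_structure:
  "stem_char b (complex_structure h w) = \<i> * stem_char b w"
proof -
  have nth: "complex_structure h w $ M = (-1) ^ card (sym_diff M {h} \<inter> {h}) * w $ (sym_diff M {h})" for M
  proof -
    have "complex_structure h w $ M = (\<Sum>K\<in>UNIV. if K = sym_diff M {h} then (-1) ^ card (K \<inter> {h}) * w $ K else 0)"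
      unfolding complex_structure_def sum_component by (intro sum.cong) (auto simp: axis_def)
    then show ?thesis by simp
  qed
  have "stem_char b (complex_structure h w) = (\<Sum>M\<in>UNIV. \<i> ^ card M * of_real (inner ((-1) ^ card (sym_diff M {h} \<inter> {h}) * w $ (sym_diff M {h})) b))"
    by (simp add: stem_char_def nth)
  also have "\<dots> = (\<Sum>K\<in>UNIV. \<i> ^ card (sym_diff K {h}) * of_real (inner ((-1) ^ card (K \<inter> {h}) * w $ K) b))"
  proof (rule sum.reindex_bij_witness[where i="\<lambda>K. sym_diff K {h}" and j="\<lambda>K. sym_diff K {h}"])
    have "sym_diff (sym_diff K {h}) {h} = K" for K :: "'a set" by auto
    then show "\<i> ^ card (sym_diff (sym_diff K {h}) {h}) * of_real (inner ((-1) ^ card (sym_diff K {h} \<inter> {h}) * w $ (sym_diff K {h})) b)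
      = \<i> ^ card K * of_real (inner ((-1) ^ card (sym_diff K {h} \<inter> {h}) * w $ (sym_diff K {h})) b)" for K
      by (simp only:)
  qed auto
  also have "\<dots> = (\<Sum>K\<in>UNIV. \<i> * (\<i> ^ card K * of_real (inner (w $ K) b)))"
  proof (rule sum.cong[OF refl])
    fix K :: "'a set"
    show "\<i> ^ card (sym_diff K {h}) * of_real (inner ((-1) ^ card (K \<inter> {h}) * w $ K) b) = \<i> * (\<i> ^ card K * of_real (inner (w $ K) b))"
    proof (cases "h \<in> K")
      case True
      then have "sym_diff K {h} = K - {h}" by auto
      moreover obtain c where "card (K - {h}) = c" by blast
      moreover have "card K = Suc (card (K - {h}))" using True by (intro card.remove) auto
      ultimately have "card (sym_diff K {h}) = c" "card K = Suc c" by simp_all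
      moreover have "card (K \<inter> {h}) = 1" using True by simp
      ultimately show ?thesis by (simp only:) (simp add: mult.assoc[symmetric])
    next
      case False
      then have "sym_diff K {h} = insert h K" by auto
      then show ?thesis using False by simp
    qed
  qed
  finally show ?thesis by (simp add: stem_char_def sum_distrib_left)
qed

lemma bounded_linear_stem_char: "bounded_linear (stem_char b)"
  unfolding stem_char_def
  by (intro bounded_linear_sum bounded_linear_const_mult bounded_linear_compose[OF bounded_linear_of_real]
     bounded_linear_compose[OF bounded_linear_inner_left] bounded_linear_vec_nth)

text \<open>Under the character the equation \<open>\<partial>\<^sub>\<alpha> F + \<J>\<^sub>h \<partial>\<^sub>\<beta> F = 0\<close> becomes the Cauchy-Riemann equation in \<open>z\<^sub>h\<close>.\<close>

lemma hol_stem_char: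
  assumes D: "open D" and F: "holomorphic_stem D F"
  shows "hol D (\<lambda>z. stem_char b (F z))"
proof (rule holI[OF D])
  show "continuous_on D (\<lambda>z. stem_char b (F z))"
    using F bounded_linear.continuous_on[OF bounded_linear_stem_char]
    by (auto simp: holomorphic_stem_def stem_function_def)
  fix z h assume z: "z \<in> D"
  obtain F' where F': "(F has_derivative blinfun_apply (F' z)) (at z)"
    using F z by (auto simp: holomorphic_stem_def C1_on_def)
  have dd: "dir_deriv F v z = F' z v" for v
  proof -
    have "((\<lambda>t. F (z + t *\<^sub>R v)) has_derivative (\<lambda>t. F' z (t *\<^sub>R v))) (at 0)"
    proof (rule has_derivative_compose[where g=F])
      show "((\<lambda>t. z + t *\<^sub>R v) has_derivative (\<lambda>t. t *\<^sub>R v)) (at 0)"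
        by (auto intro!: derivative_eq_intros)
      show "(F has_derivative F' z) (at (z + 0 *\<^sub>R v))" using F' by simp
    qed
    then show ?thesis
      by (simp add: dir_deriv_def vector_derivative_at has_vector_derivative_def blinfun.scaleR_right)
  qed
  have lin: "linear (stem_char b :: 'a coeffs \<Rightarrow> complex)"
    by (rule bounded_linear.linear[OF bounded_linear_stem_char])
  define A where "A = stem_char b (F' z (axis h 1))"
  define B where "B = stem_char b (F' z (axis h \<i>))"
  have "stem_dbar h F z = 0" using F z by (simp add: holomorphic_stem_def)
  then have "dir_deriv F (axis h 1) z + complex_structure h (dir_deriv F (axis h \<i>) z) = 0"
    by (simp add: stem_dbar_def)
  then have "F' z (axis h 1) + complex_structure h (F' z (axis h \<i>)) = 0" by (simp only: dd)
  from arg_cong[OF this, of "stem_char b"] have AB: "A + \<i> * B = 0"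
    unfolding linear_add[OF lin] linear_0[OF lin] stem_char_complex_structure A_def B_def .
  have CR: "B = \<i> * A"
  proof -
    have "A = - (\<i> * B)" using AB by (simp add: eq_neg_iff_add_eq_0)
    then show ?thesis by simp
  qed
  have "((\<lambda>t. z + axis h (t - z $ h)) has_derivative (\<lambda>t. axis h t)) (at (z $ h))"
  proof -
    have "((\<lambda>t. t - z $ h) has_derivative (\<lambda>t. t)) (at (z $ h))" by (auto intro!: derivative_eq_intros)
    then show ?thesis
      using has_derivative_add[OF has_derivative_const bounded_linear.has_derivative[OF bounded_linear_axis]] by fastforce
  qed
  then have "((\<lambda>t. F (z + axis h (t - z $ h))) has_derivative (\<lambda>t. F' z (axis h t))) (at (z $ h))"
  proof (rule has_derivative_compose)
    have "(axis h (0::complex) :: 'a cvec) = 0" by (simp add: vec_eq_iff axis_def)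
    then show "(F has_derivative F' z) (at (z + axis h (z $ h - z $ h)))"
      using F' by (simp only: diff_self add_0_right)
  qed
  then have "((\<lambda>t. stem_char b (F (upd z h t))) has_derivative (\<lambda>t. stem_char b (F' z (axis h t)))) (at (z $ h))"
    unfolding upd_eq_axis by (rule bounded_linear.has_derivative[OF bounded_linear_stem_char])
  moreover have lin': "stem_char b (F' z (axis h t)) = A * t" for t
  proof -
    have "axis h t = Re t *\<^sub>R axis h 1 + Im t *\<^sub>R (axis h \<i> :: 'a cvec)"
      by (auto simp: vec_eq_iff axis_def complex_eq_iff)
    then have "F' z (axis h t) = Re t *\<^sub>R F' z (axis h 1) + Im t *\<^sub>R F' z (axis h \<i>)"
      by (metis blinfun.add_right blinfun.scaleR_right)
    then have "stem_char b (F' z (axis h t)) = Re t *\<^sub>R A + Im t *\<^sub>R B"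
      unfolding A_def B_def by (metis linear_add[OF lin] linear_scale[OF lin])
    then have "stem_char b (F' z (axis h t)) = Re t *\<^sub>R A + Im t *\<^sub>R (\<i> * A)" unfolding CR .
    also have "\<dots> = A * t" by (simp add: complex_eq_iff algebra_simps)
    finally show ?thesis .
  qed
  ultimately have "((\<lambda>t. stem_char b (F (upd z h t))) has_field_derivative A) (at (z $ h))"
    by (simp add: has_field_derivative_def)
  then show "(\<lambda>t. stem_char b (F (upd z h t))) field_differentiable at (z $ h)"
    by (auto simp: field_differentiable_def)
qed

lemma stem_char_axis: "stem_char b (axis M q) = \<i> ^ card M * of_real (inner q b)"
proof -
  have "stem_char b (axis M q) = (\<Sum>K\<in>UNIV. if K = M then \<i> ^ card M * of_real (inner q b) else 0)"
    unfolding stem_char_def by (intro sum.cong) (auto simp: axis_def)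
  then show ?thesis by simp
qed

text \<open>Real coefficients commute with the quaternionic ones, and the sign in \<open>e\<^sub>H e\<^sub>K\<close> is that of
  \<open>\<i>\<close> to the power \<open>2 card (H \<inter> K)\<close>.\<close>

lemma stem_char_stem_prod:
  assumes real: "\<And>K. P z $ K = of_real (inner (P z $ K) 1)"
  shows "stem_char b (stem_prod P F z) = stem_char 1 (P z) * stem_char b (F z)"
proof -
  have lin: "stem_char b (\<Sum>i\<in>I. f i) = (\<Sum>i\<in>I. stem_char b (f i))" for I and f :: "'a set \<Rightarrow> 'a coeffs"
    using bounded_linear.linear[OF bounded_linear_stem_char] by (rule linear_sum)
  have "stem_char b (stem_prod P F z)
     = (\<Sum>H\<in>UNIV. \<Sum>K\<in>UNIV. \<i> ^ card (sym_diff K H) * of_real (inner ((-1) ^ card (H \<inter> K) * P z $ K * F z $ H) b))"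
    unfolding stem_prod_def lin stem_char_axis ..
  also have "\<dots> = (\<Sum>H\<in>UNIV. \<Sum>K\<in>UNIV. (\<i> ^ card K * of_real (inner (P z $ K) 1)) * (\<i> ^ card H * of_real (inner (F z $ H) b)))"
  proof (intro sum.cong refl)
    fix H K :: "'a set"
    have *: "card (sym_diff K H) + 2 * card (H \<inter> K) = card K + card H"
    proof -
      have "card K = card (K - H) + card (H \<inter> K)" "card H = card (H - K) + card (H \<inter> K)"
        using card_Int_Diff[of K H] card_Int_Diff[of H K] by (simp_all add: Int_commute)
      moreover have "card (sym_diff K H) = card (K - H) + card (H - K)"
        by (rule card_Un_disjoint) auto
      ultimately show ?thesis by simp
    qed
    have i: "\<i> ^ card (sym_diff K H) * (-1) ^ card (H \<inter> K) = \<i> ^ card K * \<i> ^ card H"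
    proof -
      have "(-1 :: complex) ^ card (H \<inter> K) = \<i> ^ (2 * card (H \<inter> K))" by (simp add: power_mult)
      moreover have "\<i> ^ (card (sym_diff K H) + 2 * card (H \<inter> K)) = \<i> ^ (card K + card H)"
        by (simp only: *)
      ultimately show ?thesis by (simp only: power_add)
    qed
    have "inner ((-1) ^ card (H \<inter> K) * P z $ K * F z $ H) b = (-1) ^ card (H \<inter> K) * inner (P z $ K) 1 * inner (F z $ H) b"
    proof -
      define r where "r = inner (P z $ K) 1"
      have "P z $ K = r *\<^sub>R 1" using real[of K] by (simp add: r_def of_real_def)
      moreover have "(-1 :: quat) ^ c = ((-1) ^ c) *\<^sub>R 1" for c by (induction c) auto
      ultimately have "(-1) ^ card (H \<inter> K) * P z $ K * F z $ H = ((-1) ^ card (H \<inter> K) * r) *\<^sub>R F z $ H"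
        by simp
      then show ?thesis by (simp add: r_def)
    qed
    then have "\<i> ^ card (sym_diff K H) * of_real (inner ((-1) ^ card (H \<inter> K) * P z $ K * F z $ H) b)
      = (\<i> ^ card (sym_diff K H) * (-1) ^ card (H \<inter> K)) * of_real (inner (P z $ K) 1) * of_real (inner (F z $ H) b)"
      by simp
    then show "\<i> ^ card (sym_diff K H) * of_real (inner ((-1) ^ card (H \<inter> K) * P z $ K * F z $ H) b)
       = (\<i> ^ card K * of_real (inner (P z $ K) 1)) * (\<i> ^ card H * of_real (inner (F z $ H) b))"
      unfolding i by simp
  qed
  also have "\<dots> = stem_char 1 (P z) * stem_char b (F z)"
    unfolding stem_char_def sum_product by (rule sum.swap)
  finally show ?thesis .
qed

section \<open>Derivatives along quaternionic coordinates\<close>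

lemma q_inner: "q0 x = inner x 1" "q1 x = inner x qi" "q2 x = inner x qj" "q3 x = inner x qk"
  by (simp_all add: inner_quat_def qi_def qj_def qk_def)

definition im_quat :: "quat \<Rightarrow> quat" where
  "im_quat q = q - of_real (q0 q)"

lemma of_real_quat_sel [simp]:
  "q0 (of_real r) = r" "q1 (of_real r) = 0" "q2 (of_real r) = 0" "q3 (of_real r) = 0"
  by (simp_all add: of_real_def)

lemma im_quat_sel [simp]:
  "q0 (im_quat q) = 0" "q1 (im_quat q) = q1 q" "q2 (im_quat q) = q2 q" "q3 (im_quat q) = q3 q"
  by (simp_all add: im_quat_def)

lemma bounded_linear_q0: "bounded_linear q0"
  unfolding q_inner by (rule bounded_linear_inner_left)

lemma bounded_linear_im_quat: "bounded_linear im_quat"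
  unfolding im_quat_def
  by (intro bounded_linear_sub bounded_linear_ident bounded_linear_compose[OF bounded_linear_of_real] bounded_linear_q0)

lemma norm_quat_sq: "(norm (q::quat))\<^sup>2 = (q0 q)\<^sup>2 + (q1 q)\<^sup>2 + (q2 q)\<^sup>2 + (q3 q)\<^sup>2"
  unfolding power2_norm_eq_inner by (simp add: inner_quat_def power2_eq_square)

lemma quat_unit_sel [simp]:
  "q0 qi = 0" "q1 qi = 1" "q2 qi = 0" "q3 qi = 0"
  "q0 qj = 0" "q1 qj = 0" "q2 qj = 1" "q3 qj = 0"
  "q0 qk = 0" "q1 qk = 0" "q2 qk = 0" "q3 qk = 1"
  by (simp_all add: qi_def qj_def qk_def)

lemma quat_units_distinct [simp]:
  "1 \<noteq> qi" "1 \<noteq> qj" "1 \<noteq> qk" "qi \<noteq> qj" "qi \<noteq> qk" "qj \<noteq> qk"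
  by (simp_all add: quat_eq_iff)

lemma im_quat_units [simp]: "im_quat 1 = 0" "im_quat qi = qi" "im_quat qj = qj" "im_quat qk = qk"
  by (simp_all add: quat_eq_iff)

lemma inner_im_quat_units [simp]:
  "inner (im_quat q) 1 = 0" "inner (im_quat q) qi = q1 q" "inner (im_quat q) qj = q2 q" "inner (im_quat q) qk = q3 q"
  by (simp_all add: inner_quat_def)

text \<open>The representative \<open>z\<close> of \<open>x\<close> with all \<open>\<beta>\<^sub>h \<ge> 0\<close>.\<close>

definition upper_point :: "('n::finite) qvec \<Rightarrow> 'n cvec" where
  "upper_point x = (\<chi> h. Complex (q0 (x $ h)) (norm (im_quat (x $ h))))"

lemma upper_point_nth [simp]:
  "Re (upper_point x $ h) = q0 (x $ h)" "Im (upper_point x $ h) = norm (im_quat (x $ h))"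
  by (simp_all add: upper_point_def)

definition radial_at :: "(quat \<Rightarrow> complex^('n + 'n) \<Rightarrow> complex) \<Rightarrow> ('n::finite) qvec \<Rightarrow> quat" where
  "radial_at \<Theta> x = radial \<Theta> (even_coords (upper_point x))"

lemma has_derivative_vecI:
  fixes f :: "'a::real_normed_vector \<Rightarrow> complex^'k::finite"
  assumes "\<And>j. ((\<lambda>x. f x $ j) has_derivative (\<lambda>v. f' v $ j)) F"
  shows "(f has_derivative f') F"
proof -
  have e: "(\<Sum>j\<in>UNIV. axis j (w $ j)) = w" for w :: "complex^'k"
    by (simp add: vec_eq_iff axis_def if_distrib[where f="\<lambda>g. g _"] cong: if_cong)
  have "((\<lambda>x. \<Sum>j\<in>UNIV. axis j (f x $ j)) has_derivative (\<lambda>v. \<Sum>j\<in>UNIV. axis j (f' v $ j))) F"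
    by (intro has_derivative_sum bounded_linear.has_derivative[OF bounded_linear_axis] assms)
  then show ?thesis by (simp only: e)
qed

text \<open>The norm of the vector part is not differentiable at real points, but its square is a polynomial. This is why
  \<open>s\<^sub>h\<close> and not \<open>\<beta>\<^sub>h\<close> is the right coordinate.\<close>

lemma even_coords_has_derivative:
  "((\<lambda>x. even_coords (upper_point x)) has_derivative
     (\<lambda>v. \<chi> j. case j of Inl h \<Rightarrow> of_real (q0 (v $ h)) | Inr h \<Rightarrow> of_real (2 * inner (im_quat (x $ h)) (v $ h)))) (at x)"
proof (rule has_derivative_vecI)
  fix j :: "'a + 'a"
  show "((\<lambda>x. even_coords (upper_point x) $ j) has_derivative
     (\<lambda>v. (\<chi> j. case j of Inl h \<Rightarrow> of_real (q0 (v $ h)) | Inr h \<Rightarrow> of_real (2 * inner (im_quat (x $ h)) (v $ h))) $ j)) (at x)"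
  proof (cases j)
    case (Inl h)
    have "bounded_linear (\<lambda>x::'a qvec. complex_of_real (q0 (x $ h)))"
      by (intro bounded_linear_compose[OF bounded_linear_of_real] bounded_linear_compose[OF bounded_linear_q0] bounded_linear_vec_nth)
    from bounded_linear.has_derivative[OF this has_derivative_ident] show ?thesis by (simp add: Inl)
  next
    case (Inr h)
    have bl: "bounded_linear (\<lambda>x::'a qvec. im_quat (x $ h))"
      by (intro bounded_linear_compose[OF bounded_linear_im_quat] bounded_linear_vec_nth)
    have d: "((\<lambda>x::'a qvec. im_quat (x $ h)) has_derivative (\<lambda>v. im_quat (v $ h))) (at x)"
      by (rule bounded_linear.has_derivative[OF bl has_derivative_ident])
    have i: "inner (im_quat (x $ h)) (im_quat v) = inner (im_quat (x $ h)) v" for v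
      by (simp add: inner_quat_def)
    have "((\<lambda>x. complex_of_real (inner (im_quat (x $ h)) (im_quat (x $ h)))) has_derivative
       (\<lambda>v. of_real (inner (im_quat (x $ h)) (im_quat (v $ h)) + inner (im_quat (v $ h)) (im_quat (x $ h))))) (at x)"
      by (intro bounded_linear.has_derivative[OF bounded_linear_of_real] has_derivative_inner d)
    moreover have "inner (im_quat (x $ h)) (im_quat (v $ h)) + inner (im_quat (v $ h)) (im_quat (x $ h)) = 2 * inner (im_quat (x $ h)) (v $ h)" for v :: "'a qvec"
      using i[of "v $ h"] inner_commute[of "im_quat (v $ h)" "im_quat (x $ h)"] by simp
    ultimately show ?thesis by (simp add: Inr power2_norm_eq_inner)
  qed
qed

lemma radial_at_has_derivative:
  assumes hol: "\<And>b. b \<in> Basis \<Longrightarrow> hol W (\<Theta> b)" and x: "even_coords (upper_point x) \<in> W"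
  shows "(radial_at \<Theta> has_derivative (\<lambda>v. \<Sum>h\<in>UNIV. q0 (v $ h) *\<^sub>R radial_at (\<lambda>b. pd (Inl h) (\<Theta> b)) x
       + (2 * inner (im_quat (x $ h)) (v $ h)) *\<^sub>R radial_at (\<lambda>b. pd (Inr h) (\<Theta> b)) x)) (at x)"
proof -
  define c' where "c' = (\<lambda>v::'a qvec. (\<chi> j. case j of Inl h \<Rightarrow> of_real (q0 (v $ h)) | Inr h \<Rightarrow> of_real (2 * inner (im_quat (x $ h)) (v $ h))) :: complex^('a+'a))"
  let ?w = "even_coords (upper_point x)"
  have "((\<lambda>x. \<Theta> b (even_coords (upper_point x))) has_derivative (\<lambda>v. \<Sum>j\<in>UNIV. c' v $ j * pd j (\<Theta> b) ?w)) (at x)"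
    if "b \<in> Basis" for b
    using has_derivative_compose[OF even_coords_has_derivative hol_has_derivative[OF hol[OF that] x]] by (simp only: c'_def)
  then have "((\<lambda>x. \<Sum>b\<in>Basis. Re (\<Theta> b (even_coords (upper_point x))) *\<^sub>R b) has_derivative
     (\<lambda>v. \<Sum>b\<in>Basis. Re (\<Sum>j\<in>UNIV. c' v $ j * pd j (\<Theta> b) ?w) *\<^sub>R b)) (at x)"
    by (intro has_derivative_sum has_derivative_scaleR_left bounded_linear.has_derivative[OF bounded_linear_Re])
  moreover have "(\<Sum>b\<in>Basis. Re (\<Sum>j\<in>UNIV. c' v $ j * pd j (\<Theta> b) ?w) *\<^sub>R b) =
     (\<Sum>h\<in>UNIV. q0 (v $ h) *\<^sub>R radial_at (\<lambda>b. pd (Inl h) (\<Theta> b)) x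
       + (2 * inner (im_quat (x $ h)) (v $ h)) *\<^sub>R radial_at (\<lambda>b. pd (Inr h) (\<Theta> b)) x)" for v
  proof -
    have "Re (\<Sum>j\<in>UNIV. c' v $ j * pd j (\<Theta> b) ?w) =
       (\<Sum>h\<in>UNIV. q0 (v $ h) * Re (pd (Inl h) (\<Theta> b) ?w) + (2 * inner (im_quat (x $ h)) (v $ h)) * Re (pd (Inr h) (\<Theta> b) ?w))" for b
    proof -
      have "(\<Sum>j\<in>UNIV. c' v $ j * pd j (\<Theta> b) ?w) = (\<Sum>h\<in>UNIV. c' v $ Inl h * pd (Inl h) (\<Theta> b) ?w) + (\<Sum>h\<in>UNIV. c' v $ Inr h * pd (Inr h) (\<Theta> b) ?w)"
        using sum.Plus[of "UNIV :: 'a set" "UNIV :: 'a set" "\<lambda>j. c' v $ j * pd j (\<Theta> b) ?w"] by (simp add: UNIV_Plus_UNIV comp_def)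
      moreover have "c' v $ Inl h = of_real (q0 (v $ h))" "c' v $ Inr h = of_real (2 * inner (im_quat (x $ h)) (v $ h))" for h
        by (simp_all add: c'_def)
      ultimately show ?thesis by (simp only: Re_sum plus_complex.sel Re_complex_of_real times_complex.sel Im_complex_of_real sum.distrib) simp
    qed
    then have "(\<Sum>b\<in>Basis. Re (\<Sum>j\<in>UNIV. c' v $ j * pd j (\<Theta> b) ?w) *\<^sub>R b) =
      (\<Sum>b\<in>Basis. \<Sum>h\<in>UNIV. (q0 (v $ h) * Re (pd (Inl h) (\<Theta> b) ?w) + (2 * inner (im_quat (x $ h)) (v $ h)) * Re (pd (Inr h) (\<Theta> b) ?w)) *\<^sub>R b)"
      by (simp only: scaleR_sum_left)
    also have "\<dots> = (\<Sum>h\<in>UNIV. \<Sum>b\<in>Basis. (q0 (v $ h) * Re (pd (Inl h) (\<Theta> b) ?w) + (2 * inner (im_quat (x $ h)) (v $ h)) * Re (pd (Inr h) (\<Theta> b) ?w)) *\<^sub>R b)"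
      by (rule sum.swap)
    finally show ?thesis
      unfolding radial_at_def radial_def scaleR_sum_right scaleR_scaleR sum.distrib[symmetric] scaleR_add_left[symmetric] .
  qed
  moreover have "radial_at \<Theta> = (\<lambda>x. \<Sum>b\<in>Basis. Re (\<Theta> b (even_coords (upper_point x))) *\<^sub>R b)"
    by (simp add: fun_eq_iff radial_at_def radial_def)
  ultimately show ?thesis by (simp only:)
qed

text \<open>A derivative depending continuously on the point when applied to each fixed vector is continuous in operator
  norm, because the space is finite-dimensional.\<close>

lemma C1_onI:
  fixes f :: "'a::euclidean_space \<Rightarrow> 'b::real_normed_vector"
  assumes "\<And>x. x \<in> U \<Longrightarrow> (f has_derivative f' x) (at x)" "\<And>v. continuous_on U (\<lambda>x. f' x v)"
  shows "C1_on U f"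
  unfolding C1_on_def
proof (intro exI conjI ballI)
  have e: "blinfun_apply (Blinfun (f' x)) = f' x" if "x \<in> U" for x
    using assms(1)[OF that] by (intro bounded_linear_Blinfun_apply has_derivative_bounded_linear)
  show "continuous_on U (\<lambda>x. Blinfun (f' x))"
    by (rule continuous_on_blinfun_componentwise) (use assms(2) e in \<open>auto cong: continuous_on_cong\<close>)
  show "(f has_derivative blinfun_apply (Blinfun (f' x))) (at x)" if "x \<in> U" for x
    using assms(1)[OF that] e[OF that] by simp
qed

lemma C1_on_iff:
  fixes f :: "'a::euclidean_space \<Rightarrow> 'b::real_normed_vector"
  shows "C1_on U f \<longleftrightarrow> (\<exists>f'. (\<forall>x\<in>U. (f has_derivative f' x) (at x)) \<and> (\<forall>v. continuous_on U (\<lambda>x. f' x v)))"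
proof
  assume "C1_on U f"
  then obtain f' where f': "continuous_on U f'" "\<forall>x\<in>U. (f has_derivative blinfun_apply (f' x)) (at x)"
    unfolding C1_on_def by blast
  then show "\<exists>f'. (\<forall>x\<in>U. (f has_derivative f' x) (at x)) \<and> (\<forall>v. continuous_on U (\<lambda>x. f' x v))"
    by (intro exI[of _ "\<lambda>x. blinfun_apply (f' x)"]) (auto intro!: continuous_intros)
qed (use C1_onI in blast)

lemma C1_on_imp_continuous_on: "C1_on U f \<Longrightarrow> continuous_on U f"
  unfolding C1_on_def by (meson continuous_at_imp_continuous_on has_derivative_continuous)

lemma C1_on_bounded_linear:
  fixes f :: "'a::euclidean_space \<Rightarrow> 'b::real_normed_vector"
  assumes "bounded_linear f" shows "C1_on U f"
  using assms by (intro C1_onI[of U f "\<lambda>x. f"]) (auto intro: bounded_linear_imp_has_derivative)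

lemma C1_on_const: "C1_on U (\<lambda>x::'a::euclidean_space. c)"
  by (rule C1_onI[where f'="\<lambda>x v. 0"]) auto

lemma C1_on_diff:
  fixes f :: "'a::euclidean_space \<Rightarrow> 'b::real_normed_vector"
  assumes "C1_on U f" "C1_on U g" shows "C1_on U (\<lambda>x. f x - g x)"
proof -
  obtain f' where "\<forall>x\<in>U. (f has_derivative f' x) (at x)" "\<forall>v. continuous_on U (\<lambda>x. f' x v)"
    using assms(1) unfolding C1_on_iff by blast
  moreover obtain g' where "\<forall>x\<in>U. (g has_derivative g' x) (at x)" "\<forall>v. continuous_on U (\<lambda>x. g' x v)"
    using assms(2) unfolding C1_on_iff by blast
  ultimately show ?thesis
    by (intro C1_onI[where f'="\<lambda>x v. f' x v - g' x v"] has_derivative_diff continuous_on_diff) auto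
qed

lemma C1_on_mult:
  fixes f :: "'a::euclidean_space \<Rightarrow> 'b::real_normed_algebra"
  assumes "C1_on U f" "C1_on U g" shows "C1_on U (\<lambda>x. f x * g x)"
proof -
  obtain f' where "\<forall>x\<in>U. (f has_derivative f' x) (at x)" "\<forall>v. continuous_on U (\<lambda>x. f' x v)"
    using assms(1) unfolding C1_on_iff by blast
  moreover obtain g' where "\<forall>x\<in>U. (g has_derivative g' x) (at x)" "\<forall>v. continuous_on U (\<lambda>x. g' x v)"
    using assms(2) unfolding C1_on_iff by blast
  ultimately show ?thesis using assms[THEN C1_on_imp_continuous_on]
    by (intro C1_onI[where f'="\<lambda>x v. f x * g' x v + f' x v * g x"] has_derivative_mult continuous_intros) auto
qed

lemma C1_on_scaleR:
  fixes f :: "'a::euclidean_space \<Rightarrow> 'b::real_normed_vector"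
  assumes "C1_on U f" shows "C1_on U (\<lambda>x. c *\<^sub>R f x)"
proof -
  obtain f' where "\<forall>x\<in>U. (f has_derivative f' x) (at x)" "\<forall>v. continuous_on U (\<lambda>x. f' x v)"
    using assms unfolding C1_on_iff by blast
  then show ?thesis
    by (intro C1_onI[where f'="\<lambda>x v. c *\<^sub>R f' x v"] has_derivative_scaleR_right continuous_intros) auto
qed

lemma C1_on_sum:
  fixes f :: "'i \<Rightarrow> 'a::euclidean_space \<Rightarrow> 'b::real_normed_vector"
  assumes "\<And>i. i \<in> I \<Longrightarrow> C1_on U (f i)" shows "C1_on U (\<lambda>x. \<Sum>i\<in>I. f i x)"
proof -
  have "\<exists>f'. (\<forall>x\<in>U. (f i has_derivative f' x) (at x)) \<and> (\<forall>v. continuous_on U (\<lambda>x. f' x v))" if "i \<in> I" for i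
    using assms[OF that] unfolding C1_on_iff .
  then obtain f' where f': "\<And>i. i \<in> I \<Longrightarrow> (\<forall>x\<in>U. (f i has_derivative f' i x) (at x)) \<and> (\<forall>v. continuous_on U (\<lambda>x. f' i x v))"
    by metis
  then show ?thesis
    by (intro C1_onI[where f'="\<lambda>x v. \<Sum>i\<in>I. f' i x v"] has_derivative_sum continuous_on_sum) (use f' in auto)
qed

lemma C1_on_cong:
  assumes "open U" "C1_on U f" "\<And>x. x \<in> U \<Longrightarrow> f x = g x"
  shows "C1_on U g"
proof -
  from assms(2) obtain f' where f': "continuous_on U f'" "\<And>x. x \<in> U \<Longrightarrow> (f has_derivative blinfun_apply (f' x)) (at x)"
    unfolding C1_on_def by blast
  have "(g has_derivative blinfun_apply (f' x)) (at x)" if "x \<in> U" for x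
    using has_derivative_transform_within_open[OF f'(2)[OF that] assms(1) that] assms(3) by simp
  with f'(1) show ?thesis unfolding C1_on_def by blast
qed

lemma continuous_on_radial_at:
  assumes hol: "\<And>b. b \<in> Basis \<Longrightarrow> hol W (\<Theta> b)" and U: "\<And>x. x \<in> U \<Longrightarrow> even_coords (upper_point x) \<in> W"
  shows "continuous_on U (radial_at \<Theta>)"
proof (intro continuous_at_imp_continuous_on ballI)
  fix x assume "x \<in> U"
  from radial_at_has_derivative[where \<Theta>=\<Theta>, OF hol U[OF this]]
  show "isCont (radial_at \<Theta>) x" by (rule has_derivative_continuous)
qed

lemma C1_on_radial_at:
  assumes hol: "\<And>b. b \<in> Basis \<Longrightarrow> hol W (\<Theta> b)" and U: "\<And>x. x \<in> U \<Longrightarrow> even_coords (upper_point x) \<in> W"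
  shows "C1_on U (radial_at \<Theta>)"
proof (rule C1_onI[OF radial_at_has_derivative[where \<Theta>=\<Theta>, OF hol U]])
  fix v :: "'a qvec"
  have c: "continuous_on U (radial_at (\<lambda>b. pd j (\<Theta> b)))" for j
    by (rule continuous_on_radial_at[where \<Theta>="\<lambda>b. pd j (\<Theta> b)", OF hol_pd[OF hol] U])
  have bl: "bounded_linear (\<lambda>x::'a qvec. im_quat (x $ h))" for h
    by (intro bounded_linear_compose[OF bounded_linear_im_quat] bounded_linear_vec_nth)
  show "continuous_on U (\<lambda>x. \<Sum>h\<in>UNIV. q0 (v $ h) *\<^sub>R radial_at (\<lambda>b. pd (Inl h) (\<Theta> b)) x
       + (2 * inner (im_quat (x $ h)) (v $ h)) *\<^sub>R radial_at (\<lambda>b. pd (Inr h) (\<Theta> b)) x)"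
    by (intro continuous_intros c bounded_linear.continuous_on[OF bl])
qed

lemma C1_on_ordered_prod:
  "C1_on U (\<lambda>x. ordered_prod L (\<lambda>h. im_quat (x $ h)))" for U :: "('n::{finite,linorder}) qvec set"
proof -
  have "C1_on U (\<lambda>x. prod_list (map (\<lambda>h. im_quat (x $ h)) hs))" for hs
  proof (induction hs)
    case Nil
    show ?case by (simp add: C1_on_const)
  next
    case (Cons h hs)
    have "C1_on U (\<lambda>x. im_quat (x $ h))"
      by (intro C1_on_bounded_linear bounded_linear_compose[OF bounded_linear_im_quat] bounded_linear_vec_nth)
    from C1_on_mult[OF this Cons] show ?case by simp
  qed
  then show ?thesis by (simp add: ordered_prod_def)
qed

text \<open>Relational counterpart of \<open>dir_deriv\<close>, which asserts existence and composes by the usual rules.\<close>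

definition has_line_deriv :: "('a::real_normed_vector \<Rightarrow> 'b::real_normed_vector) \<Rightarrow> 'a \<Rightarrow> 'b \<Rightarrow> 'a \<Rightarrow> bool" where
  "has_line_deriv f v d x \<longleftrightarrow> ((\<lambda>t. f (x + t *\<^sub>R v)) has_vector_derivative d) (at 0)"

lemma dir_deriv_eq: "has_line_deriv f v d x \<Longrightarrow> dir_deriv f v x = d"
  by (simp add: has_line_deriv_def dir_deriv_def vector_derivative_at)

lemma has_line_deriv_differentiable:
  "has_line_deriv f v d x \<Longrightarrow> (\<lambda>t::real. f (x + t *\<^sub>R v)) differentiable (at 0)"
  by (auto simp: has_line_deriv_def intro: differentiableI_vector)

lemma has_line_deriv_cong_open:
  assumes "has_line_deriv f v d x" "open U" "x \<in> U" "\<And>y. y \<in> U \<Longrightarrow> f y = g y"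
  shows "has_line_deriv g v d x"
proof -
  have "open ((\<lambda>t::real. x + t *\<^sub>R v) -` U)"
    by (intro open_vimage assms continuous_intros)
  then show ?thesis
    using assms unfolding has_line_deriv_def
    by (auto elim!: has_vector_derivative_transform_within_open)
qed

lemma has_line_deriv_const: "has_line_deriv (\<lambda>x. c) v 0 x"
  by (simp add: has_line_deriv_def)

lemma has_line_deriv_add:
  "has_line_deriv f v d x \<Longrightarrow> has_line_deriv g v e x \<Longrightarrow> has_line_deriv (\<lambda>x. f x + g x) v (d + e) x"
  unfolding has_line_deriv_def by (rule has_vector_derivative_add)

lemma has_line_deriv_diff:
  "has_line_deriv f v d x \<Longrightarrow> has_line_deriv g v e x \<Longrightarrow> has_line_deriv (\<lambda>x. f x - g x) v (d - e) x"
  unfolding has_line_deriv_def by (rule has_vector_derivative_diff)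

lemma has_line_deriv_sum:
  "(\<And>i. i \<in> I \<Longrightarrow> has_line_deriv (f i) v (d i) x) \<Longrightarrow> has_line_deriv (\<lambda>x. \<Sum>i\<in>I. f i x) v (\<Sum>i\<in>I. d i) x"
  unfolding has_line_deriv_def by (rule has_vector_derivative_sum)

lemma has_line_deriv_scaleR:
  "has_line_deriv f v d x \<Longrightarrow> has_line_deriv (\<lambda>x. c *\<^sub>R f x) v (c *\<^sub>R d) x"
  unfolding has_line_deriv_def has_vector_derivative_def
  by (drule has_derivative_scaleR_right[where r=c]) (simp add: mult.commute)

lemma has_line_deriv_mult:
  fixes f :: "'a::real_normed_vector \<Rightarrow> 'b::real_normed_algebra"
  shows "has_line_deriv f v d x \<Longrightarrow> has_line_deriv g v e x \<Longrightarrow> has_line_deriv (\<lambda>x. f x * g x) v (f x * e + d * g x) x"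
  unfolding has_line_deriv_def by (drule (1) has_vector_derivative_mult) simp

lemma has_line_deriv_scaleR2:
  assumes "has_line_deriv f v d x" "has_line_deriv g v e x" 
  shows "has_line_deriv (\<lambda>x. f x *\<^sub>R g x) v (f x *\<^sub>R e + d *\<^sub>R g x) x"
proof -
  have "((\<lambda>t. f (x + t *\<^sub>R v) *\<^sub>R g (x + t *\<^sub>R v)) has_vector_derivative
    f (x + 0 *\<^sub>R v) *\<^sub>R e + d *\<^sub>R g (x + 0 *\<^sub>R v)) (at 0)"
    using assms unfolding has_line_deriv_def
    by (intro has_vector_derivative_scaleR) (simp_all add: has_real_derivative_iff_has_vector_derivative)
  then show ?thesis by (simp add: has_line_deriv_def)
qed

lemma has_line_deriv_of_derivative:
  assumes "(f has_derivative f') (at x)"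
  shows "has_line_deriv f v (f' v) x"
proof -
  have "((\<lambda>t. f (x + t *\<^sub>R v)) has_derivative (\<lambda>t. f' (t *\<^sub>R v))) (at 0)"
  proof (rule has_derivative_compose[where g=f])
    show "((\<lambda>t. x + t *\<^sub>R v) has_derivative (\<lambda>t. t *\<^sub>R v)) (at 0)"
      by (auto intro!: derivative_eq_intros)
    show "(f has_derivative f') (at (x + 0 *\<^sub>R v))" using assms by simp
  qed
  moreover have "linear f'" using assms has_derivative_bounded_linear bounded_linear.linear by blast
  ultimately show ?thesis by (simp add: has_line_deriv_def has_vector_derivative_def linear_scale)
qed

lemma has_line_deriv_radial_at:
  assumes hol: "\<And>b. b \<in> Basis \<Longrightarrow> hol W (\<Theta> b)" and x: "even_coords (upper_point x) \<in> W"
  shows "has_line_deriv (radial_at \<Theta>) (axis h u) (q0 u *\<^sub>R radial_at (\<lambda>b. pd (Inl h) (\<Theta> b)) x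
       + (2 * inner (im_quat (x $ h)) u) *\<^sub>R radial_at (\<lambda>b. pd (Inr h) (\<Theta> b)) x) x"
proof -
  have "(\<Sum>k\<in>UNIV. q0 (axis h u $ k) *\<^sub>R radial_at (\<lambda>b. pd (Inl k) (\<Theta> b)) x
       + (2 * inner (im_quat (x $ k)) (axis h u $ k)) *\<^sub>R radial_at (\<lambda>b. pd (Inr k) (\<Theta> b)) x) =
     (\<Sum>k\<in>UNIV. if k = h then q0 u *\<^sub>R radial_at (\<lambda>b. pd (Inl k) (\<Theta> b)) x
       + (2 * inner (im_quat (x $ k)) u) *\<^sub>R radial_at (\<lambda>b. pd (Inr k) (\<Theta> b)) x else 0)"
    by (intro sum.cong refl) (auto simp: axis_def)
  then show ?thesis using has_line_deriv_of_derivative[OF radial_at_has_derivative[where \<Theta>=\<Theta>, OF hol x], where v="axis h u"] by simp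
qed

lemma has_line_deriv_im:
  "has_line_deriv (\<lambda>x. im_quat (x $ h)) (axis h u) (im_quat u) x"
proof -
  have "bounded_linear (\<lambda>x::'a qvec. im_quat (x $ h))"
    by (intro bounded_linear_compose[OF bounded_linear_im_quat] bounded_linear_vec_nth)
  from has_line_deriv_of_derivative[OF bounded_linear_imp_has_derivative[OF this], where v="axis h u" and x=x]
  show ?thesis by (simp add: axis_nth)
qed

lemma has_line_deriv_im_inner:
  "has_line_deriv (\<lambda>x. 2 * inner (im_quat (x $ h)) u) (axis h v) (2 * inner (im_quat v) u) x"
proof -
  have "bounded_linear (\<lambda>x::'a qvec. 2 * inner (im_quat (x $ h)) u)"
    by (intro bounded_linear_const_mult bounded_linear_compose[OF bounded_linear_inner_left]
      bounded_linear_compose[OF bounded_linear_im_quat] bounded_linear_vec_nth)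
  from has_line_deriv_of_derivative[OF bounded_linear_imp_has_derivative[OF this], where v="axis h v" and x=x]
  show ?thesis by simp
qed

lemma has_line_deriv_ordered_prod:
  fixes L :: "'n::{finite,linorder} set"
  assumes "h \<notin> L"
  shows "has_line_deriv (\<lambda>x. ordered_prod L (\<lambda>l. im_quat (x $ l))) (axis h u) 0 x"
proof -
  have "ordered_prod L (\<lambda>l. im_quat ((x + t *\<^sub>R axis h u) $ l)) = ordered_prod L (\<lambda>l. im_quat (x $ l))" for t
    unfolding ordered_prod_def using assms
    by (intro arg_cong[where f=prod_list] map_cong) (auto simp: axis_def)
  then show ?thesis by (simp add: has_line_deriv_def)
qed

section \<open>Slice functions and their stem functions\<close>

lemma imag_units_iff: "J \<in> imag_units \<longleftrightarrow> q0 J = 0 \<and> norm J = 1"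
proof
  assume "J \<in> imag_units"
  then have e: "(q0 J)\<^sup>2 - (q1 J)\<^sup>2 - (q2 J)\<^sup>2 - (q3 J)\<^sup>2 = -1" "q0 J * q1 J = 0" "q0 J * q2 J = 0" "q0 J * q3 J = 0"
    by (auto simp: imag_units_def quat_eq_iff power2_eq_square)
  have "q0 J = 0"
  proof (rule ccontr)
    assume "q0 J \<noteq> 0"
    with e have "(q0 J)\<^sup>2 = -1" by auto
    then show False by (metis neg_0_le_iff_le not_one_le_zero zero_le_power2)
  qed
  then have "(norm J)\<^sup>2 = 1" using e by (simp add: norm_quat_sq)
  then show "q0 J = 0 \<and> norm J = 1" using \<open>q0 J = 0\<close> norm_ge_zero[of J] by (simp add: power2_eq_1_iff)
next
  assume a: "q0 J = 0 \<and> norm J = 1"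
  then have "(q1 J)\<^sup>2 + (q2 J)\<^sup>2 + (q3 J)\<^sup>2 = 1" using norm_quat_sq[of J] by simp
  then show "J \<in> imag_units" using a by (simp add: imag_units_def quat_eq_iff power2_eq_square)
qed

lemma slice_point_sel:
  assumes "J $ h \<in> imag_units"
  shows "q0 (slice_point z J $ h) = Re (z $ h)" "im_quat (slice_point z J $ h) = Im (z $ h) *\<^sub>R J $ h"
  using assms by (auto simp: slice_point_def imag_units_iff quat_eq_iff)

lemma upper_point_slice_point:
  assumes "\<And>h. J $ h \<in> imag_units"
  shows "upper_point (slice_point z J) = (\<chi> h. Complex (Re (z $ h)) \<bar>Im (z $ h)\<bar>)"
  using assms slice_point_sel[OF assms] by (simp add: vec_eq_iff upper_point_def imag_units_iff)

text \<open>Simultaneous conjugation, which relates an arbitrary representative of a slice point to the upper one.\<close>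

definition flip :: "'n set \<Rightarrow> ('n::finite) cvec \<Rightarrow> 'n cvec" where
  "flip H z = (\<chi> k. if k \<in> H then cnj (z $ k) else z $ k)"

lemma flip_insert: "h \<notin> H \<Longrightarrow> flip (insert h H) z = conj_at h (flip H z)"
  by (simp add: flip_def vec_eq_iff)

lemma flip_in_iff:
  assumes "invariant_set D" shows "flip H z \<in> D \<longleftrightarrow> z \<in> D"
proof (induction H rule: finite_induct[OF finite])
  case 1 show ?case by (simp add: flip_def)
next
  case (2 h H) then show ?case using assms by (simp add: flip_insert invariant_set_def[of D])
qed

lemma stem_parity_flip:
  assumes "invariant_set D" "stem_parity D F" "z \<in> D"
  shows "F (flip H z) $ K = (\<Prod>k\<in>K. if k \<in> H then - 1 else 1 :: real) *\<^sub>R F z $ K"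
proof (induction H rule: finite_induct[OF finite])
  case 1 show ?case by (simp add: flip_def)
next
  case (2 h H)
  have D: "flip H z \<in> D" using assms flip_in_iff by blast
  show ?case
  proof (cases "h \<in> K")
    case True
    have "(\<Prod>k\<in>K. if k \<in> insert h H then - 1 else 1 :: real) = - (\<Prod>k\<in>K. if k \<in> H then - 1 else 1)"
      using True 2(2) by (subst (1 2) prod.remove[of K h]) (auto intro!: prod.cong)
    then show ?thesis using 2 stem_parity_simps(1)[OF assms(2) D True] by (simp add: flip_insert)
  next
    case False
    have "(\<Prod>k\<in>K. if k \<in> insert h H then - 1 else 1 :: real) = (\<Prod>k\<in>K. if k \<in> H then - 1 else 1)"
      using False by (intro prod.cong) auto
    then show ?thesis using 2 stem_parity_simps(2)[OF assms(2) D False] by (simp add: flip_insert)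
  qed
qed

lemma ordered_prod_cong: "(\<And>k. k \<in> K \<Longrightarrow> p k = q k) \<Longrightarrow> ordered_prod K p = ordered_prod K q"
  unfolding ordered_prod_def by (intro arg_cong[where f=prod_list] map_cong) auto

lemma ordered_prod_scaleR:
  "ordered_prod K (\<lambda>k. c k *\<^sub>R q k) = (\<Prod>k\<in>K. c k) *\<^sub>R ordered_prod K q"
proof -
  have "prod_list (map (\<lambda>k. c k *\<^sub>R q k) ks) = prod_list (map c ks) *\<^sub>R prod_list (map q ks)" for ks
    by (induction ks) auto
  moreover have "prod_list (map c (sorted_list_of_set K)) = (\<Prod>k\<in>K. c k)"
    using prod.distinct_set_conv_list[of "sorted_list_of_set K" c] by simp
  ultimately show ?thesis by (simp add: ordered_prod_def)
qed

text \<open>Where the vector part vanishes any imaginary unit would do.\<close>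

definition upper_unit :: "('n::finite) qvec \<Rightarrow> 'n qvec" where
  "upper_unit x = (\<chi> h. if im_quat (x $ h) = 0 then qi else im_quat (x $ h) /\<^sub>R norm (im_quat (x $ h)))"

lemma upper_unit_imag: "upper_unit x $ h \<in> imag_units"
proof (cases "im_quat (x $ h) = 0")
  case True
  then show ?thesis by (simp add: upper_unit_def imag_units_def quat_units)
next
  case False
  then show ?thesis by (simp add: upper_unit_def imag_units_iff)
qed

lemma slice_point_upper: "slice_point (upper_point x) (upper_unit x) = x"
proof -
  have "im_quat (x $ h) = (norm (im_quat (x $ h))) *\<^sub>R (upper_unit x $ h)" for h
    by (simp add: upper_unit_def)
  then have "upper_unit x $ h * of_real (norm (im_quat (x $ h))) = im_quat (x $ h)" for h
    by (metis of_real_def mult_scaleR_right mult.right_neutral)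
  then show ?thesis by (simp add: slice_point_def vec_eq_iff) (simp add: im_quat_def)
qed

definition slice_value :: "('n::{finite,linorder}) stem \<Rightarrow> 'n qvec \<Rightarrow> quat" where
  "slice_value F x = (\<Sum>K\<in>UNIV. ordered_prod K (($) (upper_unit x)) * F (upper_point x) $ K)"

text \<open>Passing to the upper representative changes the sign of some \<open>J\<^sub>h\<close> and \<open>\<beta>\<^sub>h\<close> together, so the signs in \<open>J\<^sub>K\<close>
  and in \<open>F\<^sub>K\<close> cancel. Where \<open>\<beta>\<^sub>h = 0\<close> for some \<open>h \<in> K\<close>, the unit \<open>J\<^sub>h\<close> is not determined, but \<open>F\<^sub>K\<close> vanishes.\<close>

lemma slice_value_slice_point:
  assumes inv: "invariant_set D" and par: "stem_parity D F" and z: "z \<in> D" and J: "\<And>h. J $ h \<in> imag_units"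
  shows "(\<Sum>K\<in>UNIV. ordered_prod K (($) J) * F z $ K) = slice_value F (slice_point z J)"
  unfolding slice_value_def
proof (rule sum.cong[OF refl])
  fix K :: "'a set"
  let ?x = "slice_point z J"
  define H where "H = {h. Im (z $ h) < 0}"
  have up: "upper_point ?x = flip H z"
    unfolding upper_point_slice_point[OF J] by (simp add: H_def flip_def vec_eq_iff complex_eq_iff)
  show "ordered_prod K (($) J) * F z $ K = ordered_prod K (($) (upper_unit ?x)) * F (upper_point ?x) $ K"
  proof (cases "\<exists>h\<in>K. Im (z $ h) = 0")
    case True
    then have "F z $ K = 0" using stem_parity_zero[OF par z] by blast
    then show ?thesis unfolding up by (simp add: stem_parity_flip[OF inv par z])
  next
    case False
    let ?s = "\<lambda>k. if k \<in> H then - 1 else 1 :: real"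
    have "J $ k = ?s k *\<^sub>R upper_unit ?x $ k" if "k \<in> K" for k
    proof -
      have "J $ k \<noteq> 0" "norm (J $ k) = 1" using J[of k] by (auto simp: imag_units_iff)
      moreover have "Im (z $ k) \<noteq> 0" using False that by blast
      ultimately show ?thesis unfolding upper_unit_def using slice_point_sel(2)[where z=z and h=k, OF J]
        by (auto simp: H_def)
    qed
    then have "ordered_prod K (($) J) = (\<Prod>k\<in>K. ?s k) *\<^sub>R ordered_prod K (($) (upper_unit ?x))"
      unfolding ordered_prod_scaleR[symmetric] by (rule ordered_prod_cong)
    then show ?thesis unfolding up by (simp add: stem_parity_flip[OF inv par z])
  qed
qed

lemma circularization_eq:
  assumes "invariant_set D" shows "circularization D = {x. upper_point x \<in> D}"
proof (intro set_eqI iffI; clarify)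
  fix x assume "x \<in> circularization D"
  then obtain z J where x: "x = slice_point z J" "z \<in> D" "\<And>h. J $ h \<in> imag_units"
    by (auto simp: circularization_def)
  have "upper_point x = flip {h. Im (z $ h) < 0} z"
    unfolding x(1) upper_point_slice_point[OF x(3)] by (simp add: flip_def vec_eq_iff complex_eq_iff)
  then show "upper_point x \<in> D" using flip_in_iff[OF assms] x(2) by simp
next
  fix x assume "upper_point x \<in> D"
  then show "x \<in> circularization D"
    unfolding circularization_def
    by (intro CollectI exI[of _ "upper_point x"] exI[of _ "upper_unit x"]) (simp add: slice_point_upper upper_unit_imag)
qed

lemma open_circularization:
  assumes "invariant_set D" "open D" shows "open (circularization D)"
proof -
  have "continuous_on UNIV (upper_point :: 'a qvec \<Rightarrow> 'a cvec)"
  proof -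
    have c: "continuous_on UNIV (\<lambda>x::'a qvec. im_quat (x $ h))" "continuous_on UNIV (\<lambda>x::'a qvec. q0 (x $ h))" for h
      by (intro bounded_linear.continuous_on[OF bounded_linear_im_quat] bounded_linear.continuous_on[OF bounded_linear_q0] continuous_intros)+
    have "(upper_point :: 'a qvec \<Rightarrow> 'a cvec) = (\<lambda>x. \<chi> h. of_real (q0 (x $ h)) + \<i> * of_real (norm (im_quat (x $ h))))"
      by (simp add: fun_eq_iff upper_point_def vec_eq_iff complex_eq_iff)
    then show ?thesis by (rule ssubst) (intro continuous_intros c)
  qed
  then show ?thesis unfolding circularization_eq[OF assms(1)]
    using continuous_open_preimage[of UNIV upper_point D] assms(2) by (simp add: vimage_def)
qed

lemma induced_eq_slice_value:
  assumes inv: "invariant_set D" and par: "stem_parity D F" and x: "x \<in> circularization D"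
  shows "induced D F x = slice_value F x"
  unfolding induced_def
proof (rule the_equality)
  obtain z J where "x = slice_point z J" "z \<in> D" "\<forall>h. J $ h \<in> imag_units"
    using x by (auto simp: circularization_def)
  then show "\<exists>z J. z \<in> D \<and> (\<forall>h. J $ h \<in> imag_units) \<and> x = slice_point z J \<and>
     slice_value F x = (\<Sum>K\<in>UNIV. ordered_prod K (($) J) * F z $ K)"
    using slice_value_slice_point[OF inv par] by metis
qed (use slice_value_slice_point[OF inv par] in auto)

lemma stem_parityI: "stem_function D F \<Longrightarrow> stem_parity D F"
  by (simp add: stem_function_def stem_parity_def)

text \<open>Half the sum and half the difference of the identities for \<open>H\<close> and \<open>insert a H\<close> separate the sets without \<open>a\<close>
  from those with \<open>a\<close>; induction over \<open>A\<close> isolates a single term.\<close>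

lemma sign_sums_zero:
  fixes c :: "'n::finite set \<Rightarrow> 'b::real_vector"
  assumes "finite A"
    and "\<And>H. H \<subseteq> A \<Longrightarrow> (\<Sum>K\<in>UNIV. (\<Prod>k\<in>K. if k \<in> H then - 1 else 1 :: real) *\<^sub>R c K) = 0"
  shows "(\<Sum>K | K \<inter> A = M \<inter> A. c K) = 0"
  using assms
proof (induction A arbitrary: c rule: finite_induct)
  case empty
  from empty(1)[of "{}"] show ?case by simp
next
  case (insert a A)
  define s where "s = (\<lambda>(H::'n set) K. \<Prod>k\<in>K. if k \<in> H then - 1 else 1 :: real)"
  define c' where "c' = (\<lambda>K. if (a \<in> K) = (a \<in> M) then c K else 0)"
  have "(\<Sum>K\<in>UNIV. s H K *\<^sub>R c' K) = 0" if H: "H \<subseteq> A" for H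
  proof -
    have aH: "a \<notin> H" using H insert.hyps by blast
    have s': "s (insert a H) K = (if a \<in> K then - s H K else s H K)" for K
    proof (cases "a \<in> K")
      case True
      then show ?thesis unfolding s_def using aH by (subst (1 2) prod.remove[of K a]) (auto intro!: prod.cong)
    next
      case False
      then show ?thesis unfolding s_def by (auto intro!: prod.cong)
    qed
    have z: "(\<Sum>K\<in>UNIV. s H K *\<^sub>R c K) = 0" "(\<Sum>K\<in>UNIV. s (insert a H) K *\<^sub>R c K) = 0"
      unfolding s_def using insert.prems[of H] insert.prems[of "insert a H"] H by auto
    define e where "e = (if a \<in> M then - 1 else 1 :: real)"
    have "s H K *\<^sub>R c' K = (1/2) *\<^sub>R (s H K *\<^sub>R c K + e *\<^sub>R s (insert a H) K *\<^sub>R c K)" for K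
      by (auto simp: c'_def e_def s' simp flip: scaleR_add_left)
    then have "(\<Sum>K\<in>UNIV. s H K *\<^sub>R c' K) = (1/2) *\<^sub>R ((\<Sum>K\<in>UNIV. s H K *\<^sub>R c K) + e *\<^sub>R (\<Sum>K\<in>UNIV. s (insert a H) K *\<^sub>R c K))"
      by (simp add: scaleR_sum_right sum.distrib scaleR_add_right)
    then show ?thesis by (simp add: z)
  qed
  then have "(\<Sum>K | K \<inter> A = M \<inter> A. c' K) = 0" unfolding s_def by (rule insert.IH)
  moreover have "{K. K \<inter> insert a A = M \<inter> insert a A} = {K \<in> {K. K \<inter> A = M \<inter> A}. (a \<in> K) = (a \<in> M)}"
    using insert.hyps by (auto; blast)
  ultimately show ?case by (simp add: c'_def flip: sum.inter_filter)
qed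

lemma ordered_prod_qi_cancel: "ordered_prod K (\<lambda>_. qi) * w = 0 \<Longrightarrow> w = 0"
proof -
  have "prod_list (map (\<lambda>_. qi) ks) * w = 0 \<Longrightarrow> w = 0" for ks :: "'b list" and w
  proof (induction ks)
    case (Cons k ks)
    then have "qi * (prod_list (map (\<lambda>_. qi) ks) * w) = 0" by (simp add: mult.assoc)
    then have "qi * (qi * (prod_list (map (\<lambda>_. qi) ks) * w)) = 0" by simp
    then have "prod_list (map (\<lambda>_. qi) ks) * w = 0"
      by (simp add: mult.assoc[symmetric] quat_units)
    then show ?case by (rule Cons.IH)
  qed simp
  then show "ordered_prod K (\<lambda>_. qi) * w = 0 \<Longrightarrow> w = 0" by (simp add: ordered_prod_def)
qed

lemma qi_imag_unit: "qi \<in> imag_units" "- qi \<in> imag_units"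
  by (simp_all add: imag_units_def quat_units)

text \<open>At a fixed \<open>z\<close> replace the units by \<open>\<plusminus>qi\<close> with all choices of signs: the components are then determined by
  the resulting linear system.\<close>

lemma stem_unique:
  assumes inv: "invariant_set D" and F: "stem_parity D F" and G: "stem_parity D G"
    and eq: "\<And>x. x \<in> circularization D \<Longrightarrow> induced D F x = induced D G x" and z: "z \<in> D"
  shows "F z = G z"
proof -
  have "F z $ M = G z $ M" for M
  proof -
    define c where "c = (\<lambda>K. ordered_prod K (\<lambda>_. qi) * (F z $ K - G z $ K))"
    have "(\<Sum>K | K \<inter> UNIV = M \<inter> UNIV. c K) = 0"
    proof (rule sign_sums_zero[OF finite])
      fix H :: "'a set"
      let ?s = "\<lambda>k. if k \<in> H then - 1 else 1 :: real"
      define J :: "'a qvec" where "J = (\<chi> k. ?s k *\<^sub>R qi)"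
      have J: "J $ h \<in> imag_units" for h by (simp add: J_def qi_imag_unit)
      have x: "slice_point z J \<in> circularization D"
        using z J by (auto simp: circularization_def)
      have "(\<Sum>K\<in>UNIV. ordered_prod K (($) J) * F z $ K) = (\<Sum>K\<in>UNIV. ordered_prod K (($) J) * G z $ K)"
        using eq[OF x] induced_eq_slice_value[OF inv F x] induced_eq_slice_value[OF inv G x]
          slice_value_slice_point[OF inv F z J] slice_value_slice_point[OF inv G z J] by simp
      moreover have "ordered_prod K (($) J) = (\<Prod>k\<in>K. ?s k) *\<^sub>R ordered_prod K (\<lambda>_. qi)" for K
        unfolding ordered_prod_scaleR[symmetric] by (rule ordered_prod_cong) (simp add: J_def)
      ultimately show "(\<Sum>K\<in>UNIV. (\<Prod>k\<in>K. ?s k) *\<^sub>R c K) = 0"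
        by (simp add: c_def right_diff_distrib sum_subtractf scaleR_diff_right)
    qed
    then have "c M = 0" by simp
    then show ?thesis using ordered_prod_qi_cancel[of M "F z $ M - G z $ M"] by (simp add: c_def)
  qed
  then show ?thesis by (simp add: vec_eq_iff)
qed

lemma stem_of_props:
  assumes inv: "invariant_set D" and F: "induced_by D F f"
  shows "stem_function D (stem_of D f)" "\<And>z. z \<in> D \<Longrightarrow> stem_of D f z = F z"
proof -
  have i: "induced_by D (stem_of D f) f" unfolding stem_of_def using F by (rule someI[where P="\<lambda>F. induced_by D F f"])
  then show s: "stem_function D (stem_of D f)" by (simp add: induced_by_def)
  fix z assume "z \<in> D"
  then show "stem_of D f z = F z"
    using i F by (intro stem_unique[OF inv stem_parityI stem_parityI]) (auto simp: induced_by_def)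
qed

lemma induced_by_self: "stem_function D F \<Longrightarrow> induced_by D F (induced D F)"
  by (simp add: induced_by_def)

lemma stem_prod_nth:
  "stem_prod F G z $ M = (\<Sum>H\<in>UNIV. \<Sum>K\<in>UNIV. if sym_diff K H = M then (-1) ^ card (H \<inter> K) * F z $ K * G z $ H else 0)"
  unfolding stem_prod_def sum_component by (intro sum.cong refl) (auto simp: axis_def)

lemma stem_function_stem_prod:
  assumes inv: "invariant_set D" and F: "stem_function D F" and G: "stem_function D G"
  shows "stem_function D (stem_prod F G)"
  unfolding stem_function_def
proof (intro conjI ballI allI)
  have c: "continuous_on D (\<lambda>z. F z $ K)" "continuous_on D (\<lambda>z. G z $ K)" for K
    using F G by (auto simp: stem_function_def intro!: continuous_intros)
  have "continuous_on D (\<lambda>z. \<chi> M. stem_prod F G z $ M)"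
  proof (intro continuous_on_vec_lambda)
    fix M
    have "continuous_on D (\<lambda>z. if sym_diff K H = M then (-1) ^ card (H \<inter> K) * F z $ K * G z $ H else 0)" for H K
      by (cases "sym_diff K H = M") (auto intro!: continuous_intros c)
    then show "continuous_on D (\<lambda>z. stem_prod F G z $ M)"
      unfolding stem_prod_nth by (intro continuous_on_sum)
  qed
  then show "continuous_on D (stem_prod F G)" by simp
next
  fix z M h assume z: "z \<in> D"
  have "F (conj_at h z) $ K * G (conj_at h z) $ H = (-1) ^ card (sym_diff K H \<inter> {h}) * (F z $ K * G z $ H)" for K H
    using stem_parity_simps[OF stem_parityI[OF F] z, of h K] stem_parity_simps[OF stem_parityI[OF G] z, of h H]
    by (cases "h \<in> K"; cases "h \<in> H") auto
  then have "(-1) ^ card (H \<inter> K) * F (conj_at h z) $ K * G (conj_at h z) $ H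
      = (-1) ^ card (sym_diff K H \<inter> {h}) * ((-1) ^ card (H \<inter> K) * F z $ K * G z $ H)" for K H
    by (cases "even (card (H \<inter> K))") (simp_all add: mult.assoc)
  then show "stem_prod F G (conj_at h z) $ M = (-1) ^ card (M \<inter> {h}) * stem_prod F G z $ M"
    unfolding stem_prod_nth sum_distrib_left by (intro sum.cong refl) auto
qed

section \<open>Products with coordinate functions\<close>

lemma quat_Reals: "q \<in> \<real> \<Longrightarrow> q = of_real (inner q (1::quat))"
  by (elim Reals_cases) (simp add: quat_eq_iff inner_quat_def)

lemma coord_stem_nth:
  "coord_stem j z $ K = (if K = {} then of_real (Re (z $ j)) else if K = {j} then of_real (Im (z $ j)) else 0)"
  by (auto simp: coord_stem_def axis_def)

lemma stem_function_coord_stem: "stem_function D (coord_stem j)"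
  unfolding stem_function_def
proof (intro conjI ballI allI)
  have "continuous_on D (\<lambda>z. \<chi> K. coord_stem j z $ K)"
    unfolding coord_stem_nth
    by (intro continuous_on_vec_lambda, rename_tac K, case_tac "K = {}"; case_tac "K = {j}")
      (auto intro!: continuous_intros)
  then show "continuous_on D (coord_stem j)" by simp
next
  fix z K h
  show "coord_stem j (conj_at h z) $ K = (-1) ^ card (K \<inter> {h}) * coord_stem j z $ K"
    by (auto simp: coord_stem_nth)
qed

lemma stem_char_coord_stem:
  fixes z :: "('n::finite) cvec"
  shows "stem_char 1 (coord_stem j z) = z $ j"
proof -
  have "stem_char 1 (coord_stem j z) = stem_char 1 (axis {} (of_real (Re (z $ j))) :: 'n coeffs)
     + stem_char 1 (axis {j} (of_real (Im (z $ j))) :: 'n coeffs)"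
    unfolding coord_stem_def by (rule linear_add[OF bounded_linear.linear[OF bounded_linear_stem_char]])
  also have "\<dots> = z $ j" by (simp add: stem_char_axis inner_quat_def complex_eq_iff)
  finally show ?thesis .
qed

lemma stem_prod_Reals:
  assumes "\<And>K. P z $ K \<in> \<real>" "\<And>K. Q z $ K \<in> \<real>"
  shows "stem_prod P Q z $ M \<in> \<real>"
  unfolding stem_prod_nth by (intro sum_in_Reals) (use assms in \<open>auto intro!: Reals_mult Reals_power\<close>)

lemma stem_prod_cong: "F z = F' z \<Longrightarrow> G z = G' z \<Longrightarrow> stem_prod F G z = stem_prod F' G' z"
  by (simp add: stem_prod_def)

lemma stem_function_one: "stem_function D (\<lambda>z. axis {} 1)"
  by (auto simp: stem_function_def axis_def)

lemma induced_one:
  fixes D :: "'n::{finite,linorder} cvec set"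
  assumes "invariant_set D" "x \<in> circularization D"
  shows "induced D (\<lambda>z. axis {} 1) x = 1"
proof -
  have "induced D (\<lambda>z. axis {} 1) x = (\<Sum>K\<in>UNIV. ordered_prod K (($) (upper_unit x)) * (axis {} 1 :: 'n coeffs) $ K)"
    using induced_eq_slice_value[OF assms(1) stem_parityI[OF stem_function_one] assms(2)] by (simp add: slice_value_def)
  also have "\<dots> = (\<Sum>K\<in>(UNIV :: 'n set set). if K = {} then 1 else 0)"
    by (intro sum.cong) (auto simp: axis_def ordered_prod_def)
  finally show ?thesis by simp
qed

text \<open>Under the character each factor becomes the coordinate \<open>z\<^sub>k\<close>, so the product becomes a monomial.\<close>

lemma coord_prod_stem:
  assumes inv: "invariant_set D" and D: "open D"
  shows "\<exists>P. induced_by D P (coord_prod D K) \<and> (\<forall>z\<in>D. \<forall>M. P z $ M \<in> \<real>) \<and> hol D (\<lambda>z. stem_char 1 (P z))"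
proof -
  have "\<exists>P. induced_by D P (foldr (\<lambda>k. slice_prod D (coord D k)) ks (\<lambda>x. 1)) \<and>
     (\<forall>z\<in>D. \<forall>M. P z $ M \<in> \<real>) \<and> hol D (\<lambda>z. stem_char 1 (P z))" for ks
  proof (induction ks)
    case Nil
    have "induced_by D (\<lambda>z. axis {} 1) (\<lambda>x. 1)"
      by (simp add: induced_by_def stem_function_one induced_one[OF inv])
    moreover have "\<forall>M. (axis {} 1 :: 'a coeffs) $ M \<in> \<real>" by (simp add: axis_def)
    moreover have "hol D (\<lambda>z. stem_char 1 (axis {} 1 :: 'a coeffs))" by (rule hol_const[OF D])
    ultimately show ?case by (intro exI[of _ "\<lambda>z. axis {} 1"]) simp
  next
    case (Cons k ks)
    define c where "c = foldr (\<lambda>k. slice_prod D (coord D k)) ks (\<lambda>x. 1)"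
    obtain P where P: "induced_by D P c" "\<forall>z\<in>D. \<forall>M. P z $ M \<in> \<real>" "hol D (\<lambda>z. stem_char 1 (P z))"
      using Cons unfolding c_def by blast
    have k: "induced_by D (coord_stem k) (coord D k)"
      unfolding coord_def by (rule induced_by_self[OF stem_function_coord_stem])
    define Q where "Q = stem_prod (stem_of D (coord D k)) (stem_of D c)"
    have Q: "stem_function D Q" unfolding Q_def
      by (intro stem_function_stem_prod[OF inv] stem_of_props(1)[OF inv k] stem_of_props(1)[OF inv P(1)])
    have Qz: "Q z = stem_prod (coord_stem k) P z" if "z \<in> D" for z
      unfolding Q_def by (intro stem_prod_cong stem_of_props(2)[OF inv k that] stem_of_props(2)[OF inv P(1) that])
    have kR: "coord_stem k z $ M \<in> \<real>" for z M by (simp add: coord_stem_nth)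
    have "induced_by D Q (slice_prod D (coord D k) c)"
      unfolding slice_prod_def Q_def[symmetric] by (rule induced_by_self[OF Q])
    moreover have "\<forall>z\<in>D. \<forall>M. Q z $ M \<in> \<real>"
      using P(2) kR by (simp add: Qz stem_prod_Reals)
    moreover have "hol D (\<lambda>z. stem_char 1 (Q z))"
    proof (rule hol_cong[OF hol_mult[OF hol_nth[OF D, of k] P(3)]])
      fix z assume z: "z \<in> D"
      show "z $ k * stem_char 1 (P z) = stem_char 1 (Q z)"
        using stem_char_stem_prod[of "coord_stem k" z 1 P, OF quat_Reals[OF kR]]
        by (simp add: Qz[OF z] stem_char_coord_stem)
    qed
    ultimately show ?case unfolding c_def by auto
  qed
  then show ?thesis unfolding coord_prod_def .
qed

text \<open>The description of the stem functions of slice regular functions through characters. It is stable under products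
  with real stem functions.\<close>

definition regular_stem :: "('n::finite) cvec set \<Rightarrow> 'n stem \<Rightarrow> bool" where
  "regular_stem D G \<longleftrightarrow> open D \<and> invariant_set D \<and> stem_function D G \<and> (\<forall>b. hol D (\<lambda>z. stem_char b (G z)))"

lemma regular_stem_product:
  assumes inv: "invariant_set D" and D: "open D" and f: "f \<in> slice_regular D"
  shows "regular_stem D (stem_of D (slice_prod D (coord_prod D K) f))"
proof -
  obtain F where F: "induced_by D F f" "holomorphic_stem D F" using f by (auto simp: slice_regular_def)
  obtain P where P: "induced_by D P (coord_prod D K)" "\<forall>z\<in>D. \<forall>M. P z $ M \<in> \<real>" "hol D (\<lambda>z. stem_char 1 (P z))"
    using coord_prod_stem[OF inv D] by blast
  define Q where "Q = stem_prod (stem_of D (coord_prod D K)) (stem_of D f)"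
  have Q: "stem_function D Q" unfolding Q_def
    by (intro stem_function_stem_prod[OF inv] stem_of_props(1)[OF inv P(1)] stem_of_props(1)[OF inv F(1)])
  have Qz: "Q z = stem_prod P F z" if "z \<in> D" for z
    unfolding Q_def by (intro stem_prod_cong stem_of_props(2)[OF inv P(1) that] stem_of_props(2)[OF inv F(1) that])
  have i: "induced_by D Q (slice_prod D (coord_prod D K) f)"
    unfolding slice_prod_def Q_def[symmetric] by (rule induced_by_self[OF Q])
  have "hol D (\<lambda>z. stem_char b (stem_of D (slice_prod D (coord_prod D K) f) z))" for b
  proof (rule hol_cong[OF hol_mult[OF P(3) hol_stem_char[OF D F(2), of b]]])
    fix z assume z: "z \<in> D"
    have "P z $ M = of_real (inner (P z $ M) 1)" for M using P(2) z quat_Reals by blast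
    then show "stem_char 1 (P z) * stem_char b (F z) = stem_char b (stem_of D (slice_prod D (coord_prod D K) f) z)"
      using stem_of_props(2)[OF inv i z] Qz[OF z] by (simp add: stem_char_stem_prod)
  qed
  then show ?thesis using inv D stem_of_props(1)[OF inv i] by (simp add: regular_stem_def)
qed

section \<open>Spherical components\<close>

text \<open>The function \<open>E\<^sub>K\<close>, whose values at real points do not depend on the order \<open>hs\<close> of the variables.\<close>

definition stem_radial :: "'n::finite stem \<Rightarrow> 'n list \<Rightarrow> 'n set \<Rightarrow> quat \<Rightarrow> complex^('n + 'n) \<Rightarrow> complex" where
  "stem_radial G hs K b = stem_rep hs K (\<lambda>z. stem_char b (G z))"

definition im_prod :: "'n::{finite,linorder} set \<Rightarrow> 'n qvec \<Rightarrow> quat" where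
  "im_prod L x = ordered_prod L (\<lambda>l. im_quat (x $ l))"

text \<open>The spherical derivative with respect to \<open>P\<close>, written without denominators.\<close>

definition spherical_sum :: "'n::{finite,linorder} stem \<Rightarrow> 'n list \<Rightarrow> 'n set \<Rightarrow> 'n qvec \<Rightarrow> quat" where
  "spherical_sum G hs P x = (\<Sum>L\<in>Pow (- P). im_prod L x * radial_at (stem_radial G hs (P \<union> L)) x)"

lemma invariant_off_real: "invariant_set D \<Longrightarrow> invariant_set (off_real P D)"
  unfolding invariant_set_def[of "off_real P D"] off_real_def
  by (auto simp: invariant_set_def split: if_splits)

lemma stem_spherical_deriv_nth:
  "stem_spherical_deriv P F z $ M =
     (if M \<subseteq> - P then inverse (\<Prod>h\<in>P. Im (z $ h)) *\<^sub>R F z $ (M \<union> P) else 0)"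
proof -
  have "(\<Sum>K\<in>Pow (- P). axis K (F z $ (K \<union> P))) $ M = (\<Sum>K\<in>Pow (- P). if K = M then F z $ (M \<union> P) else 0)"
    unfolding sum_component by (intro sum.cong) (auto simp: axis_def)
  then show ?thesis by (simp add: stem_spherical_deriv_def)
qed

lemma stem_parity_spherical_deriv:
  assumes par: "stem_parity D F"
  shows "stem_parity (off_real P D) (stem_spherical_deriv P F)"
  unfolding stem_parity_def
proof (intro ballI allI)
  fix z M h assume "z \<in> off_real P D"
  then have z: "z \<in> D" by (simp add: off_real_def)
  show "stem_spherical_deriv P F (conj_at h z) $ M = (-1) ^ card (M \<inter> {h}) * stem_spherical_deriv P F z $ M"
  proof (cases "M \<subseteq> - P")
    case True
    show ?thesis
    proof (cases "h \<in> P")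
      case hP: True
      have "(\<Prod>k\<in>P. Im (conj_at h z $ k)) = - (\<Prod>k\<in>P. Im (z $ k))"
        using hP by (subst (1 2) prod.remove[of P h]) (auto intro!: prod.cong)
      moreover have "h \<notin> M" using True hP by auto
      ultimately show ?thesis using True hP stem_parity_simps(1)[OF par z, of h "M \<union> P"]
        by (simp add: stem_spherical_deriv_nth)
    next
      case False
      have "(\<Prod>k\<in>P. Im (conj_at h z $ k)) = (\<Prod>k\<in>P. Im (z $ k))"
        using False by (intro prod.cong) auto
      then show ?thesis using True False stem_parity_simps[OF par z, of h "M \<union> P"]
        by (cases "h \<in> M") (simp_all add: stem_spherical_deriv_nth)
    qed
  qed (simp add: stem_spherical_deriv_nth)
qed

lemma im_prod_upper_unit:
  "im_prod L x = (\<Prod>l\<in>L. Im (upper_point x $ l)) *\<^sub>R ordered_prod L (($) (upper_unit x))"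
  unfolding im_prod_def ordered_prod_scaleR[symmetric]
  by (rule ordered_prod_cong) (simp add: upper_unit_def)

text \<open>Dividing by the \<open>\<beta>\<^sub>h\<close>, \<open>h \<in> P\<close>, removes them from the factorization of the components, and the remaining
  factors \<open>\<beta>\<^sub>l\<close> combine with the units \<open>J\<^sub>l\<close> to the vector parts.\<close>

lemma spherical_deriv_eq_sum:
  assumes G: "regular_stem D G" and g: "stem_of D g = G" and hs: "distinct hs" "set hs = UNIV"
    and x: "x \<in> circularization (off_real P D)"
  shows "spherical_deriv D P g x = spherical_sum G hs P x"
proof -
  have inv: "invariant_set D" and par: "stem_parity D G"
    using G stem_parityI by (auto simp: regular_stem_def)
  let ?z = "upper_point x"
  have z: "?z \<in> off_real P D" using x circularization_eq[OF invariant_off_real[OF inv]] by blast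
  then have zD: "?z \<in> D" and nz: "(\<Prod>h\<in>P. Im (?z $ h)) \<noteq> 0" by (auto simp: off_real_def)
  have "spherical_deriv D P g x = slice_value (stem_spherical_deriv P G) x"
    unfolding spherical_deriv_def g
    by (rule induced_eq_slice_value[OF invariant_off_real[OF inv] stem_parity_spherical_deriv[OF par] x])
  also have "\<dots> = (\<Sum>M\<in>UNIV. if M \<in> Pow (- P) then im_prod M x * radial_at (stem_radial G hs (P \<union> M)) x else 0)"
    unfolding slice_value_def
  proof (intro sum.cong refl)
    fix M
    show "ordered_prod M (($) (upper_unit x)) * stem_spherical_deriv P G ?z $ M =
      (if M \<in> Pow (- P) then im_prod M x * radial_at (stem_radial G hs (P \<union> M)) x else 0)"
    proof (cases "M \<subseteq> - P")
      case True
      have "(\<Prod>k\<in>P \<union> M. Im (?z $ k)) = (\<Prod>k\<in>P. Im (?z $ k)) * (\<Prod>k\<in>M. Im (?z $ k))"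
        using True by (intro prod.union_disjoint) auto
      then have "stem_spherical_deriv P G ?z $ M = (\<Prod>k\<in>M. Im (?z $ k)) *\<^sub>R radial_at (stem_radial G hs (P \<union> M)) x"
        using True nz unfolding stem_spherical_deriv_nth Un_commute[of M P]
        by (subst stem_eq_radial[OF inv par zD hs])
          (simp add: radial_at_def stem_radial_def[abs_def])
      then show ?thesis using True by (simp add: im_prod_upper_unit)
    qed (simp add: stem_spherical_deriv_nth)
  qed
  also have "\<dots> = spherical_sum G hs P x"
    using sum.inter_restrict[of UNIV "\<lambda>M. im_prod M x * radial_at (stem_radial G hs (P \<union> M)) x" "Pow (- P)"]
    by (simp add: spherical_sum_def)
  finally show ?thesis .
qed

text \<open>Adding a small real multiple of \<open>qi\<close> to all coordinates makes every vector part nonzero, with finitely many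
  exceptional multiples.\<close>

lemma eq_of_eq_off_real:
  fixes f g :: "('n::{finite,linorder}) qvec \<Rightarrow> quat"
  assumes D: "open D" "invariant_set D" and c: "continuous_on (circularization D) f" "continuous_on (circularization D) g"
    and eq: "\<And>x. x \<in> circularization (off_real P D) \<Longrightarrow> f x = g x" and x: "x \<in> circularization D"
  shows "f x = g x"
proof -
  define l where "l = (\<lambda>t::real. x + t *\<^sub>R (\<chi> h. qi))"
  define S where "S = {t. l t \<in> circularization D}"
  have cl: "continuous_on UNIV l" unfolding l_def by (intro continuous_intros)
  have oS: "open S" unfolding S_def
    using continuous_open_preimage[OF cl open_UNIV open_circularization[OF D(2,1)]] by (simp add: vimage_def)
  have l0: "l 0 = x" by (simp add: l_def)
  have S0: "0 \<in> S" using x l0 by (simp add: S_def)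
  have "continuous_on S (\<lambda>t. f (l t) - g (l t))"
    by (intro continuous_intros continuous_on_compose2[OF c(1)] continuous_on_compose2[OF c(2)] continuous_on_subset[OF cl])
      (auto simp: S_def)
  then have "((\<lambda>t. f (l t) - g (l t)) \<longlongrightarrow> f (l 0) - g (l 0)) (at 0)"
    using oS S0 by (auto simp: continuous_on_eq_continuous_at isCont_def)
  moreover have "eventually (\<lambda>t. f (l t) - g (l t) = 0) (at 0)"
  proof -
    \<comment> \<open>The parameters at which some vector part may vanish; \<open>0\<close> itself is excluded by the punctured limit.\<close>
    have fin: "finite ((\<lambda>h. - q1 (x $ h)) ` UNIV - {0})" by simp
    have "open (S - ((\<lambda>h. - q1 (x $ h)) ` UNIV - {0}))"
      using oS fin by (intro open_Diff finite_imp_closed)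
    then have "eventually (\<lambda>t. t \<in> (S - ((\<lambda>h. - q1 (x $ h)) ` UNIV - {0})) - {0}) (at 0)"
      using S0 by (intro eventually_at_in_open) auto
    then show ?thesis
    proof eventually_elim
      case (elim t)
      have "im_quat (l t $ h) \<noteq> 0" for h
      proof
        assume "im_quat (l t $ h) = 0"
        then have "q1 (im_quat (l t $ h)) = 0" by simp
        then have "q1 (x $ h) + t = 0" by (simp add: l_def qi_def)
        then have "t = - q1 (x $ h)" by simp
        then show False using elim by blast
      qed
      moreover have "upper_point (l t) \<in> D"
        using elim circularization_eq[OF D(2)] by (auto simp: S_def)
      ultimately have "upper_point (l t) \<in> off_real P D" by (simp add: off_real_def)
      then show ?case using eq circularization_eq[OF invariant_off_real[OF D(2)]] by force
    qed
  qed
  ultimately have "f (l 0) - g (l 0) = 0"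
    using tendsto_unique[OF _ _ tendsto_eventually] trivial_limit_at by blast
  then show ?thesis by (simp add: l0)
qed

lemma stem_radial_hol:
  assumes "regular_stem D G" shows "hol (rep_dom hs D) (stem_radial G hs K b)"
  using assms hol_stem_rep unfolding stem_radial_def regular_stem_def by blast

lemma upper_point_dom:
  assumes "regular_stem D G" "distinct hs" "set hs = UNIV" "x \<in> circularization D"
  shows "even_coords (upper_point x) \<in> rep_dom hs D"
proof -
  have "invariant_set D" using assms(1) by (simp add: regular_stem_def)
  then show ?thesis using assms(2-4) circularization_eq even_coords_dom by blast
qed

lemma continuous_on_spherical_sum:
  assumes G: "regular_stem D G" and hs: "distinct hs" "set hs = UNIV"
  shows "continuous_on (circularization D) (spherical_sum G hs P)"
proof -
  have "continuous_on (circularization D) (radial_at (stem_radial G hs K))" for K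
    by (rule continuous_on_radial_at[where \<Theta>="stem_radial G hs K", OF stem_radial_hol[OF G] upper_point_dom[OF G hs]])
  moreover have "continuous_on (circularization D) (im_prod L)" for L
    unfolding im_prod_def[abs_def] by (rule C1_on_imp_continuous_on[OF C1_on_ordered_prod])
  ultimately show ?thesis unfolding spherical_sum_def[abs_def] by (intro continuous_intros)
qed

lemma spherical_component_eq_sum:
  assumes D: "open D" "invariant_set D" and f: "f \<in> slice_regular D"
    and hs: "distinct hs" "set hs = UNIV" and x: "x \<in> circularization D"
  shows "spherical_component D m K f x =
     spherical_sum (stem_of D (slice_prod D (coord_prod D K) f)) hs (seg m) x"
proof -
  define G where "G = stem_of D (slice_prod D (coord_prod D K) f)"
  define S where "S = spherical_component D m K f"
  have G: "regular_stem D G" unfolding G_def by (rule regular_stem_product[OF D(2,1) f])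
  let ?ext = "\<lambda>g. continuous_on (circularization D) g \<and> (\<forall>x\<in>circularization (off_real (seg m) D).
        g x = spherical_deriv D (seg m) (slice_prod D (coord_prod D K) f) x)"
  have "?ext (spherical_sum G hs (seg m))"
    using continuous_on_spherical_sum[OF G hs] spherical_deriv_eq_sum[OF G G_def[symmetric] hs] by auto
  then have S: "?ext S" unfolding S_def spherical_component_def by (rule someI[where P="?ext"])
  show ?thesis unfolding S_def[symmetric] G_def[symmetric]
    by (rule eq_of_eq_off_real[OF D _ continuous_on_spherical_sum[OF G hs] _ x, of _ "seg m"])
      (use S spherical_deriv_eq_sum[OF G G_def[symmetric] hs] in auto)
qed

text \<open>This is where the order of the indices enters: a factor with a smaller index stands on the left.\<close>

lemma ordered_prod_insert_less:
  fixes h :: "'n::{finite,linorder}"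
  assumes "h \<notin> L" "\<And>l. l \<in> L \<Longrightarrow> h < l"
  shows "ordered_prod (insert h L) q = q h * ordered_prod L q"
proof -
  have "sorted_list_of_set (insert h L) = h # sorted_list_of_set L"
    using assms by (simp add: sorted_list_of_set_insert insort_is_Cons less_imp_le)
  then show ?thesis by (simp add: ordered_prod_def)
qed

lemma im_prod_insert:
  assumes "h \<notin> L" "\<And>l. l \<in> L \<Longrightarrow> h < l"
  shows "im_prod (insert h L) x = im_quat (x $ h) * im_prod L x"
  unfolding im_prod_def by (rule ordered_prod_insert_less[OF assms])

section \<open>First-order operators on axial families\<close>

lemma has_line_deriv_eqI: "has_line_deriv f v d x \<Longrightarrow> d = e \<Longrightarrow> has_line_deriv f v e x"
  by simp

definition dpart :: "'k::finite \<Rightarrow> (quat \<Rightarrow> complex^'k \<Rightarrow> complex) \<Rightarrow> quat \<Rightarrow> complex^'k \<Rightarrow> complex" where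
  "dpart j \<Theta> b = pd j (\<Theta> b)"

definition hol_family :: "(complex^'k::finite) set \<Rightarrow> (quat \<Rightarrow> complex^'k \<Rightarrow> complex) \<Rightarrow> bool" where
  "hol_family W \<Theta> \<longleftrightarrow> (\<forall>b. hol W (\<Theta> b))"

lemma hol_family_dpart: "hol_family W \<Theta> \<Longrightarrow> hol_family W (dpart j \<Theta>)"
  by (simp add: hol_family_def dpart_def hol_pd)

lemma line_deriv_radial_real:
  assumes "hol_family W \<Theta>" "even_coords (upper_point x) \<in> W"
  shows "has_line_deriv (radial_at \<Theta>) (axis h 1) (radial_at (dpart (Inl h) \<Theta>) x) x"
  using has_line_deriv_radial_at[of W \<Theta> x h 1] assms by (simp add: hol_family_def dpart_def[abs_def])

lemma line_deriv_radial_imag: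
  assumes "hol_family W \<Theta>" "even_coords (upper_point x) \<in> W" "q0 u = 0"
  shows "has_line_deriv (radial_at \<Theta>) (axis h u)
     ((2 * inner (im_quat (x $ h)) u) *\<^sub>R radial_at (dpart (Inr h) \<Theta>) x) x"
  using has_line_deriv_radial_at[of W \<Theta> x h u] assms by (simp add: hol_family_def dpart_def[abs_def])

lemma line_deriv_im_prod: "h \<notin> L \<Longrightarrow> has_line_deriv (im_prod L) (axis h u) 0 x"
  unfolding im_prod_def[abs_def] by (rule has_line_deriv_ordered_prod)

text \<open>Transfers a relation between holomorphic functions of \<open>u\<close> and \<open>s\<close> to quaternionic functions of \<open>x\<close>; its
  left-hand side is the Laplacian in \<open>x\<^sub>h\<close>.\<close>

lemma radial_relation:
  assumes "\<And>b. b \<in> Basis \<Longrightarrow> \<Theta>1 b w + 6 * \<Theta>2 b w + 4 * w $ Inr h * \<Theta>3 b w = of_real k * \<Theta>4 b w"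
    and w: "w = even_coords (upper_point x)"
  shows "radial_at \<Theta>1 x + 6 *\<^sub>R radial_at \<Theta>2 x + (4 * (norm (im_quat (x $ h)))\<^sup>2) *\<^sub>R radial_at \<Theta>3 x = k *\<^sub>R radial_at \<Theta>4 x"
proof -
  have "Re (\<Theta>1 b w) + 6 * Re (\<Theta>2 b w) + (4 * (norm (im_quat (x $ h)))\<^sup>2) * Re (\<Theta>3 b w) = k * Re (\<Theta>4 b w)" if "b \<in> Basis" for b
    using arg_cong[OF assms(1)[OF that], of Re] w by simp
  then have "(\<Sum>b\<in>Basis. (Re (\<Theta>1 b w) + 6 * Re (\<Theta>2 b w) + (4 * (norm (im_quat (x $ h)))\<^sup>2) * Re (\<Theta>3 b w)) *\<^sub>R b)
     = (\<Sum>b\<in>Basis. (k * Re (\<Theta>4 b w)) *\<^sub>R b)" by simp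
  then show ?thesis
    by (simp add: radial_at_def radial_def w[symmetric] scaleR_add_left sum.distrib scaleR_sum_right)
qed

text \<open>The result of applying \<open>\<partial>\<close> in \<open>x\<^sub>h\<close> to the product of \<open>im_prod L\<close> and the radial function of \<open>\<Theta>\<close>, see
  \<open>qd_product\<close> below.\<close>

definition monogenic_term :: "'n::{finite,linorder} \<Rightarrow> 'n set \<Rightarrow> (quat \<Rightarrow> complex^('n + 'n) \<Rightarrow> complex) \<Rightarrow> 'n qvec \<Rightarrow> quat" where
  "monogenic_term h L \<Theta> x = (1/2) *\<^sub>R (im_prod L x * radial_at (dpart (Inl h) \<Theta>) x)
     - im_quat (x $ h) * (im_prod L x * radial_at (dpart (Inr h) \<Theta>) x)"

text \<open>What is used about the odd quotients in the variable \<open>h\<close>: harmonicity in \<open>x\<^sub>h\<close> and symmetry of the mixed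
  derivatives.\<close>

definition axial_family :: "'n::finite \<Rightarrow> (complex^('n + 'n)) set \<Rightarrow> (quat \<Rightarrow> complex^('n + 'n) \<Rightarrow> complex) \<Rightarrow> bool" where
  "axial_family h W \<Theta> \<longleftrightarrow> hol_family W \<Theta> \<and> (\<forall>b. \<forall>w\<in>W.
     pd (Inl h) (pd (Inl h) (\<Theta> b)) w + 6 * pd (Inr h) (\<Theta> b) w + 4 * w $ Inr h * pd (Inr h) (pd (Inr h) (\<Theta> b)) w = 0 \<and>
     pd (Inl h) (pd (Inr h) (\<Theta> b)) w = pd (Inr h) (pd (Inl h) (\<Theta> b)) w)"

lemma axial_family_harmonic:
  assumes "axial_family h W \<Theta>" "even_coords (upper_point x) \<in> W"
  shows "radial_at (dpart (Inl h) (dpart (Inl h) \<Theta>)) x + 6 *\<^sub>R radial_at (dpart (Inr h) \<Theta>) x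
     + (4 * (norm (im_quat (x $ h)))\<^sup>2) *\<^sub>R radial_at (dpart (Inr h) (dpart (Inr h) \<Theta>)) x = 0"
proof -
  have "radial_at (dpart (Inl h) (dpart (Inl h) \<Theta>)) x + 6 *\<^sub>R radial_at (dpart (Inr h) \<Theta>) x
     + (4 * (norm (im_quat (x $ h)))\<^sup>2) *\<^sub>R radial_at (dpart (Inr h) (dpart (Inr h) \<Theta>)) x = 0 *\<^sub>R radial_at \<Theta> x"
    by (rule radial_relation[OF _ refl]) (use assms in \<open>simp add: axial_family_def dpart_def del: even_coords_nth\<close>)
  then show ?thesis by simp
qed

lemma axial_family_commute:
  assumes "axial_family h W \<Theta>" "even_coords (upper_point x) \<in> W"
  shows "radial_at (dpart (Inr h) (dpart (Inl h) \<Theta>)) x = radial_at (dpart (Inl h) (dpart (Inr h) \<Theta>)) x"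
  using assms by (simp add: radial_at_def radial_def dpart_def axial_family_def)

text \<open>The sum over the units that arises from \<open>\<partial>\<close>-bar of \<open>monogenic_term\<close>, with \<open>m\<close> the vector part of \<open>x\<^sub>h\<close>. It
  rests on \<open>m\<^sup>2 = - \<bar>m\<bar>\<^sup>2\<close> and on the sum \<open>- 3\<close> of the squares of the units; the terms with \<open>C\<close> cancel.\<close>

lemma quat_dbar_identity:
  assumes "q0 m = 0"
  shows "((1/2) *\<^sub>R A - m * C)
     + qi * ((1/2) *\<^sub>R ((2 * q1 m) *\<^sub>R C) - (m * ((2 * q1 m) *\<^sub>R E) + qi * B))
     + qj * ((1/2) *\<^sub>R ((2 * q2 m) *\<^sub>R C) - (m * ((2 * q2 m) *\<^sub>R E) + qj * B))
     + qk * ((1/2) *\<^sub>R ((2 * q3 m) *\<^sub>R C) - (m * ((2 * q3 m) *\<^sub>R E) + qk * B))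
   = (1/2) *\<^sub>R (A + 6 *\<^sub>R B + (4 * (norm m)\<^sup>2) *\<^sub>R E)"
  using assms unfolding norm_quat_sq
  by (simp add: quat_eq_iff algebra_simps power2_eq_square)

text \<open>The sum of the second derivatives of a \<open>slice_pair\<close>, with \<open>m\<close> the vector part of \<open>x\<^sub>h\<close>: besides the Laplacians of
  the two radial functions there is a cross term, since the Laplacian does not commute with multiplication by \<open>m\<close>.\<close>

lemma quat_laplace_identity:
  assumes "q0 m = 0"
  shows "(A2 + m * B2)
     + ((2 * q1 m) *\<^sub>R ((2 * q1 m) *\<^sub>R Ass) + 2 *\<^sub>R As + (qi * ((2 * q1 m) *\<^sub>R Bs) + (m * ((2 * q1 m) *\<^sub>R ((2 * q1 m) *\<^sub>R Bss) + 2 *\<^sub>R Bs) + qi * ((2 * q1 m) *\<^sub>R Bs))))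
     + ((2 * q2 m) *\<^sub>R ((2 * q2 m) *\<^sub>R Ass) + 2 *\<^sub>R As + (qj * ((2 * q2 m) *\<^sub>R Bs) + (m * ((2 * q2 m) *\<^sub>R ((2 * q2 m) *\<^sub>R Bss) + 2 *\<^sub>R Bs) + qj * ((2 * q2 m) *\<^sub>R Bs))))
     + ((2 * q3 m) *\<^sub>R ((2 * q3 m) *\<^sub>R Ass) + 2 *\<^sub>R As + (qk * ((2 * q3 m) *\<^sub>R Bs) + (m * ((2 * q3 m) *\<^sub>R ((2 * q3 m) *\<^sub>R Bss) + 2 *\<^sub>R Bs) + qk * ((2 * q3 m) *\<^sub>R Bs))))
   = (A2 + 6 *\<^sub>R As + (4 * (norm m)\<^sup>2) *\<^sub>R Ass) + m * (B2 + 6 *\<^sub>R Bs + (4 * (norm m)\<^sup>2) *\<^sub>R Bss) + 4 *\<^sub>R (m * Bs)"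
  using assms unfolding norm_quat_sq
  by (simp add: quat_eq_iff algebra_simps power2_eq_square)

lemma line_deriv_monogenic_term:
  assumes \<Theta>: "hol_family W \<Theta>" and x: "even_coords (upper_point x) \<in> W" and h: "h \<notin> L"
  shows "has_line_deriv (monogenic_term h L \<Theta>) (axis h 1)
      ((1/2) *\<^sub>R (im_prod L x * radial_at (dpart (Inl h) (dpart (Inl h) \<Theta>)) x)
       - im_quat (x $ h) * (im_prod L x * radial_at (dpart (Inl h) (dpart (Inr h) \<Theta>)) x)) x" (is ?real)
    and "q0 u = 0 \<Longrightarrow> im_quat u = u \<Longrightarrow> has_line_deriv (monogenic_term h L \<Theta>) (axis h u)
      ((1/2) *\<^sub>R ((2 * inner (im_quat (x $ h)) u) *\<^sub>R (im_prod L x * radial_at (dpart (Inr h) (dpart (Inl h) \<Theta>)) x))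
       - (im_quat (x $ h) * ((2 * inner (im_quat (x $ h)) u) *\<^sub>R (im_prod L x * radial_at (dpart (Inr h) (dpart (Inr h) \<Theta>)) x))
          + u * (im_prod L x * radial_at (dpart (Inr h) \<Theta>) x))) x" (is "_ \<Longrightarrow> _ \<Longrightarrow> ?imag")
proof -
  note d = has_line_deriv_diff has_line_deriv_scaleR has_line_deriv_mult line_deriv_im_prod[OF h] has_line_deriv_im
  show ?real unfolding monogenic_term_def[abs_def]
    by (rule has_line_deriv_eqI, (rule d line_deriv_radial_real hol_family_dpart \<Theta> x)+) simp
  show ?imag if "q0 u = 0" "im_quat u = u" unfolding monogenic_term_def[abs_def]
    by (rule has_line_deriv_eqI, (rule d line_deriv_radial_imag hol_family_dpart \<Theta> x that)+) (simp add: that)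
qed

text \<open>The first-order operators compose to a fourth of the Laplacian, which annihilates the radial function.\<close>

lemma qdbar_monogenic_term:
  assumes \<Theta>: "axial_family h W \<Theta>" and x: "even_coords (upper_point x) \<in> W" and h: "h \<notin> L"
  shows "qdbar h (monogenic_term h L \<Theta>) x = 0"
proof -
  have hol: "hol_family W \<Theta>" using \<Theta> by (simp add: axial_family_def)
  let ?m = "im_quat (x $ h)" and ?V = "im_prod L x"
  note dd = line_deriv_monogenic_term[OF hol x h, THEN dir_deriv_eq]
  have "qdbar h (monogenic_term h L \<Theta>) x = (1/2) *\<^sub>R ((1/2) *\<^sub>R
     (?V * radial_at (dpart (Inl h) (dpart (Inl h) \<Theta>)) x + 6 *\<^sub>R (?V * radial_at (dpart (Inr h) \<Theta>) x)
       + (4 * (norm ?m)\<^sup>2) *\<^sub>R (?V * radial_at (dpart (Inr h) (dpart (Inr h) \<Theta>)) x)))"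
    unfolding qdbar_def
    using quat_dbar_identity[of ?m "?V * radial_at (dpart (Inl h) (dpart (Inl h) \<Theta>)) x"
        "?V * radial_at (dpart (Inl h) (dpart (Inr h) \<Theta>)) x" "?V * radial_at (dpart (Inr h) (dpart (Inr h) \<Theta>)) x"
        "?V * radial_at (dpart (Inr h) \<Theta>) x"]
    by (simp only: dd(1) dd(2)[of qi] dd(2)[of qj] dd(2)[of qk] quat_unit_sel im_quat_units im_quat_sel
        inner_im_quat_units axial_family_commute[OF \<Theta> x])
  also have "?V * radial_at (dpart (Inl h) (dpart (Inl h) \<Theta>)) x + 6 *\<^sub>R (?V * radial_at (dpart (Inr h) \<Theta>) x)
       + (4 * (norm ?m)\<^sup>2) *\<^sub>R (?V * radial_at (dpart (Inr h) (dpart (Inr h) \<Theta>)) x)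
     = ?V * (radial_at (dpart (Inl h) (dpart (Inl h) \<Theta>)) x + 6 *\<^sub>R radial_at (dpart (Inr h) \<Theta>) x
       + (4 * (norm ?m)\<^sup>2) *\<^sub>R radial_at (dpart (Inr h) (dpart (Inr h) \<Theta>)) x)"
    by (simp only: distrib_left mult_scaleR_right)
  finally show ?thesis by (simp only: axial_family_harmonic[OF \<Theta> x]) simp
qed

lemma dir_deriv_sum:
  assumes "\<And>i. i \<in> I \<Longrightarrow> \<exists>d. has_line_deriv (f i) v d x"
  shows "dir_deriv (\<lambda>x. \<Sum>i\<in>I. f i x) v x = (\<Sum>i\<in>I. dir_deriv (f i) v x)"
    and "has_line_deriv (\<lambda>x. \<Sum>i\<in>I. f i x) v (\<Sum>i\<in>I. dir_deriv (f i) v x) x"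
proof -
  have "has_line_deriv (f i) v (dir_deriv (f i) v x) x" if "i \<in> I" for i
    using assms[OF that] dir_deriv_eq by blast
  then show s: "has_line_deriv (\<lambda>x. \<Sum>i\<in>I. f i x) v (\<Sum>i\<in>I. dir_deriv (f i) v x) x"
    by (rule has_line_deriv_sum)
  then show "dir_deriv (\<lambda>x. \<Sum>i\<in>I. f i x) v x = (\<Sum>i\<in>I. dir_deriv (f i) v x)" by (rule dir_deriv_eq)
qed

lemma qdbar_sum:
  assumes "\<And>i u. i \<in> I \<Longrightarrow> u \<in> {1, qi, qj, qk} \<Longrightarrow> \<exists>d. has_line_deriv (f i) (axis h u) d x"
  shows "qdbar h (\<lambda>x. \<Sum>i\<in>I. f i x) x = (\<Sum>i\<in>I. qdbar h (f i) x)"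
proof -
  have "dir_deriv (\<lambda>x. \<Sum>i\<in>I. f i x) (axis h u) x = (\<Sum>i\<in>I. dir_deriv (f i) (axis h u) x)" if "u \<in> {1, qi, qj, qk}" for u
    using assms that by (intro dir_deriv_sum) auto
  then show ?thesis
    by (simp add: qdbar_def sum_distrib_left scaleR_sum_right sum.distrib scaleR_add_right)
qed

lemma qd_sum:
  assumes "\<And>i u. i \<in> I \<Longrightarrow> u \<in> {1, qi, qj, qk} \<Longrightarrow> \<exists>d. has_line_deriv (f i) (axis h u) d x"
  shows "qd h (\<lambda>x. \<Sum>i\<in>I. f i x) x = (\<Sum>i\<in>I. qd h (f i) x)"
proof -
  have "dir_deriv (\<lambda>x. \<Sum>i\<in>I. f i x) (axis h u) x = (\<Sum>i\<in>I. dir_deriv (f i) (axis h u) x)" if "u \<in> {1, qi, qj, qk}" for u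
    using assms that by (intro dir_deriv_sum) auto
  then show ?thesis
    by (simp add: qd_def sum_distrib_left scaleR_sum_right sum_subtractf scaleR_diff_right)
qed

lemma line_deriv_product:
  assumes \<Theta>: "hol_family W \<Theta>" and x: "even_coords (upper_point x) \<in> W" and h: "h \<notin> L"
  shows "has_line_deriv (\<lambda>x. im_prod L x * radial_at \<Theta> x) (axis h 1) (im_prod L x * radial_at (dpart (Inl h) \<Theta>) x) x"
    and "q0 u = 0 \<Longrightarrow> has_line_deriv (\<lambda>x. im_prod L x * radial_at \<Theta> x) (axis h u)
      ((2 * inner (im_quat (x $ h)) u) *\<^sub>R (im_prod L x * radial_at (dpart (Inr h) \<Theta>) x)) x"
proof -
  note d = has_line_deriv_mult line_deriv_im_prod[OF h]
  show "has_line_deriv (\<lambda>x. im_prod L x * radial_at \<Theta> x) (axis h 1) (im_prod L x * radial_at (dpart (Inl h) \<Theta>) x) x"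
    by (rule has_line_deriv_eqI, (rule d line_deriv_radial_real \<Theta> x)+) simp
  show "has_line_deriv (\<lambda>x. im_prod L x * radial_at \<Theta> x) (axis h u)
      ((2 * inner (im_quat (x $ h)) u) *\<^sub>R (im_prod L x * radial_at (dpart (Inr h) \<Theta>) x)) x" if "q0 u = 0"
    by (rule has_line_deriv_eqI, (rule d line_deriv_radial_imag \<Theta> x that)+) simp
qed

lemma quat_d_identity:
  assumes "q0 m = 0"
  shows "A - qi * ((2 * q1 m) *\<^sub>R B) - qj * ((2 * q2 m) *\<^sub>R B) - qk * ((2 * q3 m) *\<^sub>R B) = A - 2 *\<^sub>R (m * B)"
  using assms by (simp add: quat_eq_iff algebra_simps)

lemma qd_product:
  assumes \<Theta>: "hol_family W \<Theta>" and x: "even_coords (upper_point x) \<in> W" and h: "h \<notin> L"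
  shows "qd h (\<lambda>x. im_prod L x * radial_at \<Theta> x) x = monogenic_term h L \<Theta> x"
proof -
  note dd = line_deriv_product[OF \<Theta> x h, THEN dir_deriv_eq]
  let ?m = "im_quat (x $ h)" and ?V = "im_prod L x"
  have "qd h (\<lambda>x. im_prod L x * radial_at \<Theta> x) x = (1/2) *\<^sub>R (?V * radial_at (dpart (Inl h) \<Theta>) x - 2 *\<^sub>R (?m * (?V * radial_at (dpart (Inr h) \<Theta>) x)))"
    unfolding qd_def
    using quat_d_identity[of ?m "?V * radial_at (dpart (Inl h) \<Theta>) x" "?V * radial_at (dpart (Inr h) \<Theta>) x"]
    by (simp only: dd(1) dd(2)[of qi] dd(2)[of qj] dd(2)[of qk] quat_unit_sel im_quat_sel inner_im_quat_units)
  then show ?thesis by (simp add: monogenic_term_def scaleR_diff_right)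
qed

section \<open>Axial monogenicity of first-order derivatives\<close>

lemma qdbar_cong_open:
  assumes "\<And>u. u \<in> {1, qi, qj, qk} \<Longrightarrow> \<exists>d. has_line_deriv f (axis h u) d x"
    and "open U" "x \<in> U" "\<And>y. y \<in> U \<Longrightarrow> f y = g y"
  shows "qdbar h g x = qdbar h f x"
proof -
  have "dir_deriv g (axis h u) x = dir_deriv f (axis h u) x" if u: "u \<in> {1, qi, qj, qk}" for u
  proof -
    obtain d where d: "has_line_deriv f (axis h u) d x" using assms(1)[OF u] by blast
    have "has_line_deriv g (axis h u) d x" by (rule has_line_deriv_cong_open[OF d assms(2-4)])
    then show ?thesis using d by (simp add: dir_deriv_eq)
  qed
  then show ?thesis by (simp add: qdbar_def)
qed

lemma qdbar_scaleR:
  assumes "\<And>u. u \<in> {1, qi, qj, qk} \<Longrightarrow> \<exists>d. has_line_deriv f (axis h u) d x"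
  shows "qdbar h (\<lambda>x. \<kappa> *\<^sub>R f x) x = \<kappa> *\<^sub>R qdbar h f x"
proof -
  have "dir_deriv (\<lambda>x. \<kappa> *\<^sub>R f x) (axis h u) x = \<kappa> *\<^sub>R dir_deriv f (axis h u) x" if u: "u \<in> {1, qi, qj, qk}" for u
  proof -
    obtain d where d: "has_line_deriv f (axis h u) d x" using assms(1)[OF u] by blast
    show ?thesis using dir_deriv_eq[OF d] dir_deriv_eq[OF has_line_deriv_scaleR[OF d]] by simp
  qed
  then show ?thesis by (simp add: qdbar_def scaleR_add_right mult.commute)
qed

text \<open>Stem function of \<open>\<kappa>\<close> times the sum of the functions \<open>monogenic_term h L (\<Theta> L)\<close>: the part of such a term
  without \<open>Im x\<^sub>h\<close> has index \<open>L\<close>, the part with \<open>Im x\<^sub>h\<close> has index \<open>insert h L\<close>. The factor \<open>\<kappa>\<close> is \<open>1\<close> for the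
  first-order operator and \<open>- 4\<close> for the Laplacian.\<close>

definition monogenic_stem :: "real \<Rightarrow> 'n::finite \<Rightarrow> 'n set \<Rightarrow> ('n set \<Rightarrow> quat \<Rightarrow> complex^('n + 'n) \<Rightarrow> complex) \<Rightarrow> 'n stem" where
  "monogenic_stem \<kappa> h P \<Theta> z = (\<chi> M. (\<Prod>k\<in>M. Im (z $ k)) *\<^sub>R
     (if M \<in> Pow (- P) then (\<kappa> / 2) *\<^sub>R radial (dpart (Inl h) (\<Theta> M)) (even_coords z)
      else if M \<in> insert h ` Pow (- P) then (- \<kappa>) *\<^sub>R radial (dpart (Inr h) (\<Theta> (M - {h}))) (even_coords z)
      else 0))"

lemma stem_function_monogenic_stem:
  assumes W: "\<And>z. z \<in> D \<Longrightarrow> even_coords z \<in> W" and hP: "h \<in> P"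
    and \<Theta>: "\<And>L. L \<in> Pow (- P) \<Longrightarrow> hol_family W (\<Theta> L)"
  shows "stem_function D (monogenic_stem \<kappa> h P \<Theta>)"
  unfolding stem_function_def
proof (intro conjI ballI allI)
  have r: "continuous_on D (\<lambda>z. radial (dpart j (\<Theta> L)) (even_coords z))" if "L \<in> Pow (- P)" for L j
  proof -
    have "continuous_on D (\<lambda>z. dpart j (\<Theta> L) b (even_coords z))" for b
    proof (rule continuous_on_compose2[OF _ even_coords_continuous])
      show "continuous_on W (dpart j (\<Theta> L) b)"
        using hol_family_dpart[OF \<Theta>[OF that], of j] by (simp add: hol_family_def hol_def)
    qed (use W in auto)
    then show ?thesis unfolding radial_def by (intro continuous_intros)
  qed
  have "continuous_on D (\<lambda>z. monogenic_stem \<kappa> h P \<Theta> z $ M)" for M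
  proof -
    consider "M \<in> Pow (- P)" | "M \<notin> Pow (- P)" "M \<in> insert h ` Pow (- P)" | "M \<notin> Pow (- P)" "M \<notin> insert h ` Pow (- P)"
      by blast
    then show ?thesis
    proof cases
      case 1
      then show ?thesis
        by (simp only: monogenic_stem_def vec_lambda_beta if_True) (intro continuous_intros r)
    next
      case 2
      then have "M - {h} \<in> Pow (- P)" by auto
      then show ?thesis using 2
        by (simp only: monogenic_stem_def vec_lambda_beta if_True if_False) (intro continuous_intros r)
    next
      case 3
      then show ?thesis
        by (simp only: monogenic_stem_def vec_lambda_beta if_False) (intro continuous_intros)
    qed
  qed
  then have "continuous_on D (\<lambda>z. \<chi> M. monogenic_stem \<kappa> h P \<Theta> z $ M)" by (intro continuous_on_vec_lambda)
  then show "continuous_on D (monogenic_stem \<kappa> h P \<Theta>)" by simp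
next
  fix z :: "'a cvec" and M k
  have "(\<Prod>l\<in>M. Im (conj_at k z $ l)) = (-1) ^ card (M \<inter> {k}) * (\<Prod>l\<in>M. Im (z $ l))"
  proof (cases "k \<in> M")
    case True
    then show ?thesis by (subst (1 2) prod.remove[of M k]) (auto intro!: prod.cong)
  next
    case False
    then show ?thesis by (auto intro!: prod.cong)
  qed
  then have p: "(\<Prod>l\<in>M. Im (conj_at k z $ l)) *\<^sub>R q = (-1) ^ card (M \<inter> {k}) * ((\<Prod>l\<in>M. Im (z $ l)) *\<^sub>R q)" for q :: quat
    by (cases "k \<in> M") auto
  show "monogenic_stem \<kappa> h P \<Theta> (conj_at k z) $ M = (-1) ^ card (M \<inter> {k}) * monogenic_stem \<kappa> h P \<Theta> z $ M"
    unfolding monogenic_stem_def vec_lambda_beta p even_coords_conj_at ..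
qed

lemma slice_value_monogenic_stem:
  fixes h :: "'n::{finite,linorder}"
  assumes hP: "h \<in> P" "\<And>l. l \<notin> P \<Longrightarrow> h < l"
  shows "slice_value (monogenic_stem \<kappa> h P \<Theta>) x = \<kappa> *\<^sub>R (\<Sum>L\<in>Pow (- P). monogenic_term h L (\<Theta> L) x)"
proof -
  define f where "f = (\<lambda>M. (\<kappa> / 2) *\<^sub>R (im_prod M x * radial_at (dpart (Inl h) (\<Theta> M)) x))"
  define g where "g = (\<lambda>M. (- \<kappa>) *\<^sub>R (im_prod M x * radial_at (dpart (Inr h) (\<Theta> (M - {h}))) x))"
  let ?A = "Pow (- P)" and ?B = "insert h ` Pow (- P)"
  have disj: "?A \<inter> ?B = {}" using hP(1) by auto
  have "slice_value (monogenic_stem \<kappa> h P \<Theta>) x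
     = (\<Sum>M\<in>UNIV. (if M \<in> ?A then f M else 0) + (if M \<in> ?B then g M else 0))"
    unfolding slice_value_def
  proof (intro sum.cong refl)
    fix M :: "'n set"
    show "ordered_prod M (($) (upper_unit x)) * monogenic_stem \<kappa> h P \<Theta> (upper_point x) $ M
      = (if M \<in> ?A then f M else 0) + (if M \<in> ?B then g M else 0)"
    proof (cases "M \<in> ?A")
      case True
      then have "M \<notin> ?B" using disj by blast
      then show ?thesis using True unfolding monogenic_stem_def vec_lambda_beta f_def
        by (simp only: if_True if_False im_prod_upper_unit radial_at_def) (simp add: mult.commute)
    next
      case False
      then show ?thesis unfolding monogenic_stem_def vec_lambda_beta g_def
        by (cases "M \<in> ?B") (simp_all only: if_True if_False im_prod_upper_unit radial_at_def, simp_all add: mult.commute)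
    qed
  qed
  also have "\<dots> = sum f ?A + sum g ?B"
    using sum.inter_restrict[of UNIV f ?A] sum.inter_restrict[of UNIV g ?B] by (simp only: sum.distrib finite Int_UNIV_left)
  also have "sum g ?B = (\<Sum>L\<in>?A. (- \<kappa>) *\<^sub>R (im_quat (x $ h) * (im_prod L x * radial_at (dpart (Inr h) (\<Theta> L)) x)))"
  proof -
    have inj: "inj_on (insert h) ?A" using hP(1) by (auto simp: inj_on_def)
    have "g (insert h L) = (- \<kappa>) *\<^sub>R (im_quat (x $ h) * (im_prod L x * radial_at (dpart (Inr h) (\<Theta> L)) x))" if "L \<in> ?A" for L
    proof -
      have "h \<notin> L" "\<And>l. l \<in> L \<Longrightarrow> h < l" using that hP by auto
      moreover then have "insert h L - {h} = L" by auto
      ultimately show ?thesis by (simp add: g_def im_prod_insert mult.assoc)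
    qed
    then show ?thesis by (simp add: sum.reindex[OF inj] comp_def)
  qed
  also have "sum f ?A + \<dots> = \<kappa> *\<^sub>R (\<Sum>L\<in>?A. monogenic_term h L (\<Theta> L) x)"
    unfolding sum.distrib[symmetric] scaleR_sum_right
    by (intro sum.cong refl) (simp add: f_def monogenic_term_def scaleR_diff_right)
  finally show ?thesis .
qed

lemma monogenic_sum_axially_monogenic:
  fixes D :: "'n::{finite,linorder} cvec set"
  assumes D: "open D" "invariant_set D" and W: "\<And>z. z \<in> D \<Longrightarrow> even_coords z \<in> W"
    and hP: "h \<in> P" "\<And>l. l \<notin> P \<Longrightarrow> h < l"
    and \<Theta>: "\<And>L. L \<in> Pow (- P) \<Longrightarrow> axial_family h W (\<Theta> L)"
    and F: "\<And>x. x \<in> circularization D \<Longrightarrow> F x = \<kappa> *\<^sub>R (\<Sum>L\<in>Pow (- P). monogenic_term h L (\<Theta> L) x)"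
  shows "F \<in> axially_monogenic h D"
proof -
  let ?U = "circularization D"
  let ?T = "\<lambda>x. \<Sum>L\<in>Pow (- P). monogenic_term h L (\<Theta> L) x"
  have oU: "open ?U" by (rule open_circularization[OF D(2,1)])
  have xW: "even_coords (upper_point x) \<in> W" if "x \<in> ?U" for x
    using that circularization_eq[OF D(2)] W by blast
  have hol: "hol_family W (\<Theta> L)" if "L \<in> Pow (- P)" for L using \<Theta>[OF that] by (simp add: axial_family_def)
  have hL: "h \<notin> L" if "L \<in> Pow (- P)" for L using that hP by auto
  have Q: "stem_function D (monogenic_stem \<kappa> h P \<Theta>)"
    by (rule stem_function_monogenic_stem[OF W hP(1) hol])
  have "F \<in> slice_functions D"
    unfolding slice_functions_def induced_by_def
    using Q F induced_eq_slice_value[OF D(2) stem_parityI[OF Q]] slice_value_monogenic_stem[OF hP]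
    by (intro CollectI exI[of _ "monogenic_stem \<kappa> h P \<Theta>"]) auto
  moreover have "C1_on ?U F"
  proof (rule C1_on_cong[OF oU])
    have rad: "C1_on ?U (radial_at (dpart j (\<Theta> L)))" if "L \<in> Pow (- P)" for j L
      using hol_family_dpart[OF hol[OF that], of j] xW by (intro C1_on_radial_at[of W]) (auto simp: hol_family_def)
    have im: "C1_on ?U (im_prod L)" for L unfolding im_prod_def[abs_def] by (rule C1_on_ordered_prod)
    have imh: "C1_on ?U (\<lambda>x. im_quat (x $ h))"
      by (intro C1_on_bounded_linear bounded_linear_compose[OF bounded_linear_im_quat] bounded_linear_vec_nth)
    show "C1_on ?U (\<lambda>x. \<kappa> *\<^sub>R ?T x)"
      unfolding monogenic_term_def by (intro C1_on_scaleR C1_on_sum C1_on_diff C1_on_mult imh im rad)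
  qed (use F in auto)
  moreover have "qdbar h F x = 0" if x: "x \<in> ?U" for x
  proof -
    have ex: "\<exists>d. has_line_deriv (monogenic_term h L (\<Theta> L)) (axis h u) d x" if "L \<in> Pow (- P)" "u \<in> {1, qi, qj, qk}" for L u
    proof (cases "u = 1")
      case True
      then show ?thesis using line_deriv_monogenic_term(1)[OF hol[OF that(1)] xW[OF x] hL[OF that(1)]] by blast
    next
      case False
      then have "q0 u = 0" "im_quat u = u" using that(2) by auto
      from line_deriv_monogenic_term(2)[OF hol[OF that(1)] xW[OF x] hL[OF that(1)] this] show ?thesis by blast
    qed
    have exT: "\<exists>d. has_line_deriv ?T (axis h u) d x" if "u \<in> {1, qi, qj, qk}" for u
      by (rule exI, rule dir_deriv_sum(2), rule ex[OF _ that])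
    have exS: "\<exists>d. has_line_deriv (\<lambda>x. \<kappa> *\<^sub>R ?T x) (axis h u) d x" if u: "u \<in> {1, qi, qj, qk}" for u
    proof -
      obtain d where d: "has_line_deriv ?T (axis h u) d x" using exT[OF u] by blast
      show ?thesis by (rule exI, rule has_line_deriv_scaleR, rule d)
    qed
    have "qdbar h F x = qdbar h (\<lambda>x. \<kappa> *\<^sub>R ?T x) x"
      by (rule qdbar_cong_open[OF exS oU x]) (simp_all add: F)
    also have "\<dots> = \<kappa> *\<^sub>R qdbar h ?T x" by (rule qdbar_scaleR[OF exT])
    also have "qdbar h ?T x = (\<Sum>L\<in>Pow (- P). qdbar h (monogenic_term h L (\<Theta> L)) x)"
      by (rule qdbar_sum[OF ex])
    also have "\<dots> = 0"
      using qdbar_monogenic_term[OF \<Theta> xW[OF x] hL] by simp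
    finally show ?thesis by simp
  qed
  ultimately show ?thesis by (simp add: axially_monogenic_def)
qed

text \<open>With \<open>h\<close> at the head of the list, \<open>E\<^sub>K\<close> is by definition an odd quotient in the variable \<open>h\<close>.\<close>

lemma axial_family_stem_radial:
  assumes G: "regular_stem D G" and h: "h \<in> K" and hs: "hs = h # rest"
  shows "axial_family h (rep_dom hs D) (stem_radial G hs K)"
proof -
  have hol: "hol (rep_dom rest D) (stem_radial G rest K b)" for b by (rule stem_radial_hol[OF G])
  have e: "stem_radial G hs K b = odd_quot (Inl h) (Inr h) (stem_radial G rest K b)" for b
    using h by (simp add: stem_radial_def hs)
  show ?thesis
    unfolding axial_family_def hol_family_def
  proof (intro conjI allI ballI)
    show "hol (rep_dom hs D) (stem_radial G hs K b)" for b by (rule stem_radial_hol[OF G])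
    fix b w assume "w \<in> rep_dom hs D"
    then have w: "w \<in> root_dom (Inl h) (Inr h) (rep_dom rest D)" by (simp add: hs)
    show "pd (Inl h) (pd (Inl h) (stem_radial G hs K b)) w + 6 * pd (Inr h) (stem_radial G hs K b) w
       + 4 * w $ Inr h * pd (Inr h) (pd (Inr h) (stem_radial G hs K b)) w = 0"
      unfolding e by (rule odd_quot_harmonic[OF _ hol w]) simp
    show "pd (Inl h) (pd (Inr h) (stem_radial G hs K b)) w = pd (Inr h) (pd (Inl h) (stem_radial G hs K b)) w"
      unfolding e by (rule odd_quot_pd_commute[OF _ hol w]) simp
  qed
qed

lemma qd_spherical_sum:
  fixes D :: "'n::{finite,linorder} cvec set"
  assumes G: "regular_stem D G" and hs: "hs = h # rest" "distinct hs" "set hs = UNIV"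
    and hP: "h \<in> P" "\<And>l. l \<notin> P \<Longrightarrow> h < l"
    and S: "\<And>x. x \<in> circularization D \<Longrightarrow> S x = spherical_sum G hs P x"
  shows "qd_defined (circularization D) h S" and "qd h S \<in> axially_monogenic h D"
proof -
  let ?U = "circularization D"
  let ?\<Theta> = "\<lambda>L. stem_radial G hs (P \<union> L)"
  have D: "open D" "invariant_set D" using G by (auto simp: regular_stem_def)
  have oU: "open ?U" by (rule open_circularization[OF D(2,1)])
  have ax: "axial_family h (rep_dom hs D) (?\<Theta> L)" for L
    by (rule axial_family_stem_radial[OF G _ hs(1)]) (use hP in auto)
  have hol: "hol_family (rep_dom hs D) (?\<Theta> L)" for L using ax by (simp add: axial_family_def)
  have xW: "even_coords (upper_point x) \<in> rep_dom hs D" if "x \<in> ?U" for x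
    by (rule upper_point_dom[OF G hs(2,3) that])
  have hL: "h \<notin> L" if "L \<in> Pow (- P)" for L using that hP by auto
  have ex: "\<exists>d. has_line_deriv (\<lambda>x. im_prod L x * radial_at (?\<Theta> L) x) (axis h u) d x"
    if x: "x \<in> ?U" and L: "L \<in> Pow (- P)" and u: "u \<in> {1, qi, qj, qk}" for x L u
  proof (cases "u = 1")
    case True
    then show ?thesis using line_deriv_product(1)[OF hol xW[OF x] hL[OF L]] by blast
  next
    case False
    then have "q0 u = 0" using u by auto
    from line_deriv_product(2)[OF hol xW[OF x] hL[OF L] this] show ?thesis by blast
  qed
  have S': "spherical_sum G hs P = (\<lambda>x. \<Sum>L\<in>Pow (- P). im_prod L x * radial_at (?\<Theta> L) x)"
    by (simp add: fun_eq_iff spherical_sum_def)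
  have ld: "has_line_deriv S (axis h u) (dir_deriv (spherical_sum G hs P) (axis h u) x) x"
    if x: "x \<in> ?U" and u: "u \<in> {1, qi, qj, qk}" for x u
  proof (rule has_line_deriv_cong_open[OF _ oU x])
    show "has_line_deriv (spherical_sum G hs P) (axis h u) (dir_deriv (spherical_sum G hs P) (axis h u) x) x"
    proof -
      have "\<exists>d. has_line_deriv (spherical_sum G hs P) (axis h u) d x"
        unfolding S' by (rule exI, rule dir_deriv_sum(2), rule ex[OF x _ u])
      then obtain d where d: "has_line_deriv (spherical_sum G hs P) (axis h u) d x" by blast
      show ?thesis unfolding dir_deriv_eq[OF d] by (rule d)
    qed
  qed (simp add: S)
  show "qd_defined ?U h S"
    unfolding qd_defined_def dir_differentiable_on_def using has_line_deriv_differentiable[OF ld] by blast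
  have "qd h S x = 1 *\<^sub>R (\<Sum>L\<in>Pow (- P). monogenic_term h L (?\<Theta> L) x)" if x: "x \<in> ?U" for x
  proof -
    have "qd h S x = qd h (spherical_sum G hs P) x"
      using dir_deriv_eq[OF ld[OF x]] by (simp add: qd_def)
    also have "\<dots> = (\<Sum>L\<in>Pow (- P). qd h (\<lambda>x. im_prod L x * radial_at (?\<Theta> L) x) x)"
      unfolding S' by (rule qd_sum[OF ex[OF x]])
    also have "\<dots> = (\<Sum>L\<in>Pow (- P). monogenic_term h L (?\<Theta> L) x)"
      by (intro sum.cong refl qd_product[OF hol xW[OF x] hL])
    finally show ?thesis by simp
  qed
  then show "qd h S \<in> axially_monogenic h D"
    by (intro monogenic_sum_axially_monogenic[OF D even_coords_dom[OF D(2) _ hs(2,3)] hP ax])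
qed

section \<open>The Laplacian of a spherical component\<close>

text \<open>As a function of \<open>x\<^sub>h\<close> this is a slice function with even part \<open>\<Phi>\<close> and odd quotient \<open>\<Theta>\<close>, up to the factor
  \<open>im_prod L x\<close>, which does not involve \<open>x\<^sub>h\<close> if \<open>h \<notin> L\<close>.\<close>

definition slice_pair :: "'n::{finite,linorder} \<Rightarrow> 'n set \<Rightarrow> (quat \<Rightarrow> complex^('n + 'n) \<Rightarrow> complex) \<Rightarrow>
    (quat \<Rightarrow> complex^('n + 'n) \<Rightarrow> complex) \<Rightarrow> 'n qvec \<Rightarrow> quat" where
  "slice_pair h L \<Phi> \<Theta> x = im_prod L x * radial_at \<Phi> x + im_quat (x $ h) * (im_prod L x * radial_at \<Theta> x)"

definition slice_pair_deriv :: "quat \<Rightarrow> 'n::{finite,linorder} \<Rightarrow> 'n set \<Rightarrow> (quat \<Rightarrow> complex^('n + 'n) \<Rightarrow> complex) \<Rightarrow>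
    (quat \<Rightarrow> complex^('n + 'n) \<Rightarrow> complex) \<Rightarrow> 'n qvec \<Rightarrow> quat" where
  "slice_pair_deriv u h L \<Phi> \<Theta> x = (if u = 1 then slice_pair h L (dpart (Inl h) \<Phi>) (dpart (Inl h) \<Theta>) x
     else (2 * inner (im_quat (x $ h)) u) *\<^sub>R (im_prod L x * radial_at (dpart (Inr h) \<Phi>) x)
       + (im_quat (x $ h) * ((2 * inner (im_quat (x $ h)) u) *\<^sub>R (im_prod L x * radial_at (dpart (Inr h) \<Theta>) x))
         + u * (im_prod L x * radial_at \<Theta> x)))"

lemma line_deriv_slice_pair:
  assumes \<Phi>: "hol_family W \<Phi>" and \<Theta>: "hol_family W \<Theta>" and x: "even_coords (upper_point x) \<in> W" and h: "h \<notin> L"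
    and u: "u \<in> {1, qi, qj, qk}"
  shows "has_line_deriv (slice_pair h L \<Phi> \<Theta>) (axis h u) (slice_pair_deriv u h L \<Phi> \<Theta> x) x"
proof (cases "u = 1")
  case True
  note d = has_line_deriv_add has_line_deriv_mult line_deriv_im_prod[OF h] has_line_deriv_im
  show ?thesis unfolding slice_pair_def[abs_def] True
    by (rule has_line_deriv_eqI, (rule d line_deriv_radial_real \<Theta> \<Phi> x)+) (simp add: slice_pair_deriv_def slice_pair_def)
next
  case False
  then have u0: "q0 u = 0" "im_quat u = u" using u by auto
  note d = has_line_deriv_add has_line_deriv_mult line_deriv_im_prod[OF h] has_line_deriv_im
  show ?thesis unfolding slice_pair_def[abs_def]
    by (rule has_line_deriv_eqI, (rule d line_deriv_radial_imag \<Theta> \<Phi> x u0)+) (simp add: slice_pair_deriv_def False u0)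
qed

lemma line_deriv_slice_pair_deriv:
  assumes \<Phi>: "hol_family W \<Phi>" and \<Theta>: "hol_family W \<Theta>" and x: "even_coords (upper_point x) \<in> W" and h: "h \<notin> L"
  shows "has_line_deriv (slice_pair_deriv 1 h L \<Phi> \<Theta>) (axis h 1)
      (slice_pair h L (dpart (Inl h) (dpart (Inl h) \<Phi>)) (dpart (Inl h) (dpart (Inl h) \<Theta>)) x) x" (is ?real)
    and "u \<in> {qi, qj, qk} \<Longrightarrow> c = 2 * inner (im_quat (x $ h)) u \<Longrightarrow> has_line_deriv (slice_pair_deriv u h L \<Phi> \<Theta>) (axis h u)
      (c *\<^sub>R (c *\<^sub>R (im_prod L x * radial_at (dpart (Inr h) (dpart (Inr h) \<Phi>)) x)) + 2 *\<^sub>R (im_prod L x * radial_at (dpart (Inr h) \<Phi>) x)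
       + (u * (c *\<^sub>R (im_prod L x * radial_at (dpart (Inr h) \<Theta>) x))
         + (im_quat (x $ h) * (c *\<^sub>R (c *\<^sub>R (im_prod L x * radial_at (dpart (Inr h) (dpart (Inr h) \<Theta>)) x)) + 2 *\<^sub>R (im_prod L x * radial_at (dpart (Inr h) \<Theta>) x))
           + u * (c *\<^sub>R (im_prod L x * radial_at (dpart (Inr h) \<Theta>) x))))) x" (is "_ \<Longrightarrow> _ \<Longrightarrow> ?imag")
proof -
  have "slice_pair_deriv 1 h L \<Phi> \<Theta> = slice_pair h L (dpart (Inl h) \<Phi>) (dpart (Inl h) \<Theta>)"
    by (simp add: fun_eq_iff slice_pair_deriv_def)
  moreover have "slice_pair_deriv 1 h L (dpart (Inl h) \<Phi>) (dpart (Inl h) \<Theta>) x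
      = slice_pair h L (dpart (Inl h) (dpart (Inl h) \<Phi>)) (dpart (Inl h) (dpart (Inl h) \<Theta>)) x"
    by (simp add: slice_pair_deriv_def)
  ultimately show ?real
    using line_deriv_slice_pair[OF hol_family_dpart[OF \<Phi>] hol_family_dpart[OF \<Theta>] x h, of 1 "Inl h" "Inl h"] by simp
  show ?imag if u: "u \<in> {qi, qj, qk}" and c: "c = 2 * inner (im_quat (x $ h)) u"
  proof -
    have u0: "q0 u = 0" "im_quat u = u" "inner u u = 1" "u \<noteq> 1"
      using u by (auto simp: inner_quat_def)
    have e: "slice_pair_deriv u h L \<Phi> \<Theta> = (\<lambda>x. (2 * inner (im_quat (x $ h)) u) *\<^sub>R (im_prod L x * radial_at (dpart (Inr h) \<Phi>) x)
       + (im_quat (x $ h) * ((2 * inner (im_quat (x $ h)) u) *\<^sub>R (im_prod L x * radial_at (dpart (Inr h) \<Theta>) x))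
         + u * (im_prod L x * radial_at \<Theta> x)))"
      by (simp add: fun_eq_iff slice_pair_deriv_def u0)
    note d = has_line_deriv_add has_line_deriv_scaleR2[OF has_line_deriv_im_inner] line_deriv_product(2)[OF _ x h u0(1)]
      has_line_deriv_mult[OF has_line_deriv_im] has_line_deriv_mult[OF has_line_deriv_const]
    show ?thesis unfolding e
      by (rule has_line_deriv_eqI, (rule d hol_family_dpart \<Theta> \<Phi>)+) (simp add: u0 c algebra_simps)
  qed
qed

text \<open>Fueter's theorem for one variable: the Laplacian of \<open>a\<close> is \<open>- 2 \<partial>\<^sub>u b\<close>, that of \<open>b\<close> vanishes, and together with
  the cross term this is a multiple of the conjugate first-order derivative of \<open>b\<close>.\<close>

lemma laplace_slice_pair:
  assumes \<Phi>: "hol_family W \<Phi>" and \<Theta>: "axial_family h W \<Theta>" and x: "even_coords (upper_point x) \<in> W" and h: "h \<notin> L"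
    and rel: "\<And>b w. w \<in> W \<Longrightarrow> pd (Inl h) (pd (Inl h) (\<Phi> b)) w + 6 * pd (Inr h) (\<Phi> b) w
       + 4 * w $ Inr h * pd (Inr h) (pd (Inr h) (\<Phi> b)) w = - 2 * pd (Inl h) (\<Theta> b) w"
  shows "(\<Sum>u\<in>{1, qi, qj, qk}. dir_deriv (slice_pair_deriv u h L \<Phi> \<Theta>) (axis h u) x) = (- 4) *\<^sub>R monogenic_term h L \<Theta> x"
proof -
  have hol: "hol_family W \<Theta>" using \<Theta> by (simp add: axial_family_def)
  let ?m = "im_quat (x $ h)" and ?V = "im_prod L x"
  let ?a = "\<lambda>\<Psi>. radial_at (dpart (Inl h) (dpart (Inl h) \<Psi>)) x"
  let ?s = "\<lambda>\<Psi>. radial_at (dpart (Inr h) \<Psi>) x"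
  let ?ss = "\<lambda>\<Psi>. radial_at (dpart (Inr h) (dpart (Inr h) \<Psi>)) x"
  note dd = line_deriv_slice_pair_deriv[OF \<Phi> hol x h, THEN dir_deriv_eq]
  have r\<Phi>: "?a \<Phi> + 6 *\<^sub>R ?s \<Phi> + (4 * (norm ?m)\<^sup>2) *\<^sub>R ?ss \<Phi> = (- 2) *\<^sub>R radial_at (dpart (Inl h) \<Theta>) x"
    by (rule radial_relation[OF _ refl]) (use rel[OF x] in \<open>simp add: dpart_def\<close>)
  have r\<Theta>: "?a \<Theta> + 6 *\<^sub>R ?s \<Theta> + (4 * (norm ?m)\<^sup>2) *\<^sub>R ?ss \<Theta> = 0"
    by (rule axial_family_harmonic[OF \<Theta> x])
  have V: "?V * A + 6 *\<^sub>R (?V * B) + c *\<^sub>R (?V * C) = ?V * (A + 6 *\<^sub>R B + c *\<^sub>R C)" for A B C c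
    by (simp add: distrib_left)
  have "(\<Sum>u\<in>{1, qi, qj, qk}. dir_deriv (slice_pair_deriv u h L \<Phi> \<Theta>) (axis h u) x)
     = dir_deriv (slice_pair_deriv 1 h L \<Phi> \<Theta>) (axis h 1) x + dir_deriv (slice_pair_deriv qi h L \<Phi> \<Theta>) (axis h qi) x
     + dir_deriv (slice_pair_deriv qj h L \<Phi> \<Theta>) (axis h qj) x + dir_deriv (slice_pair_deriv qk h L \<Phi> \<Theta>) (axis h qk) x"
    by (simp add: add.assoc)
  also have "\<dots> = (?V * ?a \<Phi> + 6 *\<^sub>R (?V * ?s \<Phi>) + (4 * (norm ?m)\<^sup>2) *\<^sub>R (?V * ?ss \<Phi>))
     + ?m * (?V * ?a \<Theta> + 6 *\<^sub>R (?V * ?s \<Theta>) + (4 * (norm ?m)\<^sup>2) *\<^sub>R (?V * ?ss \<Theta>)) + 4 *\<^sub>R (?m * (?V * ?s \<Theta>))"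
    unfolding dd(1) dd(2)[of qi, OF _ refl, simplified] dd(2)[of qj, OF _ refl, simplified] dd(2)[of qk, OF _ refl, simplified]
      slice_pair_def
    using quat_laplace_identity[of ?m "?V * ?a \<Phi>" "?V * ?a \<Theta>" "?V * ?ss \<Phi>" "?V * ?s \<Phi>" "?V * ?s \<Theta>" "?V * ?ss \<Theta>"]
    by simp
  also have "\<dots> = (- 4) *\<^sub>R monogenic_term h L \<Theta> x"
    unfolding V r\<Phi> r\<Theta> by (simp add: monogenic_term_def scaleR_diff_right)
  finally show ?thesis .
qed

text \<open>The index \<open>L\<close> is paired with \<open>insert h L\<close>; because \<open>h\<close> precedes \<open>L\<close>, the vector part of \<open>x\<^sub>h\<close> factors out on
  the left.\<close>

lemma spherical_sum_slice_pairs: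
  fixes h :: "'n::{finite,linorder}"
  assumes h: "h \<notin> P" "\<And>l. l \<notin> insert h P \<Longrightarrow> h < l"
  shows "spherical_sum G hs P x = (\<Sum>L\<in>Pow (- insert h P).
     slice_pair h L (stem_radial G hs (P \<union> L)) (stem_radial G hs (insert h P \<union> L)) x)"
proof -
  let ?A = "Pow (- insert h P)"
  let ?f = "\<lambda>L. im_prod L x * radial_at (stem_radial G hs (P \<union> L)) x"
  have "- P = insert h (- insert h P)" using h(1) by auto
  then have "Pow (- P) = ?A \<union> insert h ` ?A" by (metis Pow_insert)
  moreover have "?A \<inter> insert h ` ?A = {}" by auto
  ultimately have "spherical_sum G hs P x = sum ?f ?A + sum ?f (insert h ` ?A)"
    unfolding spherical_sum_def by (simp add: sum.union_disjoint)
  also have "sum ?f (insert h ` ?A) = (\<Sum>L\<in>?A. ?f (insert h L))"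
    by (subst sum.reindex) (auto simp: inj_on_def)
  also have "sum ?f ?A + \<dots> = (\<Sum>L\<in>?A. slice_pair h L (stem_radial G hs (P \<union> L)) (stem_radial G hs (insert h P \<union> L)) x)"
    unfolding sum.distrib[symmetric]
  proof (intro sum.cong refl)
    fix L assume "L \<in> ?A"
    then have "im_prod (insert h L) x = im_quat (x $ h) * im_prod L x"
      using h by (intro im_prod_insert) auto
    moreover have "P \<union> insert h L = insert h P \<union> L" by auto
    ultimately show "?f L + ?f (insert h L) = slice_pair h L (stem_radial G hs (P \<union> L)) (stem_radial G hs (insert h P \<union> L)) x"
      by (simp only: slice_pair_def mult.assoc)
  qed
  finally show ?thesis .
qed

text \<open>Up to the factor \<open>- 4\<close>, the Laplacian is the first-order derivative of the spherical derivative with respect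
  to \<open>insert h P\<close>, so its monogenicity is that of the same sum of monogenic terms.\<close>

lemma qlaplace_spherical_sum:
  fixes D :: "'n::{finite,linorder} cvec set"
  assumes G: "regular_stem D G" and hs: "hs = h # rest" "distinct hs" "set hs = UNIV"
    and hP: "h \<notin> P" "\<And>l. l \<notin> insert h P \<Longrightarrow> h < l"
    and S: "\<And>x. x \<in> circularization D \<Longrightarrow> S x = spherical_sum G hs P x"
  shows "qlaplace_defined (circularization D) h S" and "qlaplace h S \<in> axially_monogenic h D"
proof -
  let ?U = "circularization D"
  let ?P = "insert h P"
  let ?\<Theta> = "\<lambda>L. stem_radial G hs (?P \<union> L)" and ?\<Phi> = "\<lambda>L. stem_radial G hs (P \<union> L)"
  have D: "open D" "invariant_set D" using G by (auto simp: regular_stem_def)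
  have oU: "open ?U" by (rule open_circularization[OF D(2,1)])
  have ax: "axial_family h (rep_dom hs D) (?\<Theta> L)" for L
    by (rule axial_family_stem_radial[OF G _ hs(1)]) auto
  have hol: "hol_family (rep_dom hs D) (?\<Theta> L)" "hol_family (rep_dom hs D) (?\<Phi> L)" for L
    using stem_radial_hol[OF G] by (auto simp: hol_family_def)
  have xW: "even_coords (upper_point x) \<in> rep_dom hs D" if "x \<in> ?U" for x
    by (rule upper_point_dom[OF G hs(2,3) that])
  have hL: "h \<notin> L" if "L \<in> Pow (- ?P)" for L using that by auto
  have rel: "pd (Inl h) (pd (Inl h) (?\<Phi> L b)) w + 6 * pd (Inr h) (?\<Phi> L b) w
       + 4 * w $ Inr h * pd (Inr h) (pd (Inr h) (?\<Phi> L b)) w = - 2 * pd (Inl h) (?\<Theta> L b) w"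
    if L: "L \<in> Pow (- ?P)" and w: "w \<in> rep_dom hs D" for L b w
  proof -
    have r: "h \<notin> set rest" using hs by simp
    have "stem_radial G rest (?P \<union> L) b = stem_radial G rest (P \<union> L) b"
      unfolding stem_radial_def by (rule stem_rep_cong) (use r in auto)
    moreover have "?\<Phi> L b = even_part (Inl h) (Inr h) (stem_radial G rest (P \<union> L) b)"
      "?\<Theta> L b = odd_quot (Inl h) (Inr h) (stem_radial G rest (?P \<union> L) b)"
      using hL[OF L] hP(1) by (simp_all add: stem_radial_def hs(1))
    ultimately show ?thesis
      using even_part_laplacian[OF _ stem_radial_hol[OF G], of "Inl h" "Inr h" w rest "P \<union> L" b] w hs(1) by simp
  qed
  define S1 where "S1 = (\<lambda>u x. \<Sum>L\<in>Pow (- ?P). slice_pair_deriv u h L (?\<Phi> L) (?\<Theta> L) x)"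
  have ld: "has_line_deriv S (axis h u) (S1 u x) x" if x: "x \<in> ?U" and u: "u \<in> {1, qi, qj, qk}" for x u
  proof (rule has_line_deriv_cong_open[OF _ oU x])
    show "has_line_deriv (\<lambda>x. \<Sum>L\<in>Pow (- ?P). slice_pair h L (?\<Phi> L) (?\<Theta> L) x) (axis h u) (S1 u x) x"
      unfolding S1_def by (intro has_line_deriv_sum line_deriv_slice_pair[OF hol(2,1) xW[OF x] hL u])
    show "(\<Sum>L\<in>Pow (- ?P). slice_pair h L (?\<Phi> L) (?\<Theta> L) y) = S y" if "y \<in> ?U" for y
      unfolding S[OF that] by (rule spherical_sum_slice_pairs[OF hP, symmetric])
  qed
  have ex: "\<exists>d. has_line_deriv (slice_pair_deriv u h L (?\<Phi> L) (?\<Theta> L)) (axis h u) d x"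
    if x: "x \<in> ?U" and u: "u \<in> {1, qi, qj, qk}" and L: "L \<in> Pow (- ?P)" for x u L
  proof (cases "u = 1")
    case True
    then show ?thesis using line_deriv_slice_pair_deriv(1)[OF hol(2,1) xW[OF x] hL[OF L]] by blast
  next
    case False
    then have "u \<in> {qi, qj, qk}" using u by auto
    from line_deriv_slice_pair_deriv(2)[OF hol(2,1) xW[OF x] hL[OF L] this refl] show ?thesis by blast
  qed
  have ld2: "has_line_deriv (dir_deriv S (axis h u)) (axis h u)
      (\<Sum>L\<in>Pow (- ?P). dir_deriv (slice_pair_deriv u h L (?\<Phi> L) (?\<Theta> L)) (axis h u) x) x"
    if x: "x \<in> ?U" and u: "u \<in> {1, qi, qj, qk}" for x u
  proof (rule has_line_deriv_cong_open[OF _ oU x])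
    show "has_line_deriv (S1 u) (axis h u)
       (\<Sum>L\<in>Pow (- ?P). dir_deriv (slice_pair_deriv u h L (?\<Phi> L) (?\<Theta> L)) (axis h u) x) x"
      unfolding S1_def by (rule dir_deriv_sum(2)[OF ex[OF x u]])
    show "S1 u y = dir_deriv S (axis h u) y" if "y \<in> ?U" for y
      using dir_deriv_eq[OF ld[OF that u]] by simp
  qed
  show "qlaplace_defined ?U h S"
    unfolding qlaplace_defined_def dir_differentiable_on_def
    using has_line_deriv_differentiable[OF ld] has_line_deriv_differentiable[OF ld2] by blast
  have lap: "qlaplace h S x = (- 4) *\<^sub>R (\<Sum>L\<in>Pow (- ?P). monogenic_term h L (?\<Theta> L) x)" if x: "x \<in> ?U" for x
  proof -
    have "qlaplace h S x = (\<Sum>u\<in>{1, qi, qj, qk}. \<Sum>L\<in>Pow (- ?P). dir_deriv (slice_pair_deriv u h L (?\<Phi> L) (?\<Theta> L)) (axis h u) x)"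
      unfolding qlaplace_def by (intro sum.cong refl dir_deriv_eq[OF ld2[OF x]])
    also have "\<dots> = (\<Sum>L\<in>Pow (- ?P). \<Sum>u\<in>{1, qi, qj, qk}. dir_deriv (slice_pair_deriv u h L (?\<Phi> L) (?\<Theta> L)) (axis h u) x)"
      by (rule sum.swap)
    also have "\<dots> = (\<Sum>L\<in>Pow (- ?P). (- 4) *\<^sub>R monogenic_term h L (?\<Theta> L) x)"
      by (intro sum.cong refl laplace_slice_pair[OF hol(2) ax xW[OF x] hL] rel)
    finally show ?thesis by (simp only: scaleR_sum_right)
  qed
  show "qlaplace h S \<in> axially_monogenic h D"
    by (rule monogenic_sum_axially_monogenic[OF D even_coords_dom[OF D(2) _ hs(2,3)] insertI1 hP(2) ax lap])
qed

section \<open>The ordered indices and the theorem\<close>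

lemma idx_less:
  assumes "1 \<le> i" "i < j" "j \<le> CARD('n)"
  shows "(idx i :: 'n::{finite,linorder}) < idx j"
proof -
  have "sorted_wrt (<) (sorted_list_of_set (UNIV :: 'n set))" by simp
  then show ?thesis unfolding idx_def
    by (rule sorted_wrt_nth_less) (use assms in auto)
qed

lemma idx_surj: "\<exists>i. 1 \<le> i \<and> i \<le> CARD('n) \<and> l = (idx i :: 'n::{finite,linorder})"
proof -
  have "l \<in> set (sorted_list_of_set (UNIV :: 'n set))" by simp
  then obtain i where "i < length (sorted_list_of_set (UNIV :: 'n set))" "sorted_list_of_set UNIV ! i = l"
    unfolding in_set_conv_nth by blast
  then show ?thesis by (intro exI[of _ "Suc i"]) (auto simp: idx_def)
qed

lemma idx_less_outside_seg:
  assumes "1 \<le> m" "m \<le> CARD('n)" "l \<notin> seg m"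
  shows "idx m < (l :: 'n::{finite,linorder})"
proof -
  obtain i where i: "1 \<le> i" "i \<le> CARD('n)" "l = idx i" using idx_surj by blast
  then have "m < i" using assms(3) by (force simp: seg_def)
  then show ?thesis using idx_less[of m i] assms i by simp
qed

lemma idx_Suc_notin_seg:
  assumes "Suc m \<le> CARD('n)"
  shows "(idx (Suc m) :: 'n::{finite,linorder}) \<notin> seg m"
proof
  assume "(idx (Suc m) :: 'n) \<in> seg m"
  then obtain i where i: "1 \<le> i" "i \<le> m" "(idx (Suc m) :: 'n) = idx i" by (auto simp: seg_def)
  then show False using idx_less[of i "Suc m", where 'n='n] assms by simp
qed

lemma seg_Suc: "seg (Suc m) = insert (idx (Suc m)) (seg m)"
  by (simp add: seg_def atLeastAtMostSuc_conv)

theorem proposition4p4: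
  fixes D :: "'n::{finite,linorder} cvec set"
    and f :: "'n qvec \<Rightarrow> quat"
    and m :: nat
  assumes "open D" and "invariant_set D"
    and "f \<in> slice_regular D"
    and "m \<in> {1..CARD('n) - 1}"
  shows "\<forall>K\<in>Pow (seg m). let S = spherical_component D m K f in
      (qd_defined (circularization D) (idx m) S \<and>
       qd (idx m) S \<in> axially_monogenic (idx m) D) \<and>
      (qlaplace_defined (circularization D) (idx (m + 1)) S \<and>
       qlaplace (idx (m + 1)) S \<in> axially_monogenic (idx (m + 1)) D)"
proof
  fix K :: "'n set"
  define S where "S = spherical_component D m K f"
  define G where "G = stem_of D (slice_prod D (coord_prod D K) f)"
  have G: "regular_stem D G" unfolding G_def by (rule regular_stem_product[OF assms(2,1,3)])
  \<comment> \<open>Every enumeration of the indices computes the same component; the one that starts with \<open>h\<close> exhibits its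
    dependence on \<open>x\<^sub>h\<close>.\<close>
  define others where "others = (\<lambda>h::'n. h # sorted_list_of_set (- {h}))"
  have others: "others h = h # sorted_list_of_set (- {h})" "distinct (others h)" "set (others h) = UNIV" for h
    by (auto simp: others_def)
  have S: "S x = spherical_sum G (others h) (seg m) x" if "x \<in> circularization D" for x h
    unfolding S_def G_def by (rule spherical_component_eq_sum[OF assms(1-3) others(2,3) that])
  have m: "1 \<le> m" "Suc m \<le> CARD('n)" using assms(4) by auto
  have "idx m \<in> (seg m :: 'n set)" using m by (auto simp: seg_def)
  note 1 = qd_spherical_sum[OF G others this idx_less_outside_seg S]
  note 2 = qlaplace_spherical_sum[OF G others idx_Suc_notin_seg[OF m(2)] _ S]
  have "idx (Suc m) < l" if "l \<notin> insert (idx (Suc m)) (seg m)" for l :: 'n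
    using idx_less_outside_seg[of "Suc m" l] m that by (simp add: seg_Suc)
  note 2 = 2[OF this]
  show "let S = spherical_component D m K f in
      (qd_defined (circularization D) (idx m) S \<and>
       qd (idx m) S \<in> axially_monogenic (idx m) D) \<and>
      (qlaplace_defined (circularization D) (idx (m + 1)) S \<and>
       qlaplace (idx (m + 1)) S \<in> axially_monogenic (idx (m + 1)) D)"
    unfolding Let_def S_def[symmetric] using 1 2 m by simp
qed

end
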